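(* For a biconed graph $G^{A,B}$ with graphic matroid $\Delta=\mathcal{M}(G^{A,B})$, distinguished basis $T_0$, and a total order $<$ on $E(\Delta)\setminus T_0$, let $\mathcal{O}(\Delta,T_0,<)$ be the pure order ideal of monomials $\prod_{e\in F}x_e^{\omega(e)}$, where $(F,\omega)$ ranges over all $2$-weighted forests of $G^{A,B}_{\mathrm{red}}$. Then this assignment, from based matroids arising from biconed graphs to pure order ideals, satisfies the following conditions for every such $(\Delta,T_0,<)$: (1) The variables of $\mathcal{O}(\Delta,T_0,<)$ are $\{x_i : i\in E(\Delta)\setminus T_0\}$. (2) Every monomial in $\mathcal{O}(\Delta,T_0,<)$ is supported on a set of the form $\{x_i : i\in I\}$ for some independent set $I$ of $\Delta$ with $I\cap T_0=\varnothing$. (3) For each independent set $I$ of $\Delta$ disjoint from $T_0$ and each $j$, there are exactly $h_j(\Gamma_I)$ monomials in $\mathcal{O}(\Delta,T_0,<)$ of degree $|I|+j$ and support $\{x_i : i\in I\}$. (4) For each independent set $I$ of $\Delta$ disjoint from $T_0$, the restriction of $\mathcal{O}(\Delta,T_0,<)$ to the variables $\{x_i: i\in I\}$ (i.e. the set of its monomials involving only these variables) is $\mathcal{O}(\Delta|_{T_0\cup I},T_0,<)$.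
   Context: Graphs are finite and undirected, possibly with loops and parallel edges. Biconed graph: let $G$ be a graph and $A,B\subseteq V(G)$ (not necessarily disjoint) with $A\cup B=V(G)$. The biconing $G^{A,B}$ of $G$ is obtained by adding two new vertices $0$ and $\overline{0}$ and the edges $0\overline{0}$, $0a$ for all $a\in A$, and $\overline{0}b$ for all $b\in B$. A biconed graph is any graph so obtained (with this data). Put $\overline{A}:=B\setminus A$, so $V(G)=A\sqcup\overline{A}$. Let $T_0$ be the spanning tree of $G^{A,B}$ with edges $0\overline{0}$, $0u$ ($u\in A$) and $\overline{0}v$ ($v\in\overline{A}$). Let $G^{A,B}_{\mathrm{red}}$ be the graph obtained from $G^{A,B}$ by deleting the edges of $T_0$ and the vertex $0$ (so its vertex set is $V(G)\cup\{\overline{0}\}$). Weighted forests: for a set $F\subseteq E(G^{A,B}_{\mathrm{red}})$ with a weighting $\omega:F\to\mathbb{N}_{\ge 1}$, regard $F$ as a spanning subgraph of $G^{A,B}_{\mathrm{red}}$ (all vertices included, isolated vertices being components). The excess weight of a connected component $S$ is $\delta_{\overline{0}\in S}+\sum_{e\in S}(\omega(e)-1)$, where $\delta_{\overline{0}\in S}$ is $1$ if $\overline{0}$ is a vertex of $S$ and $0$ otherwise. An edge $e\in F$ is called a weighted edge if $\omega(e)\ge 2$. An edge of $G^{A,B}_{\mathrm{red}}$ is crossing if it joins a vertex of $A$ to a vertex of $\overline{A}\cup\{\overline{0}\}$. A $2$-weighted forest of $G^{A,B}_{\mathrm{red}}$ is such a pair $(F,\omega)$ satisfying: (C0) $F$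 is acyclic; (C1) at most one component has excess weight $2$; (C2) every other component has excess weight $0$ or $1$; (C3) in a component of excess weight $2$ not containing $\overline{0}$, the number of crossing edges in the unique shortest path containing all weighted edges of the component is odd; in a component of excess weight $2$ containing $\overline{0}$, the number of crossing edges in the shortest path containing both the weighted edge and $\overline{0}$ is odd. The empty set $F=\varnothing$ is allowed. Matroid notions: the graphic matroid $\mathcal{M}(H)$ has ground set $E(H)$ and independent sets the acyclic edge sets. A based matroid is a triple $(\Delta,B_0,<)$ with $\Delta$ a matroid (identified with its collection of independent sets), $B_0$ a basis, and $<$ a total order on $E(\Delta)\setminus B_0$. For an independent set $I$ with $I\cap B_0=\varnothing$, $\Gamma_I$ is the matroid on ground set $B_0$ whose independent sets are the subsets $U\subseteq B_0$ with $U\cup I\in\Delta$. $\Delta|_X$ denotes restriction to $X$. For $I$ independent and disjoint from $T_0$, the matroid $\mathcal{M}(G^{A,B})|_{T_0\cup I}$ is the graphic matroid of the subgraph of $G^{A,B}$ with all its vertices and edge set $T_0\cup I$; this is the biconed graph $G'^{A,B'}$, where $G'$ has vertex set $V(G)$ and edge set $I\cap E(G)$, and $B'=\overline{A}\cup\{b\in A\cap B:\overline{0}b\in I\}$, with the same tree $T_0$; the order $<$ is restricted to $I$. For a matroid of rank $d$, let $f_{i-1}$ be the number of independent sets of size $i$; the $h$-vector $(h_0,\dots,h_d)$ is defined by $\sum_{i=0}^d f_{i-1}(t-1)^{d-i}=\sum_{k=0}^d h_k t^{d-k}$, with $h_j:=0$ for $j>d$. An order ideal of monomials is a set of monomials closed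 under divisors; it is pure if all its maximal elements (under divisibility) have the same degree. Saying that the variables of an order ideal are a given set means that it is a set of monomials in the polynomial ring on those variables. *)

theory Defs
  imports "HOL-Library.Multiset" "HOL-Computational_Algebra.Polynomial"
begin

section \<open>Multigraphs\<close>

text \<open>Undirected graphs with loops and parallel edges: \<open>ends e\<close> is the set of endpoints of the
  edge \<open>e\<close>, a singleton exactly when \<open>e\<close> is a loop.\<close>

record ('v, 'e) mgraph =
  verts :: "'v set"
  edges :: "'e set"
  ends :: "'e \<Rightarrow> 'v set"

definition fin_mgraph :: "('v, 'e) mgraph \<Rightarrow> bool" where
  "fin_mgraph G \<longleftrightarrow> finite (verts G) \<and> finite (edges G) \<and>
     (\<forall>e\<in>edges G. ends G e \<subseteq> verts G \<and> card (ends G e) \<in> {1, 2})"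

definition spanning_subgraph :: "('v, 'e) mgraph \<Rightarrow> 'e set \<Rightarrow> ('v, 'e) mgraph" where
  "spanning_subgraph G F = \<lparr>verts = verts G, edges = F, ends = ends G\<rparr>"

text \<open>A walk is given by its vertex sequence and its edge sequence.\<close>

definition walk :: "('v, 'e) mgraph \<Rightarrow> 'v list \<Rightarrow> 'e list \<Rightarrow> bool" where
  "walk G vs es \<longleftrightarrow> length vs = Suc (length es) \<and> set vs \<subseteq> verts G \<and> set es \<subseteq> edges G \<and>
     (\<forall>i<length es. ends G (es ! i) = {vs ! i, vs ! Suc i})"

definition path :: "('v, 'e) mgraph \<Rightarrow> 'v list \<Rightarrow> 'e list \<Rightarrow> bool" where
  "path G vs es \<longleftrightarrow> walk G vs es \<and> distinct vs"

text \<open>Loops are cycles of length 1 and pairs of parallel edges are cycles of length 2; distinctness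
  of the edges prevents going back and forth along one edge from being a cycle.\<close>

definition cycle :: "('v, 'e) mgraph \<Rightarrow> 'v list \<Rightarrow> 'e list \<Rightarrow> bool" where
  "cycle G vs es \<longleftrightarrow> walk G vs es \<and> es \<noteq> [] \<and> hd vs = last vs \<and> distinct (tl vs) \<and> distinct es"

definition acyclic_set :: "('v, 'e) mgraph \<Rightarrow> 'e set \<Rightarrow> bool" where
  "acyclic_set G F \<longleftrightarrow> (\<nexists>vs es. cycle (spanning_subgraph G F) vs es)"

definition reachable :: "('v, 'e) mgraph \<Rightarrow> 'v \<Rightarrow> 'v \<Rightarrow> bool" where
  "reachable G u v \<longleftrightarrow> (\<exists>vs es. walk G vs es \<and> hd vs = u \<and> last vs = v)"

text \<open>Connected components, as vertex sets.\<close>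

definition components :: "('v, 'e) mgraph \<Rightarrow> 'v set set" where
  "components G = {{v. reachable G u v} | u. u \<in> verts G}"


section \<open>Matroids\<close>

record 'a matroid =
  ground :: "'a set"
  indep :: "'a set set"

definition is_matroid :: "'a matroid \<Rightarrow> bool" where
  "is_matroid M \<longleftrightarrow> finite (ground M) \<and> indep M \<subseteq> Pow (ground M) \<and> {} \<in> indep M \<and>
     (\<forall>I\<in>indep M. \<forall>J. J \<subseteq> I \<longrightarrow> J \<in> indep M) \<and>
     (\<forall>I\<in>indep M. \<forall>J\<in>indep M. card I < card J \<longrightarrow> (\<exists>x\<in>J - I. insert x I \<in> indep M))"

definition is_basis :: "'a matroid \<Rightarrow> 'a set \<Rightarrow> bool" where
  "is_basis M B \<longleftrightarrow> B \<in> indep M \<and> (\<forall>I\<in>indep M. B \<subseteq> I \<longrightarrow> I = B)"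

definition matroid_rank :: "'a matroid \<Rightarrow> nat" where
  "matroid_rank M = Max (card ` indep M)"

definition matroid_restrict :: "'a matroid \<Rightarrow> 'a set \<Rightarrow> 'a matroid" where
  "matroid_restrict M X = \<lparr>ground = ground M \<inter> X, indep = {I \<in> indep M. I \<subseteq> X}\<rparr>"

definition graphic_matroid :: "('v, 'e) mgraph \<Rightarrow> 'e matroid" where
  "graphic_matroid G = \<lparr>ground = edges G, indep = {F. F \<subseteq> edges G \<and> acyclic_set G F}\<rparr>"

text \<open>Total orders are reflexive relations in the sense of \<^const>\<open>linear_order_on\<close>.\<close>

definition based_matroid :: "'a matroid \<Rightarrow> 'a set \<Rightarrow> 'a rel \<Rightarrow> bool" where
  "based_matroid M B\<^sub>0 r \<longleftrightarrow> is_matroid M \<and> is_basis M B\<^sub>0 \<and> linear_order_on (ground M - B\<^sub>0) r"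

definition Gamma :: "'a matroid \<Rightarrow> 'a set \<Rightarrow> 'a set \<Rightarrow> 'a matroid" where
  "Gamma M B\<^sub>0 I = \<lparr>ground = B\<^sub>0, indep = {U. U \<subseteq> B\<^sub>0 \<and> U \<union> I \<in> indep M}\<rparr>"

text \<open>\<open>indep_count M i\<close> is the entry of the \<open>f\<close>-vector usually written with index \<open>i - 1\<close>.\<close>

definition indep_count :: "'a matroid \<Rightarrow> nat \<Rightarrow> nat" where
  "indep_count M i = card {I \<in> indep M. card I = i}"

text \<open>With \<open>d\<close> the rank, \<open>h\<^sub>k\<close> is the coefficient of \<open>t\<^bsup>d-k\<^esup>\<close> in
  \<open>\<Sum>i\<le>d. f\<^bsub>i-1\<^esub> (t - 1)\<^bsup>d-i\<^esup>\<close>; the polynomial \<open>t - 1\<close> is \<open>[:-1, 1:]\<close>.\<close>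

definition h_vector :: "'a matroid \<Rightarrow> nat \<Rightarrow> int" where
  "h_vector M k = (let d = matroid_rank M in
     if k \<le> d
     then coeff (\<Sum>i\<le>d. smult (int (indep_count M i)) ([:-1, 1:] ^ (d - i))) (d - k)
     else 0)"


section \<open>Order ideals of monomials\<close>

text \<open>Monomials are finite multisets of variables: \<^const>\<open>count\<close> gives the exponents,
  \<^const>\<open>size\<close> the degree, \<^const>\<open>set_mset\<close> the support, and \<^const>\<open>subseteq_mset\<close> is
  divisibility. The variable \<open>x\<^sub>e\<close> is identified with its index \<open>e\<close>.\<close>

definition order_ideal :: "'a multiset set \<Rightarrow> bool" where
  "order_ideal O' \<longleftrightarrow> (\<forall>m\<in>O'. \<forall>n. n \<subseteq># m \<longrightarrow> n \<in> O')"

definition maximal_monomials :: "'a multiset set \<Rightarrow> 'a multiset set" where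
  "maximal_monomials O' = {m \<in> O'. \<forall>n\<in>O'. m \<subseteq># n \<longrightarrow> n = m}"

definition pure_order_ideal :: "'a multiset set \<Rightarrow> bool" where
  "pure_order_ideal O' \<longleftrightarrow> order_ideal O' \<and>
     (\<forall>m\<in>maximal_monomials O'. \<forall>n\<in>maximal_monomials O'. size m = size n)"

definition monomials_in :: "'a set \<Rightarrow> 'a multiset set" where
  "monomials_in X = {m. set_mset m \<subseteq> X}"


section \<open>Biconed graphs\<close>

text \<open>\<open>Apex\<close> and \<open>ApexBar\<close> are the new vertices \<open>0\<close> and \<open>0\<close>-bar.\<close>

datatype 'v bvert = Apex | ApexBar | Base 'v

text \<open>\<open>Spine\<close> joins the two new vertices, \<open>Cone a\<close> joins \<open>Apex\<close> to \<open>a\<close>, and \<open>ConeBar b\<close> joins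
  \<open>ApexBar\<close> to \<open>b\<close>.\<close>

datatype ('v, 'e) bedge = Spine | Cone 'v | ConeBar 'v | BaseEdge 'e

fun bends :: "('v, 'e) mgraph \<Rightarrow> ('v, 'e) bedge \<Rightarrow> 'v bvert set" where
  "bends G Spine = {Apex, ApexBar}"
| "bends G (Cone a) = {Apex, Base a}"
| "bends G (ConeBar b) = {ApexBar, Base b}"
| "bends G (BaseEdge e) = Base ` ends G e"

definition biconing ::
  "('v, 'e) mgraph \<Rightarrow> 'v set \<Rightarrow> 'v set \<Rightarrow> ('v bvert, ('v, 'e) bedge) mgraph" where
  "biconing G A B =
     \<lparr>verts = {Apex, ApexBar} \<union> Base ` verts G,
      edges = {Spine} \<union> Cone ` A \<union> ConeBar ` B \<union> BaseEdge ` edges G,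
      ends = bends G\<rparr>"

definition biconing_data :: "('v, 'e) mgraph \<Rightarrow> 'v set \<Rightarrow> 'v set \<Rightarrow> bool" where
  "biconing_data G A B \<longleftrightarrow> fin_mgraph G \<and> A \<subseteq> verts G \<and> B \<subseteq> verts G \<and> A \<union> B = verts G"

definition base_tree :: "'v set \<Rightarrow> 'v set \<Rightarrow> ('v, 'e) bedge set" where
  "base_tree A B = {Spine} \<union> Cone ` A \<union> ConeBar ` (B - A)"

definition reduced ::
  "('v, 'e) mgraph \<Rightarrow> 'v set \<Rightarrow> 'v set \<Rightarrow> ('v bvert, ('v, 'e) bedge) mgraph" where
  "reduced G A B = (let H = biconing G A B in
     \<lparr>verts = verts H - {Apex},
      edges = {e \<in> edges H - base_tree A B. Apex \<notin> ends H e},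
      ends = ends H\<rparr>)"

text \<open>For \<open>I\<close> independent and disjoint from the tree, the subgraph of the biconed graph with all
  vertices and edge set \<open>T\<^sub>0 \<union> I\<close> is the biconing of \<open>sub_base G I\<close> along \<open>A\<close> and
  \<open>sub_coneset A B I\<close>.\<close>

definition sub_base :: "('v, 'e) mgraph \<Rightarrow> ('v, 'e) bedge set \<Rightarrow> ('v, 'e) mgraph" where
  "sub_base G I = spanning_subgraph G {e \<in> edges G. BaseEdge e \<in> I}"

definition sub_coneset :: "'v set \<Rightarrow> 'v set \<Rightarrow> ('v, 'e) bedge set \<Rightarrow> 'v set" where
  "sub_coneset A B I = (B - A) \<union> {b \<in> A \<inter> B. ConeBar b \<in> I}"


section \<open>Weighted forests\<close>

definition crossing ::
  "('v, 'e) mgraph \<Rightarrow> 'v set \<Rightarrow> 'v set \<Rightarrow> ('v, 'e) bedge \<Rightarrow> bool" where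
  "crossing G A B e \<longleftrightarrow>
     (\<exists>a\<in>Base ` A. \<exists>w\<in>Base ` (B - A) \<union> {ApexBar}. ends (reduced G A B) e = {a, w})"

definition component_edges :: "('v, 'e) mgraph \<Rightarrow> 'e set \<Rightarrow> 'v set \<Rightarrow> 'e set" where
  "component_edges H F S = {e \<in> F. ends H e \<subseteq> S}"

definition excess_weight ::
  "('v bvert, 'e) mgraph \<Rightarrow> 'e set \<Rightarrow> ('e \<Rightarrow> nat) \<Rightarrow> 'v bvert set \<Rightarrow> nat" where
  "excess_weight H F \<omega> S =
     (if ApexBar \<in> S then 1 else 0) + (\<Sum>e\<in>component_edges H F S. (\<omega> e - 1))"

definition weighted_edges ::
  "('v, 'e) mgraph \<Rightarrow> 'e set \<Rightarrow> ('e \<Rightarrow> nat) \<Rightarrow> 'v set \<Rightarrow> 'e set" where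
  "weighted_edges H F \<omega> S = {e \<in> component_edges H F S. \<omega> e \<ge> 2}"

definition path_containing ::
  "('v, 'e) mgraph \<Rightarrow> 'v set \<Rightarrow> 'e set \<Rightarrow> 'v list \<Rightarrow> 'e list \<Rightarrow> bool" where
  "path_containing H X W vs es \<longleftrightarrow> path H vs es \<and> X \<subseteq> set vs \<and> W \<subseteq> set es"

definition shortest_path_containing ::
  "('v, 'e) mgraph \<Rightarrow> 'v set \<Rightarrow> 'e set \<Rightarrow> 'v list \<Rightarrow> 'e list \<Rightarrow> bool" where
  "shortest_path_containing H X W vs es \<longleftrightarrow> path_containing H X W vs es \<and>
     (\<forall>vs' es'. path_containing H X W vs' es' \<longrightarrow> length es \<le> length es')"

text \<open>Condition (C3) for the component \<open>S\<close>. In an acyclic \<open>F\<close> the shortest path is unique up to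
  reversal, so its number of crossing edges is well defined.\<close>

definition odd_crossing ::
  "('v, 'e) mgraph \<Rightarrow> 'v set \<Rightarrow> 'v set \<Rightarrow> ('v, 'e) bedge set \<Rightarrow> (('v, 'e) bedge \<Rightarrow> nat) \<Rightarrow>
   'v bvert set \<Rightarrow> bool" where
  "odd_crossing G A B F \<omega> S \<longleftrightarrow> (let H = reduced G A B in
     \<exists>vs es. shortest_path_containing (spanning_subgraph H F)
               (if ApexBar \<in> S then {ApexBar} else {}) (weighted_edges H F \<omega> S) vs es \<and>
             odd (card {e \<in> set es. crossing G A B e}))"

definition two_weighted_forest ::
  "('v, 'e) mgraph \<Rightarrow> 'v set \<Rightarrow> 'v set \<Rightarrow> ('v, 'e) bedge set \<Rightarrow> (('v, 'e) bedge \<Rightarrow> nat) \<Rightarrow> bool"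
  where
  "two_weighted_forest G A B F \<omega> \<longleftrightarrow>
     (let H = reduced G A B; C = components (spanning_subgraph H F); ex = excess_weight H F \<omega> in
       F \<subseteq> edges H \<and> (\<forall>e\<in>F. \<omega> e \<ge> 1) \<and>
       acyclic_set H F \<and>
       (\<forall>S\<in>C. \<forall>S'\<in>C. ex S = 2 \<and> ex S' = 2 \<longrightarrow> S = S') \<and>
       (\<forall>S\<in>C. ex S \<noteq> 2 \<longrightarrow> ex S = 0 \<or> ex S = 1) \<and>
       (\<forall>S\<in>C. ex S = 2 \<longrightarrow> odd_crossing G A B F \<omega> S))"

text \<open>The order \<open>r\<close> is part of the based matroid but plays no role in the construction.\<close>

definition forest_ideal ::
  "('v, 'e) mgraph \<Rightarrow> 'v set \<Rightarrow> 'v set \<Rightarrow> ('v, 'e) bedge rel \<Rightarrow> ('v, 'e) bedge multiset set" where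
  "forest_ideal G A B r =
     {\<Sum>e\<in>F. replicate_mset (\<omega> e) e | F \<omega>. two_weighted_forest G A B F \<omega>}"

end

theory Submission
  imports Defs
begin

text \<open>Fix \<open>I\<close> and contract it: each component \<open>S\<close> becomes a vertex, and the tree edges correspond to
  the vertices other than \<open>0\<close>. A subset of them is independent in \<open>\<Gamma>\<^sub>I\<close> iff every \<open>S\<close> is attached at
  most once to each of \<open>0\<close> and \<open>0\<close>-bar and at most one component links \<open>0\<close> to \<open>0\<close>-bar. The excess
  weights of the 2-weighted forests with support \<open>I\<close> obey a constraint of the same shape. Both
  families therefore have generating functions
  \<open>(y + c) \<Prod>\<^sub>S (y + n\<^sub>S) + \<Sum>\<^sub>S d\<^sub>S \<Prod>\<^bsub>T \<noteq> S\<^esub> (y + n\<^sub>T)\<close>, with \<open>n\<^sub>S = |S|\<close> and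
  \<open>c = 1 + |S\<^sub>0 \<inter> A|\<close> on the matroid side (\<open>S\<^sub>0\<close> being the component of \<open>0\<close>-bar, left out of the
  products) and with both numbers smaller by one on the forest side, where edges are counted; the
  shift \<open>y = t - 1\<close> versus \<open>y = t\<close> in the definition of the \<open>h\<close>-vector makes them equal. That
  the coefficients \<open>d\<^sub>S\<close> agree is a bijection in trees: a pair of vertices of \<open>S\<close> on different sides
  is encoded by the two end edges of the path joining them, whose number of crossing edges is odd.

  Purity follows from computing the degree of a maximal monomial: it is the number of vertices of the
  reduced graph that are not isolated (up to loops, not counting \<open>0\<close>-bar), plus one if there is a
  crossing edge.\<close>

section \<open>Connectivity and forests\<close>

text \<open>Each vertex other than 0 owns exactly one tree edge: a vertex of \<open>A\<close> the
  one to 0, any other base vertex the one to 0-bar, and 0-bar the edge joining it to 0. The last one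
  is the 1 in c. A component other than that of 0-bar that is linked to both 0 and 0-bar is attached
  by a vertex of \<open>A\<close> and a vertex outside \<open>A\<close>, whence d_S = |S \<inter> A|
  * |S - A|. On the forest side the subset is replaced by the exponents lowered by one. Since one
  edge may carry excess 2, these form a multiset and not a set, so both counts are done for
  multisets. An edge is crossing exactly when its ends lie on different sides, hence the parity in
  (C3) depends only on the end vertices of the path; shortest paths are examined only where the
  given definitions are translated. For purity, maximal monomials with quite different supports have
  to be compared. Maximality forces excess 1 on every component except isolated vertices and one
  exceptional component, which exists as soon as some edge is crossing. Each edge of a forest lowers
  the number of components by one, so that number cancels from the degree.\<close>

definition adj :: "('e \<Rightarrow> 'v set) \<Rightarrow> 'e set \<Rightarrow> 'v rel" where
  "adj \<phi> F = {(u, v). \<exists>e\<in>F. \<phi> e = {u, v}}"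

abbreviation conn :: "('e \<Rightarrow> 'v set) \<Rightarrow> 'e set \<Rightarrow> 'v rel" where
  "conn \<phi> F \<equiv> (adj \<phi> F)\<^sup>*"

text \<open>The recursive counterpart of \<open>walk\<close>, free of indices and of the vertex set,
  so that paths can be cut, joined and reversed by induction; \<open>walk_iff_chain\<close> is the
  bridge.\<close>

fun chain :: "('e \<Rightarrow> 'v set) \<Rightarrow> 'e set \<Rightarrow> 'v list \<Rightarrow> 'e list \<Rightarrow> bool" where
  "chain \<phi> F [u] [] = True"
| "chain \<phi> F (u # v # vs) (e # es) = (e \<in> F \<and> \<phi> e = {u, v} \<and> chain \<phi> F (v # vs) es)"
| "chain \<phi> F _ _ = False"

lemma sym_adj: "sym (adj \<phi> F)"
  by (auto simp: adj_def sym_def insert_commute)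

lemma sym_conn: "sym (conn \<phi> F)"
  by (simp add: sym_adj sym_rtrancl)

lemma conn_sym: "(u, v) \<in> conn \<phi> F \<Longrightarrow> (v, u) \<in> conn \<phi> F"
  using sym_conn by (metis symD)

lemma conn_edge: "e \<in> F \<Longrightarrow> \<phi> e = {u, v} \<Longrightarrow> (u, v) \<in> conn \<phi> F"
  by (auto simp: adj_def)

lemma conn_mono: "F \<subseteq> F' \<Longrightarrow> (u, v) \<in> conn \<phi> F \<Longrightarrow> (u, v) \<in> conn \<phi> F'"
  by (rule subsetD[OF rtrancl_mono]) (auto simp: adj_def)

lemma chain_ne: "chain \<phi> F vs es \<Longrightarrow> vs \<noteq> []"
  by (induction \<phi> F vs es rule: chain.induct) auto

lemma chain_edges: "chain \<phi> F vs es \<Longrightarrow> set es \<subseteq> F"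
  by (induction \<phi> F vs es rule: chain.induct) auto

lemma chain_length: "chain \<phi> F vs es \<Longrightarrow> length vs = Suc (length es)"
  by (induction \<phi> F vs es rule: chain.induct) auto

lemma chain_mono: "chain \<phi> F vs es \<Longrightarrow> set es \<subseteq> F' \<Longrightarrow> chain \<phi> F' vs es"
  by (induction \<phi> F vs es rule: chain.induct) auto

lemma chain_ends: "chain \<phi> F vs es \<Longrightarrow> e \<in> set es \<Longrightarrow> \<phi> e \<subseteq> set vs"
  by (induction \<phi> F vs es rule: chain.induct) auto

lemma chain_verts: "chain \<phi> F vs es \<Longrightarrow> es \<noteq> [] \<Longrightarrow> set vs \<subseteq> (\<Union>e\<in>set es. \<phi> e)"
proof (induction \<phi> F vs es rule: chain.induct)
  case (2 \<phi> F u v vs e es)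
  then show ?case by (cases es; cases vs) auto
qed auto

lemma chain_verts_subset:
  assumes "chain \<phi> F vs es" "es \<noteq> []" "\<And>e. e \<in> F \<Longrightarrow> \<phi> e \<subseteq> V"
  shows "set vs \<subseteq> V"
  using chain_verts[OF assms(1,2)] chain_edges[OF assms(1)] assms(3) by blast

lemma chain_Cons_iff:
  "chain \<phi> F vs (e # es) \<longleftrightarrow>
     (\<exists>u ws. vs = u # ws \<and> ws \<noteq> [] \<and> e \<in> F \<and> \<phi> e = {u, hd ws} \<and> chain \<phi> F ws es)"
  by (cases "(\<phi>, F, vs, e # es)" rule: chain.cases) auto

lemma chain_conn: "chain \<phi> F vs es \<Longrightarrow> x \<in> set vs \<Longrightarrow> (hd vs, x) \<in> conn \<phi> (set es)"
proof (induction \<phi> F vs es rule: chain.induct)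
  case (2 \<phi> F u v vs e es)
  show ?case
  proof (cases "x = u")
    case False
    then have "(v, x) \<in> conn \<phi> (set es)" using 2 by auto
    then have "(v, x) \<in> conn \<phi> (set (e # es))" by (rule conn_mono[rotated]) auto
    moreover have "(u, v) \<in> conn \<phi> (set (e # es))" by (rule conn_edge[of e]) (use 2 in auto)
    ultimately show ?thesis by auto
  qed auto
qed auto

lemma chain_append:
  assumes "chain \<phi> F vs es" "chain \<phi> F ws fs" "last vs = hd ws"
  shows "chain \<phi> F (vs @ tl ws) (es @ fs)"
  using assms
proof (induction \<phi> F vs es rule: chain.induct)
  case (1 \<phi> F u)
  then show ?case by (cases ws) auto
qed auto

lemma chain_snoc:
  assumes "chain \<phi> F vs es" "e \<in> F" "\<phi> e = {last vs, v}"
  shows "chain \<phi> F (vs @ [v]) (es @ [e])"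
  using chain_append[OF assms(1), of "[last vs, v]" "[e]"] assms by simp

lemma chain_rev: "chain \<phi> F vs es \<Longrightarrow> chain \<phi> F (rev vs) (rev es)"
proof (induction \<phi> F vs es rule: chain.induct)
  case (2 \<phi> F u v vs e es)
  then show ?case using chain_snoc[of \<phi> F "rev (v # vs)" "rev es" e u] by (auto simp: insert_commute)
qed auto

lemma chain_split:
  assumes "chain \<phi> F (xs @ x # ys) es"
  obtains fs gs where "es = fs @ gs" "chain \<phi> F (xs @ [x]) fs" "chain \<phi> F (x # ys) gs"
proof -
  have "\<exists>fs gs. es = fs @ gs \<and> chain \<phi> F (xs @ [x]) fs \<and> chain \<phi> F (x # ys) gs"
    using assms
  proof (induction xs arbitrary: es)
    case Nil
    then show ?case by (intro exI[of _ "[]"] exI[of _ es]) auto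
  next
    case (Cons u xs)
    obtain e es' where es: "es = e # es'" using chain_length[OF Cons.prems] by (cases es) auto
    with Cons.prems have *: "chain \<phi> F (xs @ x # ys) es'" "e \<in> F" "\<phi> e = {u, hd (xs @ x # ys)}"
      by (auto simp: chain_Cons_iff)
    obtain fs gs where "es' = fs @ gs" "chain \<phi> F (xs @ [x]) fs" "chain \<phi> F (x # ys) gs"
      using Cons.IH[OF *(1)] by blast
    then show ?case using * es
      by (intro exI[of _ "e # fs"] exI[of _ gs]) (auto simp: chain_Cons_iff hd_append)
  qed
  then show ?thesis using that by blast
qed

lemma walk_iff_chain:
  "walk (spanning_subgraph H F) vs es \<longleftrightarrow> chain (ends H) F vs es \<and> set vs \<subseteq> verts H"
proof (induction "ends H" F vs es rule: chain.induct)
  case (2 F u v vs e es)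
  have "walk (spanning_subgraph H F) (u # v # vs) (e # es) \<longleftrightarrow>
     e \<in> F \<and> ends H e = {u, v} \<and> u \<in> verts H \<and> walk (spanning_subgraph H F) (v # vs) es"
    unfolding walk_def spanning_subgraph_def by (auto simp: All_less_Suc2)
  then show ?case using 2 by auto
qed (auto simp: walk_def spanning_subgraph_def)

lemma conn_imp_chain:
  assumes "(u, v) \<in> conn \<phi> F"
  obtains vs es where "chain \<phi> F vs es" "distinct vs" "hd vs = u" "last vs = v"
proof -
  have "\<exists>vs es. chain \<phi> F vs es \<and> distinct vs \<and> hd vs = u \<and> last vs = v"
    using assms
  proof (induction rule: converse_rtrancl_induct)
    case base
    show ?case by (intro exI[of _ "[v]"] exI[of _ "[]"]) auto
  next
    case (step u w)
    obtain vs es where c: "chain \<phi> F vs es" "distinct vs" "hd vs = w" "last vs = v"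
      using step by blast
    obtain e where e: "e \<in> F" "\<phi> e = {u, w}" using step by (auto simp: adj_def)
    show ?case
    proof (cases "u \<in> set vs")
      case True
      \<comment> \<open>The path already visits \<open>u\<close>; its tail from there is the path
        wanted, and distinctness is kept.\<close>
      then obtain xs ys where vs: "vs = xs @ u # ys" by (meson split_list)
      then obtain fs gs where "chain \<phi> F (u # ys) gs" using c(1) chain_split by metis
      then show ?thesis using c vs by (intro exI[of _ "u # ys"] exI[of _ gs]) auto
    next
      case False
      then show ?thesis using c e chain_ne[OF c(1)]
        by (intro exI[of _ "u # vs"] exI[of _ "e # es"]) (auto simp: chain_Cons_iff)
    qed
  qed
  then show ?thesis using that by blast
qed

text \<open>A path never returns to its first vertex, so no later edge is incident to it. This is
  what lets the rest of a path survive the removal of any edge at its start, the device behind the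
  uniqueness lemmas on paths.\<close>

lemma distinct_chain_hd:
  assumes "chain \<phi> F (u # vs) (e # es)" "distinct (u # vs)" "u \<in> \<phi> f"
  shows "f \<notin> set es"
  using chain_ends[of \<phi> F vs es f] assms by (auto simp: chain_Cons_iff)

lemma distinct_chain_edges:
  "chain \<phi> F vs es \<Longrightarrow> distinct vs \<Longrightarrow> distinct es"
proof (induction \<phi> F vs es rule: chain.induct)
  case (2 \<phi> F u v vs e es)
  then show ?case using distinct_chain_hd[of \<phi> F u "v # vs" e es e] by auto
qed auto

section \<open>Connectivity classes and acyclic edge sets\<close>

definition cls :: "('e \<Rightarrow> 'v set) \<Rightarrow> 'e set \<Rightarrow> 'v \<Rightarrow> 'v set" where
  "cls \<phi> F u = conn \<phi> F `` {u}"

lemma in_cls: "v \<in> cls \<phi> F u \<longleftrightarrow> (u, v) \<in> conn \<phi> F"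
  by (simp add: cls_def)

lemma cls_self: "u \<in> cls \<phi> F u"
  by (simp add: in_cls)

lemma cls_eq_iff: "cls \<phi> F u = cls \<phi> F v \<longleftrightarrow> (u, v) \<in> conn \<phi> F"
proof
  assume "(u, v) \<in> conn \<phi> F"
  then show "cls \<phi> F u = cls \<phi> F v"
    using conn_sym[of u v \<phi> F] by (auto simp: in_cls intro: rtrancl_trans)
qed (metis in_cls cls_self)

lemma cls_eqI: "v \<in> cls \<phi> F u \<Longrightarrow> cls \<phi> F v = cls \<phi> F u"
  by (metis cls_eq_iff in_cls)

lemma conn_closed:
  assumes "(x, y) \<in> conn \<phi> F" "x \<in> Z"
    and "\<And>e u v. e \<in> F \<Longrightarrow> \<phi> e = {u, v} \<Longrightarrow> u \<in> Z \<Longrightarrow> v \<in> Z"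
  shows "y \<in> Z"
  using assms(1,2) by (induction rule: rtrancl_induct) (auto simp: adj_def intro: assms(3))

text \<open>A connection can be shortened until it uses \<open>e\<close> at most once, in one of the
  two directions.\<close>

lemma conn_insert:
  assumes "\<phi> e = {u, v}" "(x, y) \<in> conn \<phi> (insert e F)"
  shows "(x, y) \<in> conn \<phi> F \<or> (x, u) \<in> conn \<phi> F \<and> (v, y) \<in> conn \<phi> F \<or>
    (x, v) \<in> conn \<phi> F \<and> (u, y) \<in> conn \<phi> F"
  using assms(2)
proof (induction rule: rtrancl_induct)
  case (step y z)
  obtain f where f: "f \<in> insert e F" "\<phi> f = {y, z}" using step by (auto simp: adj_def)
  show ?case
  proof (cases "f \<in> F")
    case True
    then have "(y, z) \<in> conn \<phi> F" using f by (auto intro: conn_edge)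
    \<comment> \<open>Read as equations between classes, symmetry and transitivity of connectivity
      come for free.\<close>
    then show ?thesis using step.IH unfolding cls_eq_iff[symmetric] by auto
  next
    case False
    then have "y = u \<and> z = v \<or> y = v \<and> z = u" using f assms by (auto simp: doubleton_eq_iff)
    then show ?thesis using step.IH unfolding cls_eq_iff[symmetric] by auto
  qed
qed auto

text \<open>Acyclicity without cycles as lists: every edge is a bridge. A loop fails because its end
  is connected to itself by the empty path, and parallel edges fail because each bypasses the
  other.\<close>

definition forest :: "('e \<Rightarrow> 'v set) \<Rightarrow> 'e set \<Rightarrow> bool" where
  "forest \<phi> F \<longleftrightarrow> (\<forall>e\<in>F. \<forall>u v. \<phi> e = {u, v} \<longrightarrow> (u, v) \<notin> conn \<phi> (F - {e}))"

lemma forestD: "forest \<phi> F \<Longrightarrow> e \<in> F \<Longrightarrow> \<phi> e = {u, v} \<Longrightarrow> (u, v) \<notin> conn \<phi> (F - {e})"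
  by (auto simp: forest_def)

lemma forest_mono: "forest \<phi> F \<Longrightarrow> F' \<subseteq> F \<Longrightarrow> forest \<phi> F'"
  unfolding forest_def by (meson Diff_mono conn_mono subset_iff order_refl)

lemma forest_no_loop: "forest \<phi> F \<Longrightarrow> e \<in> F \<Longrightarrow> \<phi> e = {u, v} \<Longrightarrow> u \<noteq> v"
  using forestD by fastforce

text \<open>If an old edge \<open>f\<close> ceased to be a bridge, the bypass would run through
  \<open>e\<close>; closing it up with \<open>f\<close> itself would connect \<open>u\<close> and
  \<open>v\<close> inside \<open>F\<close>.\<close>

lemma forest_insert:
  assumes F: "forest \<phi> F" and uv: "\<phi> e = {u, v}" "(u, v) \<notin> conn \<phi> F"
  shows "forest \<phi> (insert e F)"
  unfolding forest_def
proof (intro ballI allI impI)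
  fix f x y assume f: "f \<in> insert e F" and xy: "\<phi> f = {x, y}"
  show "(x, y) \<notin> conn \<phi> (insert e F - {f})"
  proof (cases "f = e")
    case True
    have "(v, u) \<notin> conn \<phi> F" using uv conn_sym by metis
    then have "(x, y) \<notin> conn \<phi> F" using True uv xy by (auto simp: doubleton_eq_iff)
    then show ?thesis using True conn_mono[of "insert e F - {f}" F x y \<phi>] by auto
  next
    case False
    then have fF: "f \<in> F" using f by auto
    have sub: "(a, b) \<in> conn \<phi> (F - {f}) \<Longrightarrow> (a, b) \<in> conn \<phi> F" for a b
      by (rule conn_mono[rotated]) auto
    have c: "(x, y) \<in> conn \<phi> F" "(y, x) \<in> conn \<phi> F" using fF xy conn_edge conn_sym by metis+
    show ?thesis
    proof
      assume "(x, y) \<in> conn \<phi> (insert e F - {f})"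
      moreover have "insert e F - {f} = insert e (F - {f})" using False by auto
      ultimately have "(x, y) \<in> conn \<phi> (insert e (F - {f}))" by simp
      from conn_insert[of \<phi>, OF uv(1) this] forestD[OF F fF xy]
      have "(x, u) \<in> conn \<phi> F \<and> (v, y) \<in> conn \<phi> F \<or> (x, v) \<in> conn \<phi> F \<and> (u, y) \<in> conn \<phi> F"
        using sub[of x u] sub[of v y] sub[of x v] sub[of u y] by argo
      then show False using c(1) uv(2) unfolding cls_eq_iff[symmetric] by argo
    qed
  qed
qed

lemma forest_insert_iff:
  assumes "e \<notin> F" "\<phi> e = {u, v}"
  shows "forest \<phi> (insert e F) \<longleftrightarrow> forest \<phi> F \<and> (u, v) \<notin> conn \<phi> F"
proof
  assume *: "forest \<phi> (insert e F)"
  have "insert e F - {e} = F" using assms by auto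
  with forestD[OF *, of e u v] assms have "(u, v) \<notin> conn \<phi> F" by auto
  then show "forest \<phi> F \<and> (u, v) \<notin> conn \<phi> F" using forest_mono[OF *] by auto
qed (use assms forest_insert in metis)

text \<open>A cycle without its first edge is a bypass of that edge, and a bypass closes up to a
  cycle. The distinctness of edges required in \<open>cycle\<close> keeps the removed edge out of
  the rest.\<close>

lemma acyclic_set_iff_forest:
  assumes ends: "\<And>e. e \<in> F \<Longrightarrow> ends H e \<subseteq> verts H"
  shows "acyclic_set H F \<longleftrightarrow> forest (ends H) F"
proof
  assume ac: "acyclic_set H F"
  show "forest (ends H) F"
    unfolding forest_def
  proof (intro ballI allI impI notI)
    fix e u v assume e: "e \<in> F" "ends H e = {u, v}" "(u, v) \<in> conn (ends H) (F - {e})"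
    obtain vs es where c: "chain (ends H) (F - {e}) vs es" "distinct vs" "hd vs = v" "last vs = u"
      using conn_imp_chain[OF conn_sym[OF e(3)]] by metis
    have "chain (ends H) F (u # vs) (e # es)"
      using c e chain_ne[OF c(1)] chain_mono[OF c(1), of F] chain_edges[OF c(1)]
      by (auto simp: chain_Cons_iff)
    moreover have "set (u # vs) \<subseteq> verts H"
      by (rule chain_verts_subset[OF calculation _ ends]) auto
    moreover have "distinct (e # es)"
      using distinct_chain_edges[OF c(1,2)] chain_edges[OF c(1)] by auto
    ultimately have "cycle (spanning_subgraph H F) (u # vs) (e # es)"
      using c chain_ne[OF c(1)] by (auto simp: cycle_def walk_iff_chain)
    then show False using ac by (auto simp: acyclic_set_def)
  qed
next
  assume fo: "forest (ends H) F"
  show "acyclic_set H F"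
    unfolding acyclic_set_def
  proof (intro notI, elim exE)
    fix vs es assume cy: "cycle (spanning_subgraph H F) vs es"
    then obtain e es' where es: "es = e # es'" by (cases es) (auto simp: cycle_def)
    with cy obtain u ws where c: "vs = u # ws" "ws \<noteq> []" "e \<in> F" "ends H e = {u, hd ws}"
      "chain (ends H) F ws es'" by (auto simp: cycle_def walk_iff_chain chain_Cons_iff)
    have "last ws = u" "e \<notin> set es'" using cy c es by (auto simp: cycle_def)
    then have "(hd ws, u) \<in> conn (ends H) (set es')" using chain_conn[OF c(5), of u] c(2) by auto
    moreover have "set es' \<subseteq> F - {e}" using chain_edges[OF c(5)] \<open>e \<notin> set es'\<close> by auto
    ultimately have "(u, hd ws) \<in> conn (ends H) (F - {e})" using conn_mono conn_sym by metis
    then show False using forestD[OF fo c(3,4)] by auto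
  qed
qed

lemma reachable_iff_conn:
  assumes ends: "\<And>e. e \<in> F \<Longrightarrow> ends H e \<subseteq> verts H" and u: "u \<in> verts H"
  shows "reachable (spanning_subgraph H F) u v \<longleftrightarrow> (u, v) \<in> conn (ends H) F"
proof
  assume "reachable (spanning_subgraph H F) u v"
  then obtain vs es where c: "chain (ends H) F vs es" "hd vs = u" "last vs = v"
    by (auto simp: reachable_def walk_iff_chain)
  then have "(u, v) \<in> conn (ends H) (set es)" using chain_conn[OF c(1), of v] chain_ne[OF c(1)] by auto
  then show "(u, v) \<in> conn (ends H) F" by (rule conn_mono[OF chain_edges[OF c(1)]])
next
  assume "(u, v) \<in> conn (ends H) F"
  then obtain vs es where c: "chain (ends H) F vs es" "hd vs = u" "last vs = v"
    using conn_imp_chain by metis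
  have "set vs \<subseteq> verts H"
  proof (cases es)
    case Nil
    then show ?thesis using c u chain_length[OF c(1)] by (cases vs) auto
  next
    case (Cons e es')
    then show ?thesis using chain_verts_subset[OF c(1) _ ends] by auto
  qed
  then show "reachable (spanning_subgraph H F) u v"
    using c by (auto simp: reachable_def walk_iff_chain)
qed

lemma components_eq:
  assumes "\<And>e. e \<in> F \<Longrightarrow> ends H e \<subseteq> verts H"
  shows "components (spanning_subgraph H F) = cls (ends H) F ` verts H"
  using reachable_iff_conn[OF assms]
  by (auto simp: components_def cls_def spanning_subgraph_def Image_def)

lemma cls_insert:
  assumes "\<phi> e = {u, v}"
  shows "cls \<phi> (insert e F) x =
    (if x \<in> cls \<phi> F u \<union> cls \<phi> F v then cls \<phi> F u \<union> cls \<phi> F v else cls \<phi> F x)"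
proof -
  have sub: "(a, b) \<in> conn \<phi> F \<Longrightarrow> (a, b) \<in> conn \<phi> (insert e F)" for a b
    by (rule conn_mono[rotated]) auto
  have uv: "(u, v) \<in> conn \<phi> (insert e F)" using assms by (auto intro: conn_edge)
  have 1: "(x, y) \<in> conn \<phi> (insert e F) \<longleftrightarrow> (x, y) \<in> conn \<phi> F \<or>
    (x, u) \<in> conn \<phi> F \<and> (v, y) \<in> conn \<phi> F \<or> (x, v) \<in> conn \<phi> F \<and> (u, y) \<in> conn \<phi> F"
    (is "?l \<longleftrightarrow> ?r") for y
  proof
    show "?l \<Longrightarrow> ?r" by (rule conn_insert[of \<phi>, OF assms])
    assume ?r
    then show ?l using uv sub[of x y] sub[of x u] sub[of x v] sub[of u y] sub[of v y]
      unfolding cls_eq_iff[symmetric] by argo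
  qed
  show ?thesis
  proof (cases "x \<in> cls \<phi> F u \<union> cls \<phi> F v")
    case True
    have "y \<in> cls \<phi> (insert e F) x \<longleftrightarrow> y \<in> cls \<phi> F u \<union> cls \<phi> F v" for y
      using True unfolding Un_iff in_cls 1 unfolding cls_eq_iff[symmetric] by argo
    then show ?thesis using True by auto
  next
    case False
    have "y \<in> cls \<phi> (insert e F) x \<longleftrightarrow> y \<in> cls \<phi> F x" for y
      using False unfolding Un_iff in_cls 1 unfolding cls_eq_iff[symmetric] by argo
    then show ?thesis using False by auto
  qed
qed

lemma cls_image_insert:
  assumes uv: "\<phi> e = {u, v}" "u \<in> V" "v \<in> V"
  shows "cls \<phi> (insert e F) ` V =
    insert (cls \<phi> F u \<union> cls \<phi> F v) (cls \<phi> F ` V - {cls \<phi> F u, cls \<phi> F v})" (is "?L = ?R")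
proof
  show "?L \<subseteq> ?R"
  proof
    fix S assume "S \<in> ?L"
    then obtain x where x: "x \<in> V" "S = cls \<phi> (insert e F) x" by auto
    show "S \<in> ?R"
    proof (cases "x \<in> cls \<phi> F u \<union> cls \<phi> F v")
      case False
      then have "cls \<phi> F x \<noteq> cls \<phi> F u" "cls \<phi> F x \<noteq> cls \<phi> F v" using cls_self[of x \<phi> F] by auto
      then show ?thesis using x False by (simp add: cls_insert[of \<phi>, OF uv(1)])
    qed (use x in \<open>simp add: cls_insert[of \<phi>, OF uv(1)]\<close>)
  qed
  show "?R \<subseteq> ?L"
  proof
    fix S assume "S \<in> ?R"
    then consider "S = cls \<phi> F u \<union> cls \<phi> F v" | x where "x \<in> V" "S = cls \<phi> F x" "S \<noteq> cls \<phi> F u" "S \<noteq> cls \<phi> F v"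
      by auto
    then show "S \<in> ?L"
    proof cases
      case 1
      then have "S = cls \<phi> (insert e F) u" by (simp add: cls_insert[of \<phi>, OF uv(1)] cls_self)
      then show ?thesis using uv by auto
    next
      case 2
      then have "x \<notin> cls \<phi> F u" "x \<notin> cls \<phi> F v" using cls_eqI by metis+
      then have "S = cls \<phi> (insert e F) x" using 2 by (simp add: cls_insert[of \<phi>, OF uv(1)])
      then show ?thesis using 2 by auto
    qed
  qed
qed

lemma card_cls_insert:
  assumes uv: "\<phi> e = {u, v}" "u \<in> V" "v \<in> V" and n: "(u, v) \<notin> conn \<phi> F" and V: "finite V"
  shows "Suc (card (cls \<phi> (insert e F) ` V)) = card (cls \<phi> F ` V)"
proof -
  have ne: "cls \<phi> F u \<noteq> cls \<phi> F v" using n by (simp add: cls_eq_iff)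
  have "cls \<phi> F u \<union> cls \<phi> F v \<notin> cls \<phi> F ` V"
  proof
    assume "cls \<phi> F u \<union> cls \<phi> F v \<in> cls \<phi> F ` V"
    then obtain x where "cls \<phi> F u \<union> cls \<phi> F v = cls \<phi> F x" by auto
    then show False using ne cls_self cls_eqI by (metis UnI1 UnI2)
  qed
  moreover have "card (cls \<phi> F ` V - {cls \<phi> F u, cls \<phi> F v}) = card (cls \<phi> F ` V) - 2"
    using uv ne by (subst card_Diff_subset) auto
  moreover have "card {cls \<phi> F u, cls \<phi> F v} \<le> card (cls \<phi> F ` V)"
    using uv V by (intro card_mono) auto
  ultimately show ?thesis using ne V by (simp add: cls_image_insert[of \<phi>, OF uv])
qed

text \<open>Without edges every vertex is a class of its own, and each further edge of a forest
  merges two different classes.\<close>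

lemma forest_card:
  assumes "finite F" "finite V" "forest \<phi> F" "\<And>e. e \<in> F \<Longrightarrow> \<exists>u\<in>V. \<exists>v\<in>V. \<phi> e = {u, v}"
  shows "card F + card (cls \<phi> F ` V) = card V"
  using assms(1,3,4)
proof (induction F)
  case empty
  have "cls \<phi> {} = (\<lambda>x. {x})" by (auto simp: cls_def adj_def fun_eq_iff)
  then show ?case by (auto simp: card_image)
next
  case (insert e F)
  obtain u v where uv: "u \<in> V" "v \<in> V" "\<phi> e = {u, v}" using insert.prems by blast
  have "forest \<phi> F" "(u, v) \<notin> conn \<phi> F" using forest_insert_iff insert uv by metis+
  then show ?case using insert card_cls_insert[of \<phi>, OF uv(3,1,2) _ assms(2)] by fastforce
qed

lemma conn_subset:
  assumes "\<And>e u v. e \<in> J \<Longrightarrow> \<phi> e = {u, v} \<Longrightarrow> (u, v) \<in> conn \<phi> I" "(x, y) \<in> conn \<phi> J"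
  shows "(x, y) \<in> conn \<phi> I"
  using assms(2)
proof (induction rule: rtrancl_induct)
  case (step y z)
  then have "(y, z) \<in> conn \<phi> I" using assms(1) by (auto simp: adj_def)
  then show ?case using step.IH by (rule rtrancl_trans[rotated])
qed auto

text \<open>The classes of \<open>J\<close> refine those of \<open>I\<close>, so sending a class of
  \<open>J\<close> to the class of \<open>I\<close> of a chosen representative is onto.\<close>

lemma card_cls_mono:
  assumes "\<And>e u v. e \<in> J \<Longrightarrow> \<phi> e = {u, v} \<Longrightarrow> (u, v) \<in> conn \<phi> I" "finite V"
  shows "card (cls \<phi> I ` V) \<le> card (cls \<phi> J ` V)"
proof -
  have "cls \<phi> I (SOME x. x \<in> cls \<phi> J u) = cls \<phi> I u" for u
  proof -
    have "(SOME x. x \<in> cls \<phi> J u) \<in> cls \<phi> J u" by (rule someI, rule cls_self)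
    then have "(u, SOME x. x \<in> cls \<phi> J u) \<in> conn \<phi> J" by (simp add: in_cls)
    then have "(u, SOME x. x \<in> cls \<phi> J u) \<in> conn \<phi> I" by (rule conn_subset[rotated]) (rule assms(1))
    then show ?thesis by (simp add: cls_eq_iff conn_sym)
  qed
  then have "cls \<phi> I ` V = (\<lambda>S. cls \<phi> I (SOME x. x \<in> S)) ` (cls \<phi> J ` V)"
    by (simp add: image_image)
  then show ?thesis using assms(2) by (simp add: card_image_le)
qed

section \<open>The graphic matroid\<close>

lemma fin_mgraph_ends:
  assumes "fin_mgraph H" "e \<in> edges H"
  shows "\<exists>u\<in>verts H. \<exists>v\<in>verts H. ends H e = {u, v}"
proof -
  have *: "ends H e \<subseteq> verts H" "card (ends H e) = 1 \<or> card (ends H e) = 2"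
    using assms by (auto simp: fin_mgraph_def)
  from *(2) obtain u v where "ends H e = {u, v}"
    by (auto simp: card_1_singleton_iff card_2_iff)
  then show ?thesis using *(1) by auto
qed

lemma graphic_matroid_indep:
  assumes "fin_mgraph H"
  shows "F \<in> indep (graphic_matroid H) \<longleftrightarrow> F \<subseteq> edges H \<and> forest (ends H) F"
proof -
  have "acyclic_set H F \<longleftrightarrow> forest (ends H) F" if "F \<subseteq> edges H"
    using that assms by (intro acyclic_set_iff_forest) (auto simp: fin_mgraph_def)
  then show ?thesis by (auto simp: graphic_matroid_def)
qed

lemma is_matroid_graphic:
  assumes fin: "fin_mgraph H"
  shows "is_matroid (graphic_matroid H)"
  unfolding is_matroid_def
proof (intro conjI ballI allI impI)
  show "finite (ground (graphic_matroid H))" using fin by (auto simp: graphic_matroid_def fin_mgraph_def)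
  show "indep (graphic_matroid H) \<subseteq> Pow (ground (graphic_matroid H))"
    by (auto simp: graphic_matroid_def)
  show "{} \<in> indep (graphic_matroid H)"
    by (auto simp: graphic_matroid_indep[OF fin] forest_def)
  fix I assume I: "I \<in> indep (graphic_matroid H)"
  {
    fix J assume "J \<subseteq> I"
    then show "J \<in> indep (graphic_matroid H)" using I forest_mono
      by (auto simp: graphic_matroid_indep[OF fin])
  }
  fix J assume J: "J \<in> indep (graphic_matroid H)" and less: "card I < card J"
  have V: "finite (verts H)" "finite (edges H)" using fin by (auto simp: fin_mgraph_def)
  have IJ: "I \<subseteq> edges H" "forest (ends H) I" "J \<subseteq> edges H" "forest (ends H) J"
    using I J by (auto simp: graphic_matroid_indep[OF fin])
  have cI: "card I + card (cls (ends H) I ` verts H) = card (verts H)"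
    using IJ V finite_subset fin_mgraph_ends[OF fin] by (intro forest_card) (blast intro: finite_subset)+
  have cJ: "card J + card (cls (ends H) J ` verts H) = card (verts H)"
    using IJ V finite_subset fin_mgraph_ends[OF fin] by (intro forest_card) (blast intro: finite_subset)+
  show "\<exists>x\<in>J - I. insert x I \<in> indep (graphic_matroid H)"
  proof (rule ccontr)
    assume no: "\<not> ?thesis"
    \<comment> \<open>If no edge of \<open>J\<close> can be added to \<open>I\<close>, all edges of
      \<open>J\<close> run inside classes of \<open>I\<close>. Then \<open>I\<close> has at most as
      many classes as \<open>J\<close>, so by \<open>forest_card\<close> at least as many
      edges.\<close>
    have "(u, v) \<in> conn (ends H) I" if e: "e \<in> J" "ends H e = {u, v}" for e u v
    proof (cases "e \<in> I")
      case False
      then have "\<not> forest (ends H) (insert e I)"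
        using no e IJ by (auto simp: graphic_matroid_indep[OF fin])
      then show ?thesis using forest_insert[OF IJ(2) e(2)] by blast
    qed (use e conn_edge in metis)
    then have "card (cls (ends H) I ` verts H) \<le> card (cls (ends H) J ` verts H)"
      by (rule card_cls_mono[OF _ V(1)])
    then show False using cI cJ less by linarith
  qed
qed

section \<open>Paths in a forest and their end edges\<close>

lemma chain_conn2:
  assumes "chain \<phi> F vs es" "x \<in> set vs" "y \<in> set vs" "set es \<subseteq> F'"
  shows "(x, y) \<in> conn \<phi> F'"
proof -
  have "(hd vs, x) \<in> conn \<phi> F'" "(hd vs, y) \<in> conn \<phi> F'"
    by (rule conn_mono[OF assms(4)], rule chain_conn[OF assms(1)], fact)+
  then show ?thesis using conn_sym rtrancl_trans by metis
qed

lemma chain_edge_doubleton: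
  assumes "chain \<phi> F vs es" "e \<in> set es"
  obtains u v where "\<phi> e = {u, v}"
proof -
  have "\<exists>u v. \<phi> e = {u, v}"
    using assms by (induction \<phi> F vs es rule: chain.induct) auto
  then show ?thesis using that by blast
qed

text \<open>Take a path to \<open>b\<close>. If it avoids \<open>b'\<close>, append
  \<open>f\<close>; if it meets \<open>b'\<close>, stop there and walk along \<open>f\<close> to
  \<open>b\<close> instead.\<close>

lemma edge_path_from:
  assumes f: "f \<in> F" "\<phi> f = {b, b'}" "b \<noteq> b'" and c: "(r, b) \<in> conn \<phi> F"
  obtains vs es where "chain \<phi> F vs es" "distinct vs" "hd vs = r" "es \<noteq> []" "last es = f"
proof -
  obtain vs es where p: "chain \<phi> F vs es" "distinct vs" "hd vs = r" "last vs = b"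
    using conn_imp_chain[OF c] by metis
  show ?thesis
  proof (cases "b' \<in> set vs")
    case True
    then obtain xs ys where vs: "vs = xs @ b' # ys" by (meson split_list)
    then obtain fs gs where fs: "chain \<phi> F (xs @ [b']) fs" using p(1) chain_split by metis
    have "b \<notin> set (xs @ [b'])" using p vs f(3) by (cases ys rule: rev_cases) auto
    moreover have "chain \<phi> F ((xs @ [b']) @ [b]) (fs @ [f])"
      using f by (intro chain_snoc[OF fs]) auto
    ultimately show ?thesis
      using that[of "(xs @ [b']) @ [b]" "fs @ [f]"] p vs by (cases xs) auto
  next
    case False
    have "chain \<phi> F (vs @ [b']) (es @ [f])"
      using f p by (intro chain_snoc) auto
    then show ?thesis using that[of "vs @ [b']" "es @ [f]"] p False chain_ne[OF p(1)] by auto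
  qed
qed

text \<open>Start with a path from \<open>a\<close> that ends with \<open>f\<close>. If it does not
  begin with \<open>e\<close>, it avoids \<open>e\<close> altogether, hence also \<open>a'\<close>,
  as \<open>e\<close> is a bridge; so \<open>e\<close> can be put in front.\<close>

lemma edge_path_between:
  assumes fo: "forest \<phi> F" and e: "e \<in> F" "\<phi> e = {a, a'}" and f: "f \<in> F" "\<phi> f = {b, b'}"
    and c: "(a, b) \<in> conn \<phi> F" and ne: "e \<noteq> f"
  obtains vs es where "chain \<phi> F vs es" "distinct vs" "es \<noteq> []" "hd es = e" "last es = f"
proof -
  obtain vs es where p: "chain \<phi> F vs es" "distinct vs" "hd vs = a" "es \<noteq> []" "last es = f"
    using edge_path_from[OF f forest_no_loop[OF fo f] c] by metis
  show ?thesis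
  proof (cases "hd es = e")
    case False
    obtain ws where vs: "vs = a # ws" using p by (cases vs) auto
    obtain g gs where es: "es = g # gs" using p by (cases es) auto
    have "e \<notin> set gs" using distinct_chain_hd[of \<phi> F a ws g gs e] p vs es e by auto
    then have sub: "set es \<subseteq> F - {e}" using False es chain_edges[OF p(1)] by auto
    have "a' \<notin> set vs"
      using chain_conn2[OF p(1) _ _ sub, of a a'] forestD[OF fo e] vs by auto
    then show ?thesis using that[of "a' # vs" "e # es"] p e vs
      by (auto simp: chain_Cons_iff insert_commute)
  qed (use p that in blast)
qed

text \<open>With different first edges, one could follow the second path to the common end and the
  first one back, which bypasses the first edge of the first path.\<close>

lemma path_first_edge_unique:
  assumes fo: "forest \<phi> F"
    and p: "chain \<phi> F vs es" "distinct vs" "es \<noteq> []"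
    and q: "chain \<phi> F vs' es'" "distinct vs'" "es' \<noteq> []"
    and eq: "hd vs = hd vs'" "last vs = last vs'"
  shows "hd es = hd es'"
proof (rule ccontr)
  assume ne: "hd es \<noteq> hd es'"
  obtain e fs where es: "es = e # fs" using p by (cases es) auto
  obtain e' fs' where es': "es' = e' # fs'" using q by (cases es') auto
  obtain u ws where vs: "vs = u # ws" "ws \<noteq> []" "e \<in> F" "\<phi> e = {u, hd ws}" "chain \<phi> F ws fs"
    using p es by (auto simp: chain_Cons_iff)
  obtain ws' where vs': "vs' = u # ws'" "ws' \<noteq> []" "e' \<in> F" "\<phi> e' = {u, hd ws'}" "chain \<phi> F ws' fs'"
    using q es' eq vs by (auto simp: chain_Cons_iff)
  have "e \<notin> set fs" "e \<notin> set fs'"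
    using distinct_chain_hd[of \<phi> F u ws e fs e] distinct_chain_hd[of \<phi> F u ws' e' fs' e]
      p q es es' vs(1,4) vs'(1) by auto
  then have s: "set fs \<subseteq> F - {e}" "set fs' \<subseteq> F - {e}" using chain_edges vs(5) vs'(5) by blast+
  have "(u, hd ws') \<in> conn \<phi> (F - {e})" using conn_edge[of e' "F - {e}"] vs' ne es es' by auto
  moreover have "(hd ws', last ws') \<in> conn \<phi> (F - {e})" using chain_conn2[OF vs'(5) _ _ s(2)] vs'(2) by simp
  moreover have "(last ws, hd ws) \<in> conn \<phi> (F - {e})" using chain_conn2[OF vs(5) _ _ s(1)] vs(2) by simp
  moreover have "last ws = last ws'" using eq vs vs' by simp
  ultimately have "(u, hd ws) \<in> conn \<phi> (F - {e})" using rtrancl_trans by metis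
  then show False using forestD[OF fo vs(3,4)] by simp
qed

lemma chain_rev_simps:
  assumes "chain \<phi> F vs es" "es \<noteq> []"
  shows "hd (rev vs) = last vs" "last (rev vs) = hd vs" "hd (rev es) = last es" "last (rev es) = hd es"
  using assms chain_ne[OF assms(1)] by (auto simp: hd_rev last_rev)

lemma path_last_edge_unique:
  assumes fo: "forest \<phi> F"
    and p: "chain \<phi> F vs es" "distinct vs" "es \<noteq> []"
    and q: "chain \<phi> F vs' es'" "distinct vs'" "es' \<noteq> []"
    and eq: "hd vs = hd vs'" "last vs = last vs'"
  shows "last es = last es'"
  using path_first_edge_unique[OF fo chain_rev[OF p(1)] _ _ chain_rev[OF q(1)]] p q eq
    chain_rev_simps[OF p(1,3)] chain_rev_simps[OF q(1,3)] by auto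

text \<open>Otherwise the common first edge is traversed in opposite directions, and the rests of
  the two paths, which end at the same vertex, join its ends without it.\<close>

lemma path_hd_unique:
  assumes fo: "forest \<phi> F"
    and p: "chain \<phi> F vs es" "distinct vs" "es \<noteq> []"
    and q: "chain \<phi> F vs' es'" "distinct vs'" "es' \<noteq> []"
    and eq: "last vs = last vs'" "hd es = hd es'"
  shows "hd vs = hd vs'"
proof (rule ccontr)
  assume ne: "hd vs \<noteq> hd vs'"
  obtain e fs where es: "es = e # fs" using p by (cases es) auto
  obtain fs' where es': "es' = e # fs'" using q eq es by (cases es') auto
  obtain u ws where vs: "vs = u # ws" "ws \<noteq> []" "e \<in> F" "\<phi> e = {u, hd ws}" "chain \<phi> F ws fs"
    using p es by (auto simp: chain_Cons_iff)
  obtain u' ws' where vs': "vs' = u' # ws'" "ws' \<noteq> []" "\<phi> e = {u', hd ws'}" "chain \<phi> F ws' fs'"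
    using q es' eq vs by (auto simp: chain_Cons_iff)
  have u: "hd ws' = u" using ne vs vs' by (auto simp: doubleton_eq_iff)
  have "e \<notin> set fs" "e \<notin> set fs'"
    using distinct_chain_hd[of \<phi> F u ws e fs e] distinct_chain_hd[of \<phi> F u' ws' e fs' e]
      p q es es' vs(1,4) vs'(1,3) by auto
  then have s: "set fs \<subseteq> F - {e}" "set fs' \<subseteq> F - {e}" using chain_edges vs(5) vs'(4) by blast+
  have "(u, last ws') \<in> conn \<phi> (F - {e})"
    using chain_conn2[OF vs'(4) _ _ s(2)] vs'(2) u by (metis last_in_set list.set_sel(1))
  moreover have "(last ws, hd ws) \<in> conn \<phi> (F - {e})" using chain_conn2[OF vs(5) _ _ s(1)] vs(2) by simp
  moreover have "last ws = last ws'" using eq vs vs' by simp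
  ultimately have "(u, hd ws) \<in> conn \<phi> (F - {e})" using rtrancl_trans by metis
  then show False using forestD[OF fo vs(3,4)] by simp
qed

lemma path_last_unique:
  assumes fo: "forest \<phi> F"
    and p: "chain \<phi> F vs es" "distinct vs" "es \<noteq> []"
    and q: "chain \<phi> F vs' es'" "distinct vs'" "es' \<noteq> []"
    and eq: "hd vs = hd vs'" "last es = last es'"
  shows "last vs = last vs'"
  using path_hd_unique[OF fo chain_rev[OF p(1)] _ _ chain_rev[OF q(1)]] p q eq
    chain_rev_simps[OF p(1,3)] chain_rev_simps[OF q(1,3)] by auto

lemma single_edge_path:
  assumes p: "chain \<phi> F vs es" "distinct vs" "es \<noteq> []" and eq: "hd es = last es"
  shows "es = [hd es]"
proof -
  have "distinct es" using distinct_chain_edges[OF p(1,2)] .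
  then show ?thesis using p(3) eq by (cases es; cases "tl es" rule: rev_cases) auto
qed

text \<open>If the first edge were traversed in opposite directions, both rests would still reach
  the common last edge and so join the ends of the first edge without it. The end edges must differ,
  since a path of one edge can be traversed both ways.\<close>

lemma path_ends_unique:
  assumes fo: "forest \<phi> F"
    and p: "chain \<phi> F vs es" "distinct vs" "es \<noteq> []"
    and q: "chain \<phi> F vs' es'" "distinct vs'" "es' \<noteq> []"
    and eq: "hd es = hd es'" "last es = last es'" and ne: "hd es \<noteq> last es"
  shows "hd vs = hd vs'" "last vs = last vs'"
proof -
  show *: "hd vs = hd vs'"
  proof (rule ccontr)
    assume hd: "hd vs \<noteq> hd vs'"
    obtain e fs where es: "es = e # fs" using p by (cases es) auto
    obtain fs' where es': "es' = e # fs'" using q eq es by (cases es') auto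
    obtain u ws where vs: "vs = u # ws" "ws \<noteq> []" "e \<in> F" "\<phi> e = {u, hd ws}" "chain \<phi> F ws fs"
      using p es by (auto simp: chain_Cons_iff)
    obtain u' ws' where vs': "vs' = u' # ws'" "ws' \<noteq> []" "\<phi> e = {u', hd ws'}" "chain \<phi> F ws' fs'"
      using q es' eq vs by (auto simp: chain_Cons_iff)
    have u: "hd ws' = u" using hd vs vs' by (auto simp: doubleton_eq_iff)
    have "e \<notin> set fs" "e \<notin> set fs'"
      using distinct_chain_hd[of \<phi> F u ws e fs e] distinct_chain_hd[of \<phi> F u' ws' e fs' e]
        p q es es' vs(1,4) vs'(1,3) by auto
    then have s: "set fs \<subseteq> F - {e}" "set fs' \<subseteq> F - {e}" using chain_edges vs(5) vs'(4) by blast+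
    have ne': "fs \<noteq> []" "fs' \<noteq> []" "last fs = last fs'" using ne eq es es' by (auto split: if_splits)
    then have l: "last fs \<in> set fs" "last fs \<in> set fs'" by (metis last_in_set)+
    obtain x y where xy: "\<phi> (last fs) = {x, y}"
      using chain_edge_doubleton[OF vs(5) l(1)] by metis
    have x: "x \<in> set ws" "x \<in> set ws'"
      using chain_ends[OF vs(5) l(1)] chain_ends[OF vs'(4) l(2)] xy by auto
    have "(u, x) \<in> conn \<phi> (F - {e})" using chain_conn2[OF vs'(4) _ _ s(2), of u x] x vs'(2) u by auto
    moreover have "(x, hd ws) \<in> conn \<phi> (F - {e})" using chain_conn2[OF vs(5) _ _ s(1), of x] x vs(2) by simp
    ultimately have "(u, hd ws) \<in> conn \<phi> (F - {e})" by (rule rtrancl_trans)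
    then show False using forestD[OF fo vs(3,4)] by simp
  qed
  show "last vs = last vs'" by (rule path_last_unique[OF fo p q * eq(2)])
qed

section \<open>Generating functions of locally constrained multisets\<close>

definition part :: "('a \<Rightarrow> 'b) \<Rightarrow> 'b \<Rightarrow> 'a multiset \<Rightarrow> 'a multiset" where
  "part \<kappa> S M = filter_mset (\<lambda>x. \<kappa> x = S) M"

text \<open>The unexceptional choices: the classes contribute independently, each nothing or a
  single element, so that the generating function becomes a product.\<close>

definition thin :: "'a set \<Rightarrow> ('a \<Rightarrow> 'b) \<Rightarrow> 'b set \<Rightarrow> 'a multiset set" where
  "thin \<Omega> \<kappa> C = {M. set_mset M \<subseteq> {x\<in>\<Omega>. \<kappa> x \<in> C} \<and> (\<forall>S\<in>C. size (part \<kappa> S M) \<le> 1)}"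

lemma part_plus [simp]: "part \<kappa> S (M + N) = part \<kappa> S M + part \<kappa> S N"
  by (simp add: part_def)

lemma part_empty [simp]: "part \<kappa> S {#} = {#}"
  by (simp add: part_def)

lemma part_add [simp]: "part \<kappa> S (add_mset x M) = (if \<kappa> x = S then add_mset x (part \<kappa> S M) else part \<kappa> S M)"
  by (simp add: part_def)

lemma set_part: "set_mset (part \<kappa> S M) = {x \<in> set_mset M. \<kappa> x = S}"
  by (simp add: part_def)

lemma part_eq_empty: "part \<kappa> S M = {#} \<longleftrightarrow> S \<notin> \<kappa> ` set_mset M"
  unfolding set_mset_eq_empty_iff[symmetric] set_part by auto

lemma part_id: "(\<And>x. x \<in># M \<Longrightarrow> \<kappa> x = S) \<Longrightarrow> part \<kappa> S M = M"
  by (simp add: part_def filter_mset_eq_conv)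

lemma part_mset_plus_rest: "M = part \<kappa> S M + filter_mset (\<lambda>x. \<kappa> x \<noteq> S) M"
  by (simp add: part_def multiset_partition)

lemma part_rest: "T \<noteq> S \<Longrightarrow> part \<kappa> T (filter_mset (\<lambda>x. \<kappa> x \<noteq> S) M) = part \<kappa> T M"
  by (simp add: part_def filter_filter_mset) (rule filter_mset_cong, auto)

lemma thin_insert:
  assumes S: "S \<notin> C"
  shows "thin \<Omega> \<kappa> (insert S C) = thin \<Omega> \<kappa> C \<union> (\<Union>x\<in>{x\<in>\<Omega>. \<kappa> x = S}. add_mset x ` thin \<Omega> \<kappa> C)"
    (is "?L = ?R")
proof
  show "?R \<subseteq> ?L"
  proof
    fix M assume "M \<in> ?R"
    then consider "M \<in> thin \<Omega> \<kappa> C" |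
      x N where "x \<in> \<Omega>" "\<kappa> x = S" "N \<in> thin \<Omega> \<kappa> C" "M = add_mset x N" by auto
    moreover have "part \<kappa> S N = {#}" if "N \<in> thin \<Omega> \<kappa> C" for N
      using that S by (auto simp: thin_def part_eq_empty)
    ultimately show "M \<in> ?L" using S by cases (auto simp: thin_def)
  qed
  show "?L \<subseteq> ?R"
  proof
    fix M assume M: "M \<in> ?L"
    define N where "N = filter_mset (\<lambda>x. \<kappa> x \<noteq> S) M"
    have N: "N \<in> thin \<Omega> \<kappa> C"
      using M S by (auto simp: thin_def N_def part_rest) (subst part_rest, auto)
    have "size (part \<kappa> S M) \<le> 1" using M by (auto simp: thin_def)
    then have "part \<kappa> S M = {#} \<or> (\<exists>x. part \<kappa> S M = {#x#})"
      by (metis le_Suc_eq One_nat_def le_zero_eq size_eq_0_iff_empty size_1_singleton_mset)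
    then show "M \<in> ?R"
    proof
      assume "part \<kappa> S M = {#}"
      then show ?thesis using part_mset_plus_rest[of M \<kappa> S] N by (simp add: N_def)
    next
      assume "\<exists>x. part \<kappa> S M = {#x#}"
      then obtain x where x: "part \<kappa> S M = {#x#}" by auto
      then have "x \<in> set_mset (part \<kappa> S M)" by simp
      then have "x \<in> \<Omega>" "\<kappa> x = S" using M by (auto simp: set_part thin_def)
      moreover have "M = add_mset x N" using part_mset_plus_rest[of M \<kappa> S] x by (simp add: N_def)
      ultimately show ?thesis using N by auto
    qed
  qed
qed

lemma thin_empty: "thin \<Omega> \<kappa> {} = {{#}}"
  by (auto simp: thin_def)

text \<open>A class that is skipped contributes a factor y, a class that is used one of its
  elements. The ring is left open because y will be 0 in the integers as well as t - 1 and t among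
  the integer polynomials.\<close>

lemma thin_gf:
  fixes y :: "'c::comm_ring_1"
  assumes "finite C" "finite \<Omega>"
  shows "finite (thin \<Omega> \<kappa> C) \<and> (\<forall>M\<in>thin \<Omega> \<kappa> C. size M \<le> card C) \<and>
    (\<Sum>M\<in>thin \<Omega> \<kappa> C. y ^ (card C - size M)) = (\<Prod>S\<in>C. y + of_nat (card {x\<in>\<Omega>. \<kappa> x = S}))"
  using assms(1)
proof (induction C)
  case empty
  then show ?case by (simp add: thin_empty)
next
  case (insert S C)
  define T where "T = thin \<Omega> \<kappa> C"
  define E where "E = {x\<in>\<Omega>. \<kappa> x = S}"
  have T: "finite T" "\<And>M. M \<in> T \<Longrightarrow> size M \<le> card C" using insert.IH by (auto simp: T_def)
  have E: "finite E" using assms(2) by (simp add: E_def)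
  have eq: "thin \<Omega> \<kappa> (insert S C) = T \<union> (\<Union>x\<in>E. add_mset x ` T)"
    using thin_insert[OF insert(2)] by (simp add: T_def E_def)
  have nS: "M \<in> T \<Longrightarrow> x \<in># M \<Longrightarrow> x \<notin> E" for M x using insert(2) by (auto simp: T_def E_def thin_def)
  have d1: "T \<inter> (\<Union>x\<in>E. add_mset x ` T) = {}" using nS by fastforce
  have d2: "add_mset x M \<noteq> add_mset x' M'" if "x \<in> E" "x' \<in> E" "x \<noteq> x'" "M \<in> T" "M' \<in> T" for x x' M M'
    using nS that by (auto simp: add_eq_conv_ex)
  have "(\<Sum>M\<in>thin \<Omega> \<kappa> (insert S C). y ^ (card (insert S C) - size M)) =
     (\<Sum>M\<in>T. y ^ (Suc (card C) - size M)) + (\<Sum>x\<in>E. \<Sum>M\<in>add_mset x ` T. y ^ (Suc (card C) - size M))"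
  proof -
    have "(\<Sum>M\<in>(\<Union>x\<in>E. add_mset x ` T). y ^ (Suc (card C) - size M)) =
        (\<Sum>x\<in>E. \<Sum>M\<in>add_mset x ` T. y ^ (Suc (card C) - size M))"
      using T E by (intro sum.UNION_disjoint) (auto dest: d2)
    moreover have "finite (\<Union>x\<in>E. add_mset x ` T)" using T E by auto
    ultimately show ?thesis using insert(1,2) T(1) d1 unfolding eq
      by (subst sum.union_disjoint) auto
  qed
  also have "(\<Sum>M\<in>T. y ^ (Suc (card C) - size M)) = y * (\<Sum>M\<in>T. y ^ (card C - size M))"
    by (simp add: sum_distrib_left Suc_diff_le T(2))
  also have "(\<Sum>x\<in>E. \<Sum>M\<in>add_mset x ` T. y ^ (Suc (card C) - size M)) =
     (\<Sum>x\<in>E. \<Sum>M\<in>T. y ^ (card C - size M))"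
    by (rule sum.cong[OF refl]) (simp add: sum.reindex inj_on_def)
  finally show ?case
    using insert T E by (auto simp: eq T_def E_def algebra_simps Suc_le_eq le_SucI less_Suc_eq_le)
qed

text \<open>The common shape of both counts. \<open>D S\<close> lists the exceptional parts of the
  class \<open>S\<close>: pairs for an ordinary class, single elements for the root class
  \<open>s\<close>. The root class is one step ahead of the others, since 0-bar itself counts in it,
  and so admits no unexceptional element.\<close>

definition mixed :: "'a set \<Rightarrow> ('a \<Rightarrow> 'b) \<Rightarrow> 'b set \<Rightarrow> 'b \<Rightarrow> ('b \<Rightarrow> 'a multiset set) \<Rightarrow> 'a multiset set" where
  "mixed \<Omega> \<kappa> C s D = {M. set_mset M \<subseteq> \<Omega> \<and>
     (\<forall>S\<in>C. size (part \<kappa> S M) \<le> 1 \<or> part \<kappa> S M \<in> D S) \<and>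
     (part \<kappa> s M = {#} \<or> part \<kappa> s M \<in> D s) \<and>
     (\<forall>S\<in>insert s C. \<forall>S'\<in>insert s C. part \<kappa> S M \<in> D S \<longrightarrow> part \<kappa> S' M \<in> D S' \<longrightarrow> S = S')}"

text \<open>The exceptional class is unique if there is one; splitting off its part leaves a thin
  choice on the remaining ordinary classes. The sizes in \<open>Ds\<close> and \<open>D\<close>
  ensure that an exceptional part is never also an unexceptional one. For the root class no class is
  removed from \<open>C\<close>.\<close>

lemma mixed_eq:
  assumes s: "s \<notin> C" and \<kappa>: "\<kappa> ` \<Omega> \<subseteq> insert s C"
    and Ds: "\<And>N. N \<in> D s \<Longrightarrow> size N = 1 \<and> set_mset N \<subseteq> {x\<in>\<Omega>. \<kappa> x = s}"
    and D: "\<And>S N. S \<in> C \<Longrightarrow> N \<in> D S \<Longrightarrow> size N = 2 \<and> set_mset N \<subseteq> {x\<in>\<Omega>. \<kappa> x = S}"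
  shows "mixed \<Omega> \<kappa> C s D = thin \<Omega> \<kappa> C \<union>
     (\<Union>S\<in>insert s C. \<Union>N\<in>D S. (\<lambda>M. N + M) ` thin \<Omega> \<kappa> (C - {S}))" (is "?L = ?R")
proof
  have pD: "part \<kappa> T N = (if T = S then N else {#})" if "S \<in> insert s C" "N \<in> D S" for S N T
    using that Ds[of N] D[of S N] by (cases "S = s") (auto simp: part_eq_empty intro!: part_id)
  have pY: "part \<kappa> T M = {#}" if "M \<in> thin \<Omega> \<kappa> C'" "T \<notin> C'" for M T C'
    using that by (auto simp: thin_def part_eq_empty)
  have pY1: "size (part \<kappa> T M) \<le> 1" if "M \<in> thin \<Omega> \<kappa> C'" for M T C'
    using that pY[OF that, of T] by (cases "T \<in> C'") (auto simp: thin_def)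
  have nD: "N \<notin> D S" if "size N \<le> 1" "S \<in> C" for S N using that D[of S N] by auto
  have nDs: "{#} \<notin> D s" using Ds[of "{#}"] by auto
  show "?R \<subseteq> ?L"
  proof
    fix M assume "M \<in> ?R"
    then consider (1) "M \<in> thin \<Omega> \<kappa> C" |
      (2) S N M' where "S \<in> insert s C" "N \<in> D S" "M' \<in> thin \<Omega> \<kappa> (C - {S})" "M = N + M'" by auto
    then show "M \<in> ?L"
    proof cases
      case 1
      have "part \<kappa> S M \<notin> D S" if "S \<in> insert s C" for S
        using that nD pY1[OF 1] pY[OF 1 s] nDs by auto
      then show ?thesis using 1 pY[OF 1 s] pY1[OF 1] by (auto simp: mixed_def thin_def)
    next
      case 2
      have p: "part \<kappa> T M = (if T = S then N else part \<kappa> T M')" for T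
        using 2 pD[OF 2(1,2), of T] pY[OF 2(3), of T] by auto
      have n: "part \<kappa> T M \<in> D T \<longleftrightarrow> T = S" if "T \<in> insert s C" for T
      proof (cases "T = S")
        case False
        then have "part \<kappa> T M = part \<kappa> T M'" using p[of T] by simp
        moreover have "part \<kappa> T M' \<notin> D T"
          using that nD[OF pY1[OF 2(3)], of T] pY[OF 2(3), of s] nDs s by (cases "T = s") auto
        ultimately show ?thesis using False by simp
      qed (use p[of S] 2(2) in simp)
      have "set_mset M \<subseteq> \<Omega>" using 2 Ds[of N] D[of S N] by (auto simp: thin_def)
      moreover have "size (part \<kappa> T M) \<le> 1 \<or> part \<kappa> T M \<in> D T" if "T \<in> C" for T
        using n[of T] that pY1[OF 2(3)] p by auto
      moreover have "part \<kappa> s M = {#} \<or> part \<kappa> s M \<in> D s"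
        using n[of s] p pY[OF 2(3), of s] s by auto
      ultimately show ?thesis using n by (simp add: mixed_def)
    qed
  qed
  show "?L \<subseteq> ?R"
  proof
    fix M assume M: "M \<in> ?L"
    have M\<Omega>: "set_mset M \<subseteq> \<Omega>" using M by (simp add: mixed_def)
    show "M \<in> ?R"
    proof (cases "\<exists>S\<in>insert s C. part \<kappa> S M \<in> D S")
      case False
      then have "part \<kappa> s M = {#}" "\<forall>S\<in>C. size (part \<kappa> S M) \<le> 1" using M by (auto simp: mixed_def)
      then have "M \<in> thin \<Omega> \<kappa> C" using \<kappa> M\<Omega> by (fastforce simp: thin_def part_eq_empty)
      then show ?thesis by simp
    next
      case True
      then obtain S where S: "S \<in> insert s C" "part \<kappa> S M \<in> D S" by auto
      define N where "N = filter_mset (\<lambda>x. \<kappa> x \<noteq> S) M"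
      have o: "part \<kappa> T M \<notin> D T" if "T \<in> insert s C" "T \<noteq> S" for T
        using M S that by (auto simp: mixed_def)
      have "N \<in> thin \<Omega> \<kappa> (C - {S})"
        unfolding thin_def
      proof (rule CollectI, rule conjI)
        show "set_mset N \<subseteq> {x \<in> \<Omega>. \<kappa> x \<in> C - {S}}"
        proof
          fix x assume "x \<in> set_mset N"
          then have x: "x \<in># M" "\<kappa> x \<noteq> S" by (auto simp: N_def)
          have "\<kappa> x \<noteq> s"
          proof
            assume xs: "\<kappa> x = s"
            then have "part \<kappa> s M \<noteq> {#}" using x by (auto simp: part_eq_empty)
            then have "part \<kappa> s M \<in> D s" using M by (auto simp: mixed_def)
            then show False using o[of s] xs x by auto
          qed
          then show "x \<in> {x \<in> \<Omega>. \<kappa> x \<in> C - {S}}" using x M\<Omega> \<kappa> by auto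
        qed
        show "\<forall>T\<in>C - {S}. size (part \<kappa> T N) \<le> 1"
        proof
          fix T assume T: "T \<in> C - {S}"
          then have "size (part \<kappa> T M) \<le> 1" using o[of T] M by (auto simp: mixed_def)
          then show "size (part \<kappa> T N) \<le> 1" using part_rest[of T S \<kappa> M] T by (simp add: N_def)
        qed
      qed
      moreover have "M = part \<kappa> S M + N" using part_mset_plus_rest[of M \<kappa> S] by (simp add: N_def)
      ultimately show ?thesis using S by blast
    qed
  qed
qed

text \<open>The degree \<open>Suc (card C)\<close> is chosen so that exceptional parts carry no
  power of y: a pair uses up two degrees and leaves the degree \<open>card C - 1\<close> of a thin
  choice without its class, an exceptional root element uses up one and leaves
  \<open>card C\<close>.\<close>

lemma mixed_gf:
  fixes y :: "'c::comm_ring_1"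
  assumes fin: "finite C" "finite \<Omega>" and s: "s \<notin> C" and \<kappa>: "\<kappa> ` \<Omega> \<subseteq> insert s C"
    and Ds: "\<And>N. N \<in> D s \<Longrightarrow> size N = 1 \<and> set_mset N \<subseteq> {x\<in>\<Omega>. \<kappa> x = s}"
    and D: "\<And>S N. S \<in> C \<Longrightarrow> N \<in> D S \<Longrightarrow> size N = 2 \<and> set_mset N \<subseteq> {x\<in>\<Omega>. \<kappa> x = S}"
    and fD: "\<And>S. S \<in> insert s C \<Longrightarrow> finite (D S)"
  shows "finite (mixed \<Omega> \<kappa> C s D)"
    and "\<And>M. M \<in> mixed \<Omega> \<kappa> C s D \<Longrightarrow> size M \<le> Suc (card C)"
    and "(\<Sum>M\<in>mixed \<Omega> \<kappa> C s D. y ^ (Suc (card C) - size M)) =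
      (y + of_nat (card (D s))) * (\<Prod>S\<in>C. y + of_nat (card {x\<in>\<Omega>. \<kappa> x = S})) +
      (\<Sum>S\<in>C. of_nat (card (D S)) * (\<Prod>T\<in>C - {S}. y + of_nat (card {x\<in>\<Omega>. \<kappa> x = T})))"
proof -
  define Y where "Y = thin \<Omega> \<kappa>"
  define P where "P C' = (\<Prod>S\<in>C'. y + of_nat (card {x\<in>\<Omega>. \<kappa> x = S}))" for C'
  have Y: "finite (Y C')" "M \<in> Y C' \<Longrightarrow> size M \<le> card C'"
    "(\<Sum>M\<in>Y C'. y ^ (card C' - size M)) = P C'" if "C' \<subseteq> C" for C' M
    using thin_gf[of C' \<Omega> \<kappa> y] finite_subset[OF that fin(1)] fin(2) by (auto simp: Y_def P_def)
  define Z where "Z S = (\<Union>N\<in>D S. (\<lambda>M. N + M) ` Y (C - {S}))" for S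
  have eq: "mixed \<Omega> \<kappa> C s D = Y C \<union> (\<Union>S\<in>insert s C. Z S)"
    unfolding Y_def Z_def by (rule mixed_eq[OF s \<kappa> Ds D])
  have pD: "part \<kappa> S N = N" if "S \<in> insert s C" "N \<in> D S" for S N
    using that Ds[of N] D[of S N] by (cases "S = s") (auto intro!: part_id)
  have pY: "part \<kappa> T M = {#}" if "M \<in> Y C'" "T \<notin> C'" for M T C'
    using that by (auto simp: Y_def thin_def part_eq_empty)
  have pY1: "size (part \<kappa> T M) \<le> 1" if "M \<in> Y C'" for M T C'
    using that pY[OF that, of T] by (cases "T \<in> C'") (auto simp: Y_def thin_def)
  have nY: "part \<kappa> S M \<notin> D S" if "M \<in> Y C'" "S \<in> insert s C" "C' \<subseteq> C" for M S C'
    using pY1[OF that(1), of S] pY[OF that(1), of s] D[of S "part \<kappa> S M"] Ds[of "{#}"] that s by fastforce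
  have pZ: "part \<kappa> S M \<in> D S" if "M \<in> Z S" "S \<in> insert s C" for M S
    using that pD pY[of _ "C - {S}" S] by (auto simp: Z_def)
  have pZ': "part \<kappa> T M \<notin> D T" 
    if Z: "M \<in> Z S" and that: "S \<in> insert s C" "T \<in> insert s C" "T \<noteq> S" for M S T
  proof -
    obtain N M' where NM: "N \<in> D S" "M' \<in> Y (C - {S})" "M = N + M'" using Z unfolding Z_def by blast
    have "part \<kappa> T N = {#}" using NM(1) that Ds[of N] D[of S N]
      by (cases "S = s") (auto simp: part_eq_empty)
    then show ?thesis using nY[OF NM(2) that(2)] NM by auto
  qed
  have disj: "Z S \<inter> Z T = {}" if "S \<in> insert s C" "T \<in> insert s C" "S \<noteq> T" for S T
    using pZ pZ' that by blast
  have disjY: "Y C \<inter> (\<Union>S\<in>insert s C. Z S) = {}" using pZ nY[of _ C] by blast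
  have finZ: "finite (Z S)" if "S \<in> insert s C" for S
    using fD[OF that] Y(1)[of "C - {S}"] by (auto simp: Z_def)
  have sizeZ: "size M \<le> Suc (card C)" if "S \<in> insert s C" "M \<in> Z S" for S M
  proof (cases "S = s")
    case True
    then show ?thesis using that Ds Y(2)[of "C - {s}"] s by (fastforce simp: Z_def)
  next
    case False
    then have S: "S \<in> C" using that by auto
    have "Suc (card (C - {S})) = card C" using S fin(1) by (metis card_Suc_Diff1)
    then show ?thesis using that S D Y(2)[of "C - {S}"] by (fastforce simp: Z_def)
  qed
  have dN: "(+) N ` Y (C - {S}) \<inter> (+) N' ` Y (C - {S}) = {}"
    if S: "S \<in> insert s C" and N: "N \<in> D S" "N' \<in> D S" "N \<noteq> N'" for N N' S
  proof -
    have *: "part \<kappa> S (K + M) = K" if "K \<in> D S" "M \<in> Y (C - {S})" for K M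
      using that pD[OF S] pY[of M "C - {S}" S] by simp
    show ?thesis
    proof (rule equals0I)
      fix K assume "K \<in> (+) N ` Y (C - {S}) \<inter> (+) N' ` Y (C - {S})"
      then obtain M M' where "M \<in> Y (C - {S})" "M' \<in> Y (C - {S})" "K = N + M" "K = N' + M'" by auto
      then show False using *[OF N(1), of M] *[OF N(2), of M'] N(3) by simp
    qed
  qed
  have sumZ: "(\<Sum>M\<in>Z S. y ^ (Suc (card C) - size M)) =
      (\<Sum>N\<in>D S. \<Sum>M\<in>Y (C - {S}). y ^ (Suc (card C) - (size N + size M)))" if "S \<in> insert s C" for S
  proof -
    have "(\<Sum>M\<in>Z S. y ^ (Suc (card C) - size M)) =
        (\<Sum>N\<in>D S. \<Sum>M\<in>(+) N ` Y (C - {S}). y ^ (Suc (card C) - size M))"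
      unfolding Z_def using fD[OF that] Y(1)[of "C - {S}"] dN that
      by (intro sum.UNION_disjoint) auto
    also have "\<dots> = (\<Sum>N\<in>D S. \<Sum>M\<in>Y (C - {S}). y ^ (Suc (card C) - (size N + size M)))"
      by (rule sum.cong[OF refl]) (simp add: sum.reindex inj_on_def)
    finally show ?thesis .
  qed
  have sumZs: "(\<Sum>M\<in>Z s. y ^ (Suc (card C) - size M)) = of_nat (card (D s)) * P C"
  proof -
    have "(\<Sum>M\<in>Z s. y ^ (Suc (card C) - size M)) = (\<Sum>N\<in>D s. \<Sum>M\<in>Y C. y ^ (card C - size M))"
      using s Ds by (subst sumZ) (auto intro!: sum.cong)
    then show ?thesis using Y(3)[of C] by simp
  qed
  have sumZS: "(\<Sum>M\<in>Z S. y ^ (Suc (card C) - size M)) = of_nat (card (D S)) * P (C - {S})" if "S \<in> C" for S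
  proof -
    have c: "Suc (card (C - {S})) = card C" using that fin(1) by (metis card_Suc_Diff1)
    have e: "Suc (card C) - (size N + size M) = card (C - {S}) - size M" if "N \<in> D S" for N M
      using D[OF \<open>S \<in> C\<close> that] c by auto
    have "(\<Sum>M\<in>Z S. y ^ (Suc (card C) - size M)) = (\<Sum>N\<in>D S. \<Sum>M\<in>Y (C - {S}). y ^ (card (C - {S}) - size M))"
      by (subst sumZ, use that in simp, rule sum.cong[OF refl], rule sum.cong[OF refl], simp only: e)
    then show ?thesis using Y(3)[of "C - {S}"] by auto
  qed
  show "finite (mixed \<Omega> \<kappa> C s D)" using Y(1)[of C] finZ fin(1) by (auto simp: eq)
  show "\<And>M. M \<in> mixed \<Omega> \<kappa> C s D \<Longrightarrow> size M \<le> Suc (card C)"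
    using Y(2)[of C] sizeZ by (fastforce simp: eq)
  have "(\<Sum>M\<in>mixed \<Omega> \<kappa> C s D. y ^ (Suc (card C) - size M)) =
      (\<Sum>M\<in>Y C. y ^ (Suc (card C) - size M)) + (\<Sum>M\<in>(\<Union>S\<in>insert s C. Z S). y ^ (Suc (card C) - size M))"
    unfolding eq using Y(1)[of C] finZ fin(1) disjY by (intro sum.union_disjoint) auto
  also have "(\<Sum>M\<in>(\<Union>S\<in>insert s C. Z S). y ^ (Suc (card C) - size M)) =
      (\<Sum>S\<in>insert s C. \<Sum>M\<in>Z S. y ^ (Suc (card C) - size M))"
    using finZ fin(1) disj by (intro sum.UNION_disjoint) auto
  also have "(\<Sum>M\<in>Y C. y ^ (Suc (card C) - size M)) = y * P C"
    unfolding Y(3)[of C, OF order_refl, symmetric]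
    by (simp add: sum_distrib_left Suc_diff_le Y(2))
  finally show "(\<Sum>M\<in>mixed \<Omega> \<kappa> C s D. y ^ (Suc (card C) - size M)) =
      (y + of_nat (card (D s))) * (\<Prod>S\<in>C. y + of_nat (card {x\<in>\<Omega>. \<kappa> x = S})) +
      (\<Sum>S\<in>C. of_nat (card (D S)) * (\<Prod>T\<in>C - {S}. y + of_nat (card {x\<in>\<Omega>. \<kappa> x = T})))"
    using fin(1) s by (simp add: sumZs sumZS P_def algebra_simps)
qed

section \<open>Parities of paths in a forest\<close>

text \<open>An odd number of crossing edges, expressed by the two end vertices alone;
  \<open>odd_crossings_iff\<close> justifies this. The case \<open>e = f\<close> is included and
  means that the edge is crossing itself.\<close>

definition oddpath :: "('e \<Rightarrow> 'v set) \<Rightarrow> ('v \<Rightarrow> bool) \<Rightarrow> 'e set \<Rightarrow> 'e \<Rightarrow> 'e \<Rightarrow> bool" where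
  "oddpath \<phi> \<sigma> F e f \<longleftrightarrow> (\<exists>vs es. chain \<phi> F vs es \<and> distinct vs \<and> es \<noteq> [] \<and> hd es = e \<and> last es = f \<and>
     \<sigma> (hd vs) \<noteq> \<sigma> (last vs))"

definition oddroot :: "('e \<Rightarrow> 'v set) \<Rightarrow> ('v \<Rightarrow> bool) \<Rightarrow> 'e set \<Rightarrow> 'v \<Rightarrow> 'e \<Rightarrow> bool" where
  "oddroot \<phi> \<sigma> F r f \<longleftrightarrow> (\<exists>vs es. chain \<phi> F vs es \<and> distinct vs \<and> es \<noteq> [] \<and> hd vs = r \<and> last es = f \<and>
     \<sigma> r \<noteq> \<sigma> (last vs))"

lemma oddpathI:
  assumes "chain \<phi> F vs es" "distinct vs" "es \<noteq> []" "\<sigma> (hd vs) \<noteq> \<sigma> (last vs)"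
  shows "oddpath \<phi> \<sigma> F (hd es) (last es)"
  using assms unfolding oddpath_def by blast

lemma oddpath_sym: "oddpath \<phi> \<sigma> F e f \<Longrightarrow> oddpath \<phi> \<sigma> F f e"
proof -
  assume "oddpath \<phi> \<sigma> F e f"
  then obtain vs es where p: "chain \<phi> F vs es" "distinct vs" "es \<noteq> []" "hd es = e" "last es = f"
    "\<sigma> (hd vs) \<noteq> \<sigma> (last vs)" by (auto simp: oddpath_def)
  show ?thesis
    using oddpathI[OF chain_rev[OF p(1)], of \<sigma>] p chain_rev_simps[OF p(1,3)] by auto
qed

lemma chain_hd_edge:
  assumes "chain \<phi> F vs es" "es \<noteq> []"
  shows "hd vs \<in> \<phi> (hd es)" "last vs \<in> \<phi> (last es)"
proof -
  have *: "hd vs \<in> \<phi> (hd es)" if c: "chain \<phi> F vs es" and ne: "es \<noteq> []" for vs es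
  proof -
    obtain e es' where es: "es = e # es'" using ne by (cases es) auto
    obtain u ws where "vs = u # ws" "\<phi> e = {u, hd ws}"
      using c unfolding es chain_Cons_iff by blast
    then show ?thesis using es by simp
  qed
  show "hd vs \<in> \<phi> (hd es)" by (rule *[OF assms])
  show "last vs \<in> \<phi> (last es)"
    using *[OF chain_rev[OF assms(1)]] chain_rev_simps[OF assms] assms(2) by simp
qed

lemma chain_singleton_edge:
  assumes "chain \<phi> F vs [e]"
  shows "\<phi> e = {hd vs, last vs}"
proof -
  obtain u ws where ws: "vs = u # ws" "ws \<noteq> []" "\<phi> e = {u, hd ws}" "chain \<phi> F ws []"
    using assms unfolding chain_Cons_iff by blast
  then obtain w where "ws = [w]" using chain_length[OF ws(4)] by (cases ws) auto
  then show ?thesis using ws by simp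
qed

lemma chain_in_cls:
  assumes "chain \<phi> F vs es" "x \<in> set vs" "x \<in> cls \<phi> F a" "y \<in> set vs"
  shows "y \<in> cls \<phi> F a"
  using chain_conn2[OF assms(1,2,4) chain_edges[OF assms(1)]] assms(3) unfolding in_cls by (rule rtrancl_trans[rotated])

lemma edge_in_cls:
  assumes "e \<in> F" "\<phi> e = {u, v}"
  shows "\<phi> e \<subseteq> cls \<phi> F a \<longleftrightarrow> u \<in> cls \<phi> F a"
proof -
  have "(u, v) \<in> conn \<phi> F" using assms by (rule conn_edge)
  then show ?thesis using assms(2) by (auto simp: in_cls intro: rtrancl_trans)
qed

lemma oddpath_edges:
  assumes "oddpath \<phi> \<sigma> F e f"
  shows "e \<in> F" "f \<in> F" "\<phi> e \<subseteq> cls \<phi> F a \<longleftrightarrow> \<phi> f \<subseteq> cls \<phi> F a"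
proof -
  from assms obtain vs es where p: "chain \<phi> F vs es" "es \<noteq> []" "hd es = e" "last es = f"
    by (auto simp: oddpath_def)
  then have i: "e \<in> set es" "f \<in> set es" by auto
  then show ef: "e \<in> F" "f \<in> F" using chain_edges[OF p(1)] by auto
  obtain u v where uv: "\<phi> e = {u, v}" using chain_edge_doubleton[OF p(1) i(1)] by metis
  obtain x y where xy: "\<phi> f = {x, y}" using chain_edge_doubleton[OF p(1) i(2)] by metis
  have "u \<in> set vs" "x \<in> set vs" using chain_ends[OF p(1)] i uv xy by auto
  then show "\<phi> e \<subseteq> cls \<phi> F a \<longleftrightarrow> \<phi> f \<subseteq> cls \<phi> F a"
    unfolding edge_in_cls[of e F \<phi>, OF ef(1) uv] edge_in_cls[of f F \<phi>, OF ef(2) xy] using chain_in_cls[OF p(1)] by blast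
qed

lemma conn_path_family:
  obtains pv pe where "\<And>u v. (u, v) \<in> conn \<phi> F \<Longrightarrow> chain \<phi> F (pv u v) (pe u v) \<and> distinct (pv u v) \<and>
     hd (pv u v) = u \<and> last (pv u v) = v \<and> (u \<noteq> v \<longrightarrow> pe u v \<noteq> [])"
proof -
  have "\<exists>vs es. (u, v) \<in> conn \<phi> F \<longrightarrow> chain \<phi> F vs es \<and> distinct vs \<and> hd vs = u \<and> last vs = v \<and> (u \<noteq> v \<longrightarrow> es \<noteq> [])"
    for u v
  proof (cases "(u, v) \<in> conn \<phi> F")
    case True
    then obtain vs es where p: "chain \<phi> F vs es" "distinct vs" "hd vs = u" "last vs = v"
      using conn_imp_chain by metis
    have "u \<noteq> v \<longrightarrow> es \<noteq> []" using p chain_length[OF p(1)] by (cases vs) auto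
    then show ?thesis using p by blast
  qed auto
  then show ?thesis using that by metis
qed

text \<open>In a rooted tree, sending a vertex to the last edge on its path from the root is a bijection
  from the vertices other than the root onto the edges.\<close>

lemma root_edge_bij:
  fixes F \<phi> a \<sigma>
  assumes fo: "forest \<phi> F" and ends: "\<And>e. e \<in> F \<Longrightarrow> \<exists>u v. \<phi> e = {u, v}"
  shows "\<exists>g. bij_betw g (cls \<phi> F a - {a}) {f\<in>F. \<phi> f \<subseteq> cls \<phi> F a} \<and>
    (\<forall>v\<in>cls \<phi> F a - {a}. oddroot \<phi> \<sigma> F a (g v) \<longleftrightarrow> \<sigma> v \<noteq> \<sigma> a)"
proof -
  obtain pv pe where "\<And>u v. (u, v) \<in> conn \<phi> F \<Longrightarrow> chain \<phi> F (pv u v) (pe u v) \<and> distinct (pv u v) \<and>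
     hd (pv u v) = u \<and> last (pv u v) = v \<and> (u \<noteq> v \<longrightarrow> pe u v \<noteq> [])"
    using conn_path_family[of \<phi> F] by blast
  then have p: "chain \<phi> F (pv a v) (pe a v)" "distinct (pv a v)" "pe a v \<noteq> []"
    "hd (pv a v) = a" "last (pv a v) = v" if "v \<in> cls \<phi> F a - {a}" for v
    using that unfolding in_cls Diff_iff by blast+
  define g where "g v = last (pe a v)" for v
  have eq: "g v = last es" if v: "v \<in> cls \<phi> F a - {a}"
    and q: "chain \<phi> F vs es" "distinct vs" "es \<noteq> []" "hd vs = a" "last vs = v" for v vs es
    unfolding g_def by (rule path_last_edge_unique[OF fo p(1-3)[OF v] q(1-3)]) (use p[OF v] q in auto)
  have eq': "v = last vs" if v: "v \<in> cls \<phi> F a - {a}"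
    and q: "chain \<phi> F vs es" "distinct vs" "es \<noteq> []" "hd vs = a" "last es = g v" for v vs es
    using path_last_unique[OF fo p(1-3)[OF v] q(1-3)] p[OF v] q by (auto simp: g_def)
  have "bij_betw g (cls \<phi> F a - {a}) {f\<in>F. \<phi> f \<subseteq> cls \<phi> F a}"
  proof (rule bij_betwI')
    fix v w assume v: "v \<in> cls \<phi> F a - {a}" and w: "w \<in> cls \<phi> F a - {a}"
    show "g v = g w \<longleftrightarrow> v = w" using eq'[OF v p(1-3)[OF w]] p[OF w] by (auto simp: g_def)
  next
    fix v assume v: "v \<in> cls \<phi> F a - {a}"
    have "g v \<in> set (pe a v)" using p(3)[OF v] by (simp add: g_def)
    moreover have "set (pv a v) \<subseteq> cls \<phi> F a"
      
      using chain_in_cls[OF p(1)[OF v], of a a] p(4)[OF v] cls_self[of a \<phi> F] hd_in_set[OF chain_ne[OF p(1)[OF v]]]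
      by (auto simp del: hd_in_set)
    ultimately show "g v \<in> {f\<in>F. \<phi> f \<subseteq> cls \<phi> F a}"
      using chain_edges[OF p(1)[OF v]] chain_ends[OF p(1)[OF v]] by blast
  next
    fix f assume f: "f \<in> {f\<in>F. \<phi> f \<subseteq> cls \<phi> F a}"
    obtain b b' where b: "\<phi> f = {b, b'}" using ends f by blast
    then have ab: "(a, b) \<in> conn \<phi> F" using f by (auto simp: in_cls)
    have bb: "b \<noteq> b'" using forest_no_loop[OF fo _ b] f by auto
    obtain vs es where q: "chain \<phi> F vs es" "distinct vs" "hd vs = a" "es \<noteq> []" "last es = f"
      using edge_path_from[OF _ b bb ab] f by auto
    have "last vs \<noteq> a"
      using q chain_length[OF q(1)] by (cases vs; cases "tl vs" rule: rev_cases) auto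
    moreover have "last vs \<in> cls \<phi> F a"
      using chain_hd_edge[OF q(1,4)] q(5) f by auto
    ultimately have l: "last vs \<in> cls \<phi> F a - {a}" by simp
    have "g (last vs) = last es" using q by (intro eq[OF l]) auto
    then show "\<exists>v\<in>cls \<phi> F a - {a}. f = g v" using l q(5) by (intro bexI[of _ "last vs"]) auto
  qed
  moreover have "oddroot \<phi> \<sigma> F a (g v) \<longleftrightarrow> \<sigma> v \<noteq> \<sigma> a" if v: "v \<in> cls \<phi> F a - {a}" for v
  proof
    assume "oddroot \<phi> \<sigma> F a (g v)"
    then show "\<sigma> v \<noteq> \<sigma> a" using eq'[OF v] unfolding oddroot_def by metis
  next
    assume "\<sigma> v \<noteq> \<sigma> a"
    then show "oddroot \<phi> \<sigma> F a (g v)" using p[OF v] unfolding oddroot_def g_def by metis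
  qed
  ultimately show ?thesis by blast
qed

lemma card_tree_edges:
  assumes "forest \<phi> F" "\<And>e. e \<in> F \<Longrightarrow> \<exists>u v. \<phi> e = {u, v}"
  shows "card {f\<in>F. \<phi> f \<subseteq> cls \<phi> F a} = card (cls \<phi> F a) - 1"
proof -
  obtain g where "bij_betw g (cls \<phi> F a - {a}) {f\<in>F. \<phi> f \<subseteq> cls \<phi> F a}"
    using root_edge_bij[OF assms, of a undefined] by blast
  then have "card {f\<in>F. \<phi> f \<subseteq> cls \<phi> F a} = card (cls \<phi> F a - {a})"
    by (simp add: bij_betw_same_card)
  then show ?thesis using cls_self[of a \<phi> F] by (metis card_Diff_singleton)
qed

text \<open>The bijection of \<open>root_edge_bij\<close> restricts to the vertices on the other
  side from the root; the root is not among them.\<close>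

lemma card_oddroot:
  assumes "forest \<phi> F" "\<And>e. e \<in> F \<Longrightarrow> \<exists>u v. \<phi> e = {u, v}"
  shows "card {f\<in>F. \<phi> f \<subseteq> cls \<phi> F a \<and> oddroot \<phi> \<sigma> F a f} = card {v\<in>cls \<phi> F a. \<sigma> v \<noteq> \<sigma> a}"
proof -
  obtain g where g: "bij_betw g (cls \<phi> F a - {a}) {f\<in>F. \<phi> f \<subseteq> cls \<phi> F a}"
    "\<And>v. v \<in> cls \<phi> F a - {a} \<Longrightarrow> oddroot \<phi> \<sigma> F a (g v) \<longleftrightarrow> \<sigma> v \<noteq> \<sigma> a"
    using root_edge_bij[OF assms, of a \<sigma>] by blast
  have "bij_betw g {v\<in>cls \<phi> F a. \<sigma> v \<noteq> \<sigma> a} {f\<in>F. \<phi> f \<subseteq> cls \<phi> F a \<and> oddroot \<phi> \<sigma> F a f}"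
    using g(1) unfolding bij_betw_def
  proof (intro conjI; elim conjE)
    assume i: "inj_on g (cls \<phi> F a - {a})" and im: "g ` (cls \<phi> F a - {a}) = {f\<in>F. \<phi> f \<subseteq> cls \<phi> F a}"
    show "inj_on g {v\<in>cls \<phi> F a. \<sigma> v \<noteq> \<sigma> a}" by (rule inj_on_subset[OF i]) auto
    show "g ` {v\<in>cls \<phi> F a. \<sigma> v \<noteq> \<sigma> a} = {f\<in>F. \<phi> f \<subseteq> cls \<phi> F a \<and> oddroot \<phi> \<sigma> F a f}"
    proof
      show "g ` {v\<in>cls \<phi> F a. \<sigma> v \<noteq> \<sigma> a} \<subseteq> {f\<in>F. \<phi> f \<subseteq> cls \<phi> F a \<and> oddroot \<phi> \<sigma> F a f}"
      proof
        fix f assume "f \<in> g ` {v\<in>cls \<phi> F a. \<sigma> v \<noteq> \<sigma> a}"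
        then obtain v where v: "v \<in> cls \<phi> F a - {a}" "\<sigma> v \<noteq> \<sigma> a" "f = g v" by auto
        then have "f \<in> {f\<in>F. \<phi> f \<subseteq> cls \<phi> F a}" using im by blast
        then show "f \<in> {f\<in>F. \<phi> f \<subseteq> cls \<phi> F a \<and> oddroot \<phi> \<sigma> F a f}" using v g(2)[OF v(1)] by simp
      qed
      show "{f\<in>F. \<phi> f \<subseteq> cls \<phi> F a \<and> oddroot \<phi> \<sigma> F a f} \<subseteq> g ` {v\<in>cls \<phi> F a. \<sigma> v \<noteq> \<sigma> a}"
      proof
        fix f assume f: "f \<in> {f\<in>F. \<phi> f \<subseteq> cls \<phi> F a \<and> oddroot \<phi> \<sigma> F a f}"
        then have "f \<in> g ` (cls \<phi> F a - {a})" using im by blast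
        then obtain v where v: "v \<in> cls \<phi> F a - {a}" "f = g v" by blast
        then have "\<sigma> v \<noteq> \<sigma> a" using f g(2)[OF v(1)] by simp
        then show "f \<in> g ` {v\<in>cls \<phi> F a. \<sigma> v \<noteq> \<sigma> a}" using v by blast
      qed
    qed
  qed
  then show ?thesis by (simp add: bij_betw_same_card)
qed

lemma pair_mset_eq: "{#a, b#} = {#c, d#} \<longleftrightarrow> a = c \<and> b = d \<or> a = d \<and> b = c"
  by (auto simp: add_eq_conv_ex)

text \<open>The end edges of the path between two vertices determine the two vertices.\<close>

lemma card_oddpath:
  assumes fo: "forest \<phi> F"
  shows "card {{#e, f#} | e f. oddpath \<phi> \<sigma> F e f \<and> \<phi> e \<subseteq> cls \<phi> F a} =
     card {v\<in>cls \<phi> F a. \<sigma> v} * card {v\<in>cls \<phi> F a. \<not> \<sigma> v}" (is "card ?D = _")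
proof -
  let ?S = "cls \<phi> F a"
  let ?A = "{v\<in>?S. \<sigma> v}" and ?B = "{v\<in>?S. \<not> \<sigma> v}"
  obtain pv pe where "\<And>u v. (u, v) \<in> conn \<phi> F \<Longrightarrow> chain \<phi> F (pv u v) (pe u v) \<and> distinct (pv u v) \<and>
     hd (pv u v) = u \<and> last (pv u v) = v \<and> (u \<noteq> v \<longrightarrow> pe u v \<noteq> [])"
    using conn_path_family[of \<phi> F] by blast
  then have p: "chain \<phi> F (pv u v) (pe u v)" "distinct (pv u v)" "pe u v \<noteq> []"
    "hd (pv u v) = u" "last (pv u v) = v" if "u \<in> ?A" "v \<in> ?B" for u v
    using that cls_eqI[of u \<phi> F a] in_cls[of v \<phi> F u] by auto
  define h where "h = (\<lambda>(u, v). {#hd (pe u v), last (pe u v)#})"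
  have "bij_betw h (?A \<times> ?B) ?D"
  proof (rule bij_betwI')
    fix x y assume "x \<in> ?A \<times> ?B" "y \<in> ?A \<times> ?B"
    then obtain u v u' v' where x: "x = (u, v)" "u \<in> ?A" "v \<in> ?B" and y: "y = (u', v')" "u' \<in> ?A" "v' \<in> ?B"
      by blast
    note P = p[OF x(2,3)] and Q = p[OF y(2,3)]
    show "h x = h y \<longleftrightarrow> x = y"
    proof
      assume "h x = h y"
      then consider (1) "hd (pe u v) = hd (pe u' v')" "last (pe u v) = last (pe u' v')" |
        (2) "hd (pe u v) = last (pe u' v')" "last (pe u v) = hd (pe u' v')"
        unfolding h_def x y by (auto simp: pair_mset_eq)
      then show "x = y"
      proof cases
        case 1
        show ?thesis
        proof (cases "hd (pe u v) = last (pe u v)")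
          case True
          then have e: "pe u v = [hd (pe u v)]" "pe u' v' = [hd (pe u v)]"
            using single_edge_path[OF P(1-3)] single_edge_path[OF Q(1-3)] 1 by auto
          have "\<phi> (hd (pe u v)) = {u, v}" "\<phi> (hd (pe u v)) = {u', v'}"
            using chain_singleton_edge[of \<phi> F "pv u v" "hd (pe u v)"]
              chain_singleton_edge[of \<phi> F "pv u' v'" "hd (pe u v)"] P Q e by auto
          then show ?thesis using x y by (auto simp: doubleton_eq_iff)
        next
          case False
          then show ?thesis using path_ends_unique[OF fo P(1-3) Q(1-3) 1] P Q x y by auto
        qed
      next
        case 2
        have R: "chain \<phi> F (rev (pv u' v')) (rev (pe u' v'))" "distinct (rev (pv u' v'))" "rev (pe u' v') \<noteq> []"
          using chain_rev[OF Q(1)] Q by auto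
        note Rs = chain_rev_simps[OF Q(1,3)]
        show ?thesis
        proof (cases "hd (pe u v) = last (pe u v)")
          case True
          then have e: "pe u v = [hd (pe u v)]" "pe u' v' = [hd (pe u v)]"
            using single_edge_path[OF P(1-3)] single_edge_path[OF Q(1-3)] 2 by auto
          have "\<phi> (hd (pe u v)) = {u, v}" "\<phi> (hd (pe u v)) = {u', v'}"
            using chain_singleton_edge[of \<phi> F "pv u v" "hd (pe u v)"]
              chain_singleton_edge[of \<phi> F "pv u' v'" "hd (pe u v)"] P Q e by auto
          then show ?thesis using x y by (auto simp: doubleton_eq_iff)
        next
          case False
          \<comment> \<open>Impossible, as \<sigma> holds at \<open>u\<close> and fails at
            \<open>v'\<close>: the reversed coincidence occurs for single edges only.\<close>
          then have "u = v'" using path_ends_unique(1)[OF fo P(1-3) R] P Q Rs 2 by auto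
          then show ?thesis using x y by auto
        qed
      qed
    qed simp
  next
    fix x assume "x \<in> ?A \<times> ?B"
    then obtain u v where x: "x = (u, v)" "u \<in> ?A" "v \<in> ?B" by blast
    note P = p[OF x(2,3)]
    have "oddpath \<phi> \<sigma> F (hd (pe u v)) (last (pe u v))" using x P by (intro oddpathI) auto
    moreover have "\<phi> (hd (pe u v)) \<subseteq> ?S"
    proof -
      have "\<phi> (hd (pe u v)) \<subseteq> set (pv u v)" using P by (intro chain_ends[OF P(1)]) auto
      also have "\<dots> \<subseteq> ?S" 
        using chain_in_cls[OF P(1), of u a] P(4) hd_in_set[OF chain_ne[OF P(1)]] x(2) by (auto simp del: hd_in_set)
      finally show ?thesis .
    qed
    ultimately show "h x \<in> ?D" using x by (auto simp: h_def)
  next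
    fix M assume "M \<in> ?D"
    then obtain e f where M: "M = {#e, f#}" "oddpath \<phi> \<sigma> F e f" "\<phi> e \<subseteq> ?S" by auto
    then obtain vs es where q: "chain \<phi> F vs es" "distinct vs" "es \<noteq> []" "hd es = e" "last es = f"
      "\<sigma> (hd vs) \<noteq> \<sigma> (last vs)" by (auto simp: oddpath_def)
    have S: "hd vs \<in> ?S" "last vs \<in> ?S"
      using chain_hd_edge[OF q(1,3)] q M oddpath_edges(3)[OF M(2)] by blast+
    show "\<exists>x\<in>?A \<times> ?B. M = h x"
    proof (cases "\<sigma> (hd vs)")
      case True
      then have ab: "hd vs \<in> ?A" "last vs \<in> ?B" using S q by auto
      note P = p[OF ab]
      have "hd (pe (hd vs) (last vs)) = e" "last (pe (hd vs) (last vs)) = f"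
        using path_first_edge_unique[OF fo P(1-3) q(1-3)] path_last_edge_unique[OF fo P(1-3) q(1-3)] P q by auto
      then show ?thesis using ab M by (intro bexI[of _ "(hd vs, last vs)"]) (auto simp: h_def)
    next
      case False
      then have ab: "last vs \<in> ?A" "hd vs \<in> ?B" using S q by auto
      note P = p[OF ab]
      have R: "chain \<phi> F (rev vs) (rev es)" "distinct (rev vs)" "rev es \<noteq> []"
        using chain_rev[OF q(1)] q by auto
      have "hd (pe (last vs) (hd vs)) = f" "last (pe (last vs) (hd vs)) = e"
        using path_first_edge_unique[OF fo P(1-3) R] path_last_edge_unique[OF fo P(1-3) R] P q
          chain_rev_simps[OF q(1,3)] by auto
      then show ?thesis using ab M by (intro bexI[of _ "(last vs, hd vs)"]) (auto simp: h_def)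
    qed
  qed
  then have "card (?A \<times> ?B) = card ?D" by (rule bij_betw_same_card)
  then show ?thesis by (simp add: card_cartesian_product)
qed

section \<open>Subsets of the cone edges\<close>

text \<open>Reduces acyclicity to the added edges. A bridge of the whole remains a bridge of every
  intermediate set, and inserting a bridge keeps the older edges bridges.\<close>

lemma forest_add_bridges:
  assumes "finite W" "forest \<phi> I" "W \<inter> I = {}"
    and "\<And>e. e \<in> W \<Longrightarrow> \<exists>u v. \<phi> e = {u, v} \<and> (u, v) \<notin> conn \<phi> (I \<union> W - {e})"
  shows "forest \<phi> (I \<union> W)"
  using assms
proof (induction W)
  case (insert e W)
  have sub: "I \<union> W - {f} \<subseteq> I \<union> insert e W - {f}" for f by auto
  have "forest \<phi> (I \<union> W)"
  proof (rule insert.IH)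
    fix f assume "f \<in> W"
    then obtain u v where "\<phi> f = {u, v}" "(u, v) \<notin> conn \<phi> (I \<union> insert e W - {f})"
      using insert.prems(3)[of f] by auto
    then show "\<exists>u v. \<phi> f = {u, v} \<and> (u, v) \<notin> conn \<phi> (I \<union> W - {f})"
      using conn_mono[OF sub, of u v \<phi> f] by auto
  qed (use insert.prems in auto)
  moreover obtain u v where uv: "\<phi> e = {u, v}" "(u, v) \<notin> conn \<phi> (I \<union> insert e W - {e})"
    using insert.prems(3)[of e] by auto
  moreover have "I \<union> insert e W - {e} = I \<union> W" using insert by auto
  ultimately show ?case using forest_insert[of \<phi> "I \<union> W" e u v] by simp
qed simp

text \<open>What the two counts share: the fixed independent set \<open>I\<close> on the vertices
  other than 0, with \<open>r\<close> for 0-bar and \<sigma> for membership in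
  \<open>A\<close>.\<close>

locale rooted_forest =
  fixes \<phi> :: "'e \<Rightarrow> 'v set" and V :: "'v set" and r :: 'v and \<sigma> :: "'v \<Rightarrow> bool" and I :: "'e set"
  assumes finV: "finite V" and rV: "r \<in> V" and \<sigma>r: "\<not> \<sigma> r"
    and fo: "forest \<phi> I" and finI: "finite I"
    and ends: "\<And>e. e \<in> I \<Longrightarrow> \<exists>u\<in>V. \<exists>v\<in>V. \<phi> e = {u, v}"
begin

abbreviation K :: "'v \<Rightarrow> 'v set" where "K \<equiv> cls \<phi> I"
abbreviation S\<^sub>0 :: "'v set" where "S\<^sub>0 \<equiv> cls \<phi> I r"
definition Cs :: "'v set set" where "Cs = K ` V - {S\<^sub>0}"

lemma finCs: "finite Cs" using finV by (simp add: Cs_def)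
lemma S0_notin: "S\<^sub>0 \<notin> Cs" by (simp add: Cs_def)
lemma insert_Cs: "insert S\<^sub>0 Cs = K ` V" using rV by (auto simp: Cs_def)

lemma edge_ends: "e \<in> I \<Longrightarrow> \<phi> e = {u, v} \<Longrightarrow> u \<in> V \<and> v \<in> V"
  using ends[of e] by (auto simp: doubleton_eq_iff)

lemma conn_V: "(u, v) \<in> conn \<phi> I \<Longrightarrow> u \<in> V \<Longrightarrow> v \<in> V"
  by (erule conn_closed) (auto dest: edge_ends)

lemma K_subset: "u \<in> V \<Longrightarrow> K u \<subseteq> V"
  using conn_V by (auto simp: in_cls)

lemma K_eq_iff: "S \<in> K ` V \<Longrightarrow> K u = S \<longleftrightarrow> u \<in> S"
  using cls_eqI cls_self by (metis imageE)

lemma K_set: "S \<in> K ` V \<Longrightarrow> {u\<in>V. K u = S} = S"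
  using K_eq_iff[of S] K_subset by auto

lemma finK: "S \<in> K ` V \<Longrightarrow> finite S"
  by (auto intro: finite_subset[OF K_subset finV])

end

text \<open>Here \<open>z\<close> is the vertex 0 and \<open>t x\<close> the tree edge owned by
  \<open>x\<close>, so that sets of tree edges are handled as sets of vertices. The exception
  \<open>x = r\<close> is the edge between 0-bar and 0.\<close>

locale rooted_cone = rooted_forest \<phi> V r \<sigma> I
  for \<phi> :: "'e \<Rightarrow> 'v set" and V :: "'v set" and r :: 'v and \<sigma> :: "'v \<Rightarrow> bool" and I :: "'e set" +
  fixes z :: 'v and t :: "'v \<Rightarrow> 'e"
  assumes zV: "z \<notin> V" and inj_t: "inj_on t V" and t_I: "t ` V \<inter> I = {}"
    and t_ends: "\<And>x. x \<in> V \<Longrightarrow> \<phi> (t x) = {x, if \<sigma> x \<or> x = r then z else r}"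
begin

abbreviation p where "p x \<equiv> (if \<sigma> x \<or> x = r then z else r)"

text \<open>The component links \<open>z\<close> and \<open>r\<close>. If it contains
  \<open>r\<close>, a single attachment to \<open>z\<close> is enough.\<close>

definition doubly_attached where "doubly_attached U S \<longleftrightarrow> (\<exists>a\<in>U \<inter> S. p a = z \<and> (r \<in> S \<or> (\<exists>b\<in>U \<inter> S. p b = r)))"

definition admissible where "admissible U \<longleftrightarrow>
  (\<forall>u\<in>U. \<forall>u'\<in>U. u \<noteq> u' \<longrightarrow> K u = K u' \<longrightarrow> p u \<noteq> p u') \<and>
  (\<forall>u\<in>U \<inter> S\<^sub>0. p u = z) \<and>
  (\<forall>S\<in>K ` V. \<forall>S'\<in>K ` V. doubly_attached U S \<longrightarrow> doubly_attached U S' \<longrightarrow> S = S')"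

lemma zr: "z \<noteq> r" using zV rV by auto

text \<open>Every violation produces a bypass of some \<open>t u\<close>: two attachments to the
  same point close up inside the component, an attachment of the root component to \<open>r\<close>
  is bypassed inside that component, and two links between \<open>z\<close> and \<open>r\<close>
  bypass each other.\<close>

lemma forest_imp_admissible:
  assumes U: "U \<subseteq> V" and X: "forest \<phi> (I \<union> t ` U)"
  shows "admissible U"
proof -
  let ?X = "\<lambda>u. I \<union> t ` U - {t u}"
  have sep: "(u, p u) \<notin> conn \<phi> (?X u)" if "u \<in> U" for u
    using forestD[OF X, of "t u" u "p u"] t_ends[of u] that U by auto
  have cI: "(x, y) \<in> conn \<phi> (?X u)" if "K x = K y" "u \<in> U" for x y u
  proof (rule conn_mono)
    show "I \<subseteq> ?X u" using t_I that U by auto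
    show "(x, y) \<in> conn \<phi> I" using that by (simp add: cls_eq_iff)
  qed
  have ct: "(w, p w) \<in> conn \<phi> (?X u)" if "w \<in> U" "u \<in> U" "w \<noteq> u" for u w
  proof (rule conn_edge[of "t w"])
    show "t w \<in> ?X u" using that U inj_t by (auto simp: inj_on_def)
    show "\<phi> (t w) = {w, p w}" using t_ends that U by blast
  qed
  have 1: "p u \<noteq> p u'" if u: "u \<in> U" "u' \<in> U" "u \<noteq> u'" "K u = K u'" for u u'
  proof
    assume eq: "p u = p u'"
    have "(u, p u') \<in> conn \<phi> (?X u)"
      by (rule rtrancl_trans[OF cI[OF u(4,1)] ct[OF u(2,1)]]) (use u(3) in blast)
    then show False using sep[OF u(1), unfolded eq] by blast
  qed
  have 2: "p u = z" if "u \<in> U" "u \<in> S\<^sub>0" for u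
    using sep[OF that(1)] cI[of u r u] that cls_eqI[OF that(2)] by (auto split: if_splits)
  have 3: "S = S'" if S: "S \<in> K ` V" "S' \<in> K ` V" and d: "doubly_attached U S" "doubly_attached U S'" for S S'
  proof (rule ccontr)
    assume ne: "S \<noteq> S'"
    obtain a where a: "a \<in> U" "a \<in> S" "p a = z" "r \<in> S \<or> (\<exists>b\<in>U \<inter> S. p b = r)"
      using d(1) unfolding doubly_attached_def by auto
    obtain a' where a': "a' \<in> U" "a' \<in> S'" "p a' = z" "r \<in> S' \<or> (\<exists>b\<in>U \<inter> S'. p b = r)"
      using d(2) unfolding doubly_attached_def by auto
    \<comment> \<open>Both doubly attached components reach \<open>r\<close> without
      \<open>t a\<close>, and \<open>S'\<close> also reaches \<open>z\<close>. Hence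
      \<open>a\<close> reaches \<open>z\<close> without its own edge.\<close>
    have key: "(x, r) \<in> conn \<phi> (?X a)" if T: "T \<in> K ` V" "x \<in> T" "r \<in> T \<or> (\<exists>b\<in>U \<inter> T. p b = r)" for T x
      using T(3)
    proof
      assume "r \<in> T"
      then have "K x = K r" using T K_eq_iff[OF T(1)] by metis
      then show ?thesis using cI a by blast
    next
      assume "\<exists>b\<in>U \<inter> T. p b = r"
      then obtain b where b: "b \<in> U" "b \<in> T" "p b = r" by auto
      then have "b \<noteq> a" using a(3) zr by auto
      then have "(b, r) \<in> conn \<phi> (?X a)" using ct[OF b(1) a(1)] b(3) by simp
      moreover have "K x = K b" using T(2) b(2) K_eq_iff[OF T(1)] by metis
      ultimately show ?thesis using cI[OF _ a(1)] rtrancl_trans by metis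
    qed
    have "a' \<noteq> a" using ne a a' S K_eq_iff by metis
    then have "(a', z) \<in> conn \<phi> (?X a)" using ct[OF a'(1) a(1)] a'(3) by simp
    moreover have "(a, r) \<in> conn \<phi> (?X a)" "(a', r) \<in> conn \<phi> (?X a)" using key a a' S by blast+
    ultimately have "(a, z) \<in> conn \<phi> (?X a)" using conn_sym rtrancl_trans by metis
    then show False using sep[OF a(1)] a(3) by simp
  qed
  show ?thesis using 1 2 3 unfolding admissible_def by blast
qed

text \<open>Every tree edge is a bridge: a component without a double attachment is itself cut off by
  its edge; for the doubly attached component, cut off \<open>z\<close> with everything hanging from it.\<close>

lemma admissible_imp_forest:
  assumes U: "U \<subseteq> V" and adm: "admissible U"
  shows "forest \<phi> (I \<union> t ` U)"
proof (rule forest_add_bridges)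
  have A: "p u \<noteq> p u'" if "u \<in> U" "u' \<in> U" "u \<noteq> u'" "K u = K u'" for u u'
    using adm that unfolding admissible_def by blast
  have B: "p u = z" if "u \<in> U" "u \<in> S\<^sub>0" for u
    using adm that unfolding admissible_def by blast
  have C: "S = S'" if "S \<in> K ` V" "S' \<in> K ` V" "doubly_attached U S" "doubly_attached U S'" for S S'
    using adm that unfolding admissible_def by blast
  show "finite (t ` U)" using finite_subset[OF U finV] by simp
  show "forest \<phi> I" by (rule fo)
  show "t ` U \<inter> I = {}" using t_I U by auto
  fix e assume "e \<in> t ` U"
  then obtain u where u: "u \<in> U" "e = t u" by auto
  let ?X = "I \<union> t ` U - {t u}"
  let ?S = "K u"
  have S: "?S \<in> K ` V" using u U by auto
  have edge: "(e \<in> I \<and> (x, y) \<in> conn \<phi> I \<and> x \<in> V \<and> y \<in> V) \<or>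
      (\<exists>w\<in>U. w \<noteq> u \<and> (x = w \<and> y = p w \<or> x = p w \<and> y = w))" 
    if eX: "e \<in> ?X" and exy: "\<phi> e = {x, y}" for e x y
  proof (cases "e \<in> I")
    case True
    then show ?thesis using conn_edge[of e I \<phi>, OF True exy] edge_ends[OF True exy] by blast
  next
    case False
    then obtain w where w: "w \<in> U" "e = t w" "w \<noteq> u" using eX by auto
    have "\<phi> (t w) = {w, p w}" using t_ends w(1) U by blast
    then have "{x, y} = {w, p w}" by (simp only: w(2)[symmetric] exy)
    then have "x = w \<and> y = p w \<or> x = p w \<and> y = w" unfolding doubleton_eq_iff by blast
    then show ?thesis using w by blast
  qed
  \<comment> \<open>The vertex \<open>z\<close> with all components hanging from it other than that
    of \<open>u\<close>. It is the side of \<open>z\<close> in the cut made by removing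
    \<open>t u\<close> when \<open>t u\<close> leads to \<open>z\<close>.\<close>
  define Z where "Z = insert z {v. \<exists>w\<in>U. p w = z \<and> K w = K v \<and> w \<notin> ?S}"
  have noV: "z \<notin> U" "z \<notin> ?S" using zV U K_subset[of u] u by auto
  have cl: "y \<in> ?S" if "x \<in> ?S" "(x, y) \<in> conn \<phi> I" for x y
    using that unfolding in_cls by (rule rtrancl_trans)
  have "(u, p u) \<notin> conn \<phi> ?X"
  proof (cases "doubly_attached U ?S")
    case False
    have rS: "r \<notin> ?S"
    proof
      assume "r \<in> ?S"
      then have "u \<in> S\<^sub>0" using cls_eqI[of r \<phi> I u] cls_self[of u \<phi> I] by simp
      then show False using False B[OF u(1)] u \<open>r \<in> ?S\<close> cls_self[of u \<phi> I] by (auto simp: doubly_attached_def)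
    qed
    have only: "w = u" if "w \<in> U" "w \<in> ?S" for w
    proof (rule ccontr)
      assume "w \<noteq> u"
      then have "p w \<noteq> p u" using A[OF that(1) u(1)] cls_eqI[OF that(2)] by simp
      then have "doubly_attached U ?S" unfolding doubly_attached_def using u(1) that cls_self[of u \<phi> I] zr
        by (cases "p w = z") (auto split: if_splits)
      then show False using False by simp
    qed
    show ?thesis
    proof
      assume "(u, p u) \<in> conn \<phi> ?X"
      then have "p u \<in> ?S"
      proof (rule conn_closed)
        fix e x y assume "e \<in> ?X" "\<phi> e = {x, y}" "x \<in> ?S"
        then show "y \<in> ?S" using edge[of e x y] cl[of x y] only noV rS by (auto split: if_splits)
      qed (rule cls_self)
      then show False using noV rS by (auto split: if_splits)
    qed
  next
    case True
    \<comment> \<open>The component of \<open>u\<close> is the only doubly attached one, so the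
      other components hanging from \<open>z\<close> have no contact with \<open>r\<close>.\<close>
    have nd: "v \<noteq> r \<and> \<not> (v \<in> U \<and> p v = r)"
      if "w \<in> U" "p w = z" "w \<notin> ?S" "K w = K v" for w v
    proof (rule ccontr)
      assume "\<not> ?thesis"
      moreover have "v \<in> K w" using that(4) cls_self[of v \<phi> I] by simp
      ultimately have "doubly_attached U (K w)" unfolding doubly_attached_def using that(1,2) cls_self[of w \<phi> I] by blast
      then have "K w = ?S" using C[of "K w" ?S] S True that(1) U by blast
      then show False using that(3) cls_self[of w \<phi> I] by simp
    qed
    have rZ: "r \<notin> Z" using nd zr unfolding Z_def by blast
    have bZ: "b \<notin> Z" if "b \<in> U" "p b = r" for b
      using nd[of _ b] that noV unfolding Z_def by blast
    have ZI: "y \<in> Z" if "x \<in> Z" "x \<in> V" "(x, y) \<in> conn \<phi> I" for x y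
      using that zV unfolding Z_def cls_eq_iff[symmetric] by auto
    have uZ: "u \<notin> Z" using u noV unfolding Z_def using cls_self by fastforce
    have zZ: "z \<in> Z" by (simp add: Z_def)
    have wZ: "w \<in> Z" if "w \<in> U" "p w = z" "w \<notin> ?S" for w
      unfolding Z_def using that by blast
    have A': "p w \<noteq> p u" if "w \<in> U" "w \<noteq> u" "w \<in> ?S" for w
      using A[OF that(1) u(1) that(2)] cls_eqI[OF that(3)] by simp
    have pc: "p w = z \<or> p w = r" for w by simp
    show ?thesis
    proof (cases "p u = z")
      case pu: True
      show ?thesis
      proof
        assume "(u, p u) \<in> conn \<phi> ?X"
        then have "(z, u) \<in> conn \<phi> ?X" unfolding pu by (rule conn_sym)
        then have "u \<in> Z"
        proof (rule conn_closed)
          fix e x y assume e: "e \<in> ?X" "\<phi> e = {x, y}" "x \<in> Z"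
          from edge[OF e(1,2)] show "y \<in> Z"
          proof (elim disjE conjE bexE)
            fix w assume "w \<in> U" "w \<noteq> u" "x = w" "y = p w"
            moreover have wZ': "w \<in> Z" using e(3) \<open>x = w\<close> by (simp only:)
            moreover have "p w = z"
            proof (rule disjE[OF pc[of w]])
              assume "p w = r"
              from bZ[OF \<open>w \<in> U\<close> this] wZ' show ?thesis by (rule notE)
            qed
            ultimately show ?thesis using zZ by (simp only:)
          next
            fix w assume "w \<in> U" "w \<noteq> u" "x = p w" "y = w"
            moreover have "p w \<noteq> r" using rZ e(3) calculation by (auto simp only:)
            then have pw: "p w = z" using pc[of w] by blast
            have "w \<notin> ?S"
            proof
              assume "w \<in> ?S"
              from A'[OF \<open>w \<in> U\<close> \<open>w \<noteq> u\<close> this] show False unfolding pw pu by simp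
            qed
            then have "w \<in> Z" by (rule wZ[OF \<open>w \<in> U\<close> pw])
            then show ?thesis using \<open>y = w\<close> by (simp only:)
          qed (use ZI e in blast)
        qed (rule zZ)
        then show False using uZ by simp
      qed
    next
      case False
      \<comment> \<open>Now the removed edge is the link to \<open>r\<close>. The component of
        \<open>u\<close> may still be tied to \<open>z\<close>, so the closed side becomes
        \<open>Z\<close> together with that component.\<close>
      then have pu: "p u = r" using pc[of u] by simp
      have rS: "r \<notin> ?S"
      proof
        assume "r \<in> ?S"
        then have "u \<in> S\<^sub>0" using cls_eqI[of r \<phi> I u] cls_self[of u \<phi> I] by simp
        then show False using False B[OF u(1)] by simp
      qed
      show ?thesis
      proof
        assume "(u, p u) \<in> conn \<phi> ?X"
        then have "p u \<in> Z \<union> ?S"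
        proof (rule conn_closed)
          fix e x y assume e: "e \<in> ?X" "\<phi> e = {x, y}" "x \<in> Z \<union> ?S"
          from edge[OF e(1,2)] show "y \<in> Z \<union> ?S"
          proof (elim disjE conjE bexE)
            fix w assume "w \<in> U" "w \<noteq> u" "x = w" "y = p w"
            moreover have "p w \<noteq> r"
            proof
              assume pw: "p w = r"
              then have "w \<in> ?S" using bZ[of w] e(3) calculation by blast
              from A'[OF \<open>w \<in> U\<close> \<open>w \<noteq> u\<close> this] show False unfolding pw pu by simp
            qed
            then have "p w = z" using pc[of w] by blast
            ultimately show ?thesis using zZ by (simp only: Un_iff simp_thms)
          next
            fix w assume "w \<in> U" "w \<noteq> u" "x = p w" "y = w"
            moreover have "p w \<noteq> r" using rZ rS e(3) calculation by (auto simp only:)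
            then have "p w = z" using pc[of w] by blast
            ultimately show ?thesis using wZ[of w] by blast
          next
            assume "(x, y) \<in> conn \<phi> I" "x \<in> V"
            then show ?thesis using ZI[of x y] cl[of x y] e(3) by blast
          qed
        qed (simp add: cls_self)
        then show False using pu rZ rS by simp
      qed
    qed
  qed
  then show "\<exists>x y. \<phi> e = {x, y} \<and> (x, y) \<notin> conn \<phi> (I \<union> t ` U - {e})"
    using u t_ends[of u] U by blast
qed

text \<open>The root class includes \<open>r\<close> itself, which stands for the tree edge between
  0-bar and 0. Elsewhere a double attachment needs one vertex from each side.\<close>

definition vertex_doubles where "vertex_doubles S = (if S = S\<^sub>0 then {{#v#} | v. v \<in> S \<and> p v = z}
  else {{#a, b#} | a b. a \<in> S \<and> b \<in> S \<and> \<sigma> a \<and> \<not> \<sigma> b})"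

lemma part_set:
  assumes "finite U" "U \<subseteq> V" "S \<in> K ` V"
  shows "part K S (mset_set U) = mset_set (U \<inter> S)"
proof -
  have "{u\<in>U. K u = S} = U \<inter> S" using K_eq_iff[OF assms(3)] by auto
  then show ?thesis using assms(1) by (simp add: part_def)
qed

lemma p_z: "p v = z \<longleftrightarrow> \<sigma> v \<or> v = r"
  using zr by auto

lemma mset_set_eq_pair:
  assumes "finite X" "mset_set X = {#a, b#}"
  shows "X = {a, b} \<and> a \<noteq> b"
proof -
  have "set_mset (mset_set X) = {a, b}" using assms(2) by simp
  then have X: "X = {a, b}" using assms(1) by simp
  then show ?thesis using assms(2) by (cases "a = b") auto
qed

text \<open>The hypotheses \<open>s\<close> and \<open>d\<close> follow from admissibility and also
  from membership in \<open>mixed\<close>, so that the lemma serves both directions of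
  \<open>admissible_iff_mixed\<close>.\<close>

lemma vertex_doubles_iff:
  assumes U: "finite U" "U \<subseteq> V" and S: "S \<in> K ` V"
    and s: "S = S\<^sub>0 \<Longrightarrow> \<exists>v. U \<inter> S \<subseteq> {v}"
    and d: "S \<noteq> S\<^sub>0 \<Longrightarrow> \<forall>u\<in>U \<inter> S. \<forall>u'\<in>U \<inter> S. u \<noteq> u' \<longrightarrow> p u \<noteq> p u'"
  shows "part K S (mset_set U) \<in> vertex_doubles S \<longleftrightarrow> doubly_attached U S"
proof (cases "S = S\<^sub>0")
  case True
  have rS: "r \<in> S" using True cls_self by metis
  obtain v where v: "U \<inter> S \<subseteq> {v}" using s True by blast
  show ?thesis
  proof
    assume "part K S (mset_set U) \<in> vertex_doubles S"
    then obtain w where w: "mset_set (U \<inter> S) = {#w#}" "w \<in> S" "p w = z"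
      unfolding part_set[OF U S] vertex_doubles_def using True by auto
    then have "w \<in> U \<inter> S" using finite_set_mset_mset_set[of "U \<inter> S"] U by auto
    then show "doubly_attached U S" using w rS unfolding doubly_attached_def by blast
  next
    assume "doubly_attached U S"
    then obtain a where a: "a \<in> U \<inter> S" "p a = z" unfolding doubly_attached_def by blast
    then have "U \<inter> S = {a}" using v by blast
    then show "part K S (mset_set U) \<in> vertex_doubles S"
      unfolding part_set[OF U S] vertex_doubles_def using True a by auto
  qed
next
  case False
  have rS: "r \<notin> S" using False S K_eq_iff[OF S] by blast
  have pS: "p v = z \<longleftrightarrow> \<sigma> v" "p v = r \<longleftrightarrow> \<not> \<sigma> v" if "v \<in> S" for v
    using that rS zr by auto
  show ?thesis
  proof
    assume "part K S (mset_set U) \<in> vertex_doubles S"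
    then obtain a b where ab: "mset_set (U \<inter> S) = {#a, b#}" "a \<in> S" "b \<in> S" "\<sigma> a" "\<not> \<sigma> b"
      unfolding part_set[OF U S] vertex_doubles_def using False by auto
    then have "U \<inter> S = {a, b}" using mset_set_eq_pair[OF _ ab(1)] U by auto
    then show "doubly_attached U S" unfolding doubly_attached_def using pS ab by blast
  next
    assume "doubly_attached U S"
    then obtain a b where ab: "a \<in> U \<inter> S" "p a = z" "b \<in> U \<inter> S" "p b = r"
      unfolding doubly_attached_def using rS by blast
    then have sab: "\<sigma> a" "\<not> \<sigma> b" using pS by auto
    have "w = a \<or> w = b" if w: "w \<in> U \<inter> S" for w
      using d[OF False] w ab by (metis (full_types))
    then have "U \<inter> S = {a, b}" using ab by blast
    moreover have "a \<noteq> b" using sab by auto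
    ultimately have "mset_set (U \<inter> S) = {#a, b#}" by simp
    then show "part K S (mset_set U) \<in> vertex_doubles S"
      unfolding part_set[OF U S] vertex_doubles_def if_not_P[OF False] using ab(1,3) sab by blast
  qed
qed

text \<open>As \<open>p\<close> has only two values, a component may contribute more than one vertex
  only as a pair attached to both points, which is an exceptional part. In the root component any
  attachment is exceptional at once.\<close>

lemma admissible_iff_mixed:
  assumes U: "U \<subseteq> V"
  shows "admissible U \<longleftrightarrow> mset_set U \<in> mixed V K Cs S\<^sub>0 vertex_doubles"
proof -
  have fU: "finite U" using U finV by (rule finite_subset)
  have S0: "S\<^sub>0 \<in> K ` V" using rV by auto
  have CsD: "S \<in> Cs \<Longrightarrow> S \<in> K ` V \<and> S \<noteq> S\<^sub>0" for S by (auto simp: Cs_def)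
  have cardp: "size (part K S (mset_set U)) = card (U \<inter> S)" if "S \<in> K ` V" for S
    using part_set[OF fU U that] by simp
  show ?thesis
  proof
    assume adm: "admissible U"
    have A: "p u \<noteq> p u'" if "u \<in> U" "u' \<in> U" "u \<noteq> u'" "K u = K u'" for u u'
      using adm that unfolding admissible_def by blast
    have A': "p u \<noteq> p u'" if "u \<in> U \<inter> S" "u' \<in> U \<inter> S" "u \<noteq> u'" "S \<in> K ` V" for u u' S
      using A[of u u'] that K_eq_iff[OF that(4)] by blast
    have B: "p u = z" if "u \<in> U \<inter> S\<^sub>0" for u
      using adm that unfolding admissible_def by blast
    have C: "S = S'" if "S \<in> K ` V" "S' \<in> K ` V" "doubly_attached U S" "doubly_attached U S'" for S S'
      using adm that unfolding admissible_def by blast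
    have s0: "\<exists>v. U \<inter> S\<^sub>0 \<subseteq> {v}"
    proof (cases "U \<inter> S\<^sub>0 = {}")
      case False
      then obtain v where v: "v \<in> U \<inter> S\<^sub>0" by blast
      have "w = v" if "w \<in> U \<inter> S\<^sub>0" for w
        using A'[OF that v _ S0] B[OF that] B[OF v] by metis
      then show ?thesis by blast
    qed auto
    have iff: "part K S (mset_set U) \<in> vertex_doubles S \<longleftrightarrow> doubly_attached U S" if "S \<in> K ` V" for S
      using s0 A' that by (intro vertex_doubles_iff[OF fU U that]) blast+
    have 1: "size (part K S (mset_set U)) \<le> 1 \<or> part K S (mset_set U) \<in> vertex_doubles S" if S: "S \<in> Cs" for S
    proof (cases "\<exists>a\<in>U \<inter> S. \<exists>b\<in>U \<inter> S. a \<noteq> b")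
      case True
      then obtain a b where ab: "a \<in> U \<inter> S" "b \<in> U \<inter> S" "a \<noteq> b" by blast
      then have "p a \<noteq> p b" using A' CsD[OF S] by blast
      then have "doubly_attached U S" unfolding doubly_attached_def using ab by (cases "p a = z") (auto split: if_splits)
      then show ?thesis using iff CsD[OF S] by blast
    next
      case False
      then have "card (U \<inter> S) \<le> 1" using card_le_Suc0_iff_eq[of "U \<inter> S"] fU by auto
      then show ?thesis using cardp CsD[OF S] by simp
    qed
    have 2: "part K S\<^sub>0 (mset_set U) = {#} \<or> part K S\<^sub>0 (mset_set U) \<in> vertex_doubles S\<^sub>0"
    proof (cases "U \<inter> S\<^sub>0 = {}")
      case True
      then show ?thesis using part_set[OF fU U S0] by simp
    next
      case False
      then have "doubly_attached U S\<^sub>0" unfolding doubly_attached_def using B cls_self[of r \<phi> I] by blast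
      then show ?thesis using iff S0 by blast
    qed
    have 3: "S = S'" if "S \<in> insert S\<^sub>0 Cs" "S' \<in> insert S\<^sub>0 Cs"
      "part K S (mset_set U) \<in> vertex_doubles S" "part K S' (mset_set U) \<in> vertex_doubles S'" for S S'

    proof -
      have s: "S \<in> K ` V" "S' \<in> K ` V" using that(1,2) unfolding insert_Cs by auto
      show ?thesis
        by (rule C[OF s iff[OF s(1), THEN iffD1, OF that(3)] iff[OF s(2), THEN iffD1, OF that(4)]])
    qed
    show "mset_set U \<in> mixed V K Cs S\<^sub>0 vertex_doubles"
      unfolding mixed_def mem_Collect_eq finite_set_mset_mset_set[OF fU]
    proof (intro conjI ballI impI)
      show "U \<subseteq> V" by (rule U)
    qed (fact 1 2 3)+
  next
    assume M: "mset_set U \<in> mixed V K Cs S\<^sub>0 vertex_doubles"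
    have s0': "U \<inter> S\<^sub>0 = {} \<or> (\<exists>v. U \<inter> S\<^sub>0 = {v} \<and> p v = z)"
    proof -
      have D: "vertex_doubles S\<^sub>0 = {{#v#} | v. v \<in> S\<^sub>0 \<and> p v = z}" unfolding vertex_doubles_def if_P[OF refl] ..
      have "part K S\<^sub>0 (mset_set U) = {#} \<or> part K S\<^sub>0 (mset_set U) \<in> vertex_doubles S\<^sub>0"
        using M unfolding mixed_def by blast
      then consider "mset_set (U \<inter> S\<^sub>0) = {#}" | v where "mset_set (U \<inter> S\<^sub>0) = {#v#}" "p v = z"
        unfolding part_set[OF fU U S0] D by blast
      then show ?thesis
      proof cases
        case 1
        then show ?thesis using fU by (simp add: mset_set_empty_iff)
      next
        case (2 v)
        have "set_mset (mset_set (U \<inter> S\<^sub>0)) = {v}" unfolding 2(1) by simp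
        then have "U \<inter> S\<^sub>0 = {v}" using fU by simp
        then show ?thesis using 2(2) by blast
      qed
    qed
    have sS: "p a \<noteq> p b" if S: "S \<in> Cs" and ab: "a \<in> U \<inter> S" "b \<in> U \<inter> S" "a \<noteq> b" for S a b
    proof -
      have "2 \<le> card (U \<inter> S)"
        using card_mono[of "U \<inter> S" "{a, b}"] ab fU by auto
      then have "part K S (mset_set U) \<in> vertex_doubles S" using M S cardp CsD[OF S] unfolding mixed_def by force
      then obtain x y where xy: "mset_set (U \<inter> S) = {#x, y#}" "x \<in> S" "y \<in> S" "\<sigma> x" "\<not> \<sigma> y"
        unfolding part_set[OF fU U conjunct1[OF CsD[OF S]]] vertex_doubles_def using CsD[OF S] by auto
      then have "U \<inter> S = {x, y}" using mset_set_eq_pair[OF _ xy(1)] fU by auto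
      moreover have "r \<notin> S" using CsD[OF S] K_eq_iff[of S r] by auto
      ultimately show ?thesis using ab xy zr by auto
    qed
    have A': "p u \<noteq> p u'" if "u \<in> U \<inter> S" "u' \<in> U \<inter> S" "u \<noteq> u'" "S \<in> K ` V" for u u' S
    proof (cases "S = S\<^sub>0")
      case True
      have False using s0'
      proof
        assume "\<exists>v. U \<inter> S\<^sub>0 = {v} \<and> p v = z"
        then obtain v where "U \<inter> S\<^sub>0 = {v}" by (elim exE conjE)
        then show False using that(1,2)[unfolded True] that(3) by simp
      qed (use that(1)[unfolded True] in simp)
      then show ?thesis ..
    next
      case False
      then have "S \<in> Cs" using that(4) by (simp add: Cs_def)
      then show ?thesis by (rule sS[OF _ that(1-3)])
    qed
    have iff: "part K S (mset_set U) \<in> vertex_doubles S \<longleftrightarrow> doubly_attached U S" if "S \<in> K ` V" for S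
      using s0' A' that by (intro vertex_doubles_iff[OF fU U that]) blast+
    have "p u \<noteq> p u'" if "u \<in> U" "u' \<in> U" "u \<noteq> u'" "K u = K u'" for u u'
      by (rule A'[of u "K u" u']) (use that U cls_self[of u \<phi> I] cls_self[of u' \<phi> I] in auto)
    moreover have "p u = z" if "u \<in> U \<inter> S\<^sub>0" for u
    proof -
      obtain v where v: "U \<inter> S\<^sub>0 = {v}" "p v = z" using s0' \<open>u \<in> U \<inter> S\<^sub>0\<close> by (elim disjE exE conjE) simp
      have "u = v" using that unfolding v(1) by simp
      then show ?thesis using v(2) by (simp only:)
    qed
    moreover have "S = S'" if "S \<in> K ` V" "S' \<in> K ` V" "doubly_attached U S" "doubly_attached U S'" for S S'
      using M that iff unfolding mixed_def insert_Cs by blast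
    ultimately show "admissible U" unfolding admissible_def by blast
  qed
qed

lemma forest_iff_mixed:
  assumes "U \<subseteq> V"
  shows "forest \<phi> (I \<union> t ` U) \<longleftrightarrow> mset_set U \<in> mixed V K Cs S\<^sub>0 vertex_doubles"
  using admissible_iff_mixed[OF assms] forest_imp_admissible[OF assms] admissible_imp_forest[OF assms] by blast

text \<open>No vertex repeats, because the two vertices of an exceptional pair lie on different
  sides. So this count of multisets is a count of subsets of the tree.\<close>

lemma mixed_vertex_doubles_is_set:
  assumes M: "M \<in> mixed V K Cs S\<^sub>0 vertex_doubles"
  shows "M = mset_set (set_mset M)"
proof (rule multiset_eqI)
  fix x
  show "count M x = count (mset_set (set_mset M)) x"
  proof (cases "x \<in># M")
    case True
    then have xV: "x \<in> V" using M by (auto simp: mixed_def)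
    have c: "count M x = count (part K (K x) M) x" by (simp add: part_def)
    have "K x \<in> Cs \<or> K x = S\<^sub>0" using xV by (auto simp: Cs_def)
    then have "size (part K (K x) M) \<le> 1 \<or> part K (K x) M \<in> vertex_doubles (K x)"
      using M unfolding mixed_def by auto
    then have "count (part K (K x) M) x \<le> 1"
    proof
      assume "size (part K (K x) M) \<le> 1"
      then show ?thesis using count_le_size[of "part K (K x) M" x] by linarith
    next
      assume "part K (K x) M \<in> vertex_doubles (K x)"
      then show ?thesis unfolding vertex_doubles_def by (auto split: if_splits)
    qed
    moreover have "count M x \<ge> 1" using True by (simp add: Suc_le_eq)
    ultimately have "count M x = 1" using c by linarith
    then show ?thesis using True by simp
  qed (simp add: not_in_iff)
qed

lemma vertex_doubles_gf:
  fixes y :: "'c::comm_ring_1"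
  shows "finite (mixed V K Cs S\<^sub>0 vertex_doubles)"
    and "\<And>M. M \<in> mixed V K Cs S\<^sub>0 vertex_doubles \<Longrightarrow> size M \<le> Suc (card Cs)"
    and "(\<Sum>M\<in>mixed V K Cs S\<^sub>0 vertex_doubles. y ^ (Suc (card Cs) - size M)) =
      (y + 1 + of_nat (card {v\<in>S\<^sub>0. \<sigma> v})) * (\<Prod>S\<in>Cs. y + of_nat (card S)) +
      (\<Sum>S\<in>Cs. of_nat (card {v\<in>S. \<sigma> v} * card {v\<in>S. \<not> \<sigma> v}) * (\<Prod>T\<in>Cs - {S}. y + of_nat (card T)))"
proof -
  have S0: "S\<^sub>0 \<in> K ` V" using rV by auto
  have CsD: "S \<in> Cs \<Longrightarrow> S \<in> K ` V \<and> S \<noteq> S\<^sub>0" for S by (auto simp: Cs_def)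
  have \<kappa>: "K ` V \<subseteq> insert S\<^sub>0 Cs" by (simp add: insert_Cs)
  have Ds: "size N = 1 \<and> set_mset N \<subseteq> {x\<in>V. K x = S\<^sub>0}" if "N \<in> vertex_doubles S\<^sub>0" for N
    using that unfolding K_set[OF S0] by (auto simp: vertex_doubles_def)
  have D: "size N = 2 \<and> set_mset N \<subseteq> {x\<in>V. K x = S}" if "S \<in> Cs" "N \<in> vertex_doubles S" for S N
    using that(2) CsD[OF that(1)] unfolding K_set[OF conjunct1[OF CsD[OF that(1)]]] vertex_doubles_def by auto
  \<comment> \<open>As \<sigma> fails at \<open>r\<close>, the tree edge owned by 0-bar comes on top
    of the vertices of \<open>A\<close> in the root class; this gives the summand 1.\<close>
  have s0eq: "vertex_doubles S\<^sub>0 = (\<lambda>v. {#v#}) ` insert r {v\<in>S\<^sub>0. \<sigma> v}"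
    using cls_self[of r \<phi> I] by (auto simp: vertex_doubles_def p_z)
  have card0: "card (vertex_doubles S\<^sub>0) = Suc (card {v\<in>S\<^sub>0. \<sigma> v})"
    unfolding s0eq using finK[OF S0] \<sigma>r by (subst card_image) (auto simp: inj_on_def)
  have Seq: "vertex_doubles S = (\<lambda>(a, b). {#a, b#}) ` ({v\<in>S. \<sigma> v} \<times> {v\<in>S. \<not> \<sigma> v})" if "S \<in> Cs" for S
    using CsD[OF that] by (auto simp: vertex_doubles_def)
  have cardS: "card (vertex_doubles S) = card {v\<in>S. \<sigma> v} * card {v\<in>S. \<not> \<sigma> v}" if "S \<in> Cs" for S
    unfolding Seq[OF that] by (subst card_image) (auto simp: inj_on_def pair_mset_eq card_cartesian_product)
  have fD: "finite (vertex_doubles S)" if "S \<in> insert S\<^sub>0 Cs" for S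
    using that s0eq Seq[of S] finK[OF S0] finK[of S] CsD[of S] by auto
  note gf = mixed_gf[OF finCs finV S0_notin \<kappa> Ds D fD]
  show "finite (mixed V K Cs S\<^sub>0 vertex_doubles)" by (rule gf(1))
  show "\<And>M. M \<in> mixed V K Cs S\<^sub>0 vertex_doubles \<Longrightarrow> size M \<le> Suc (card Cs)" by (rule gf(2))
  have e: "{x\<in>V. K x = S} = S" if "S \<in> Cs" for S using K_set CsD[OF that] by blast
  have P1: "(\<Prod>S\<in>Cs. y + of_nat (card {x\<in>V. K x = S})) = (\<Prod>S\<in>Cs. y + of_nat (card S))"
    by (rule prod.cong[OF refl]) (simp only: e)
  have P2: "of_nat (card (vertex_doubles S)) * (\<Prod>T\<in>Cs - {S}. y + of_nat (card {x\<in>V. K x = T})) =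
      of_nat (card {v\<in>S. \<sigma> v} * card {v\<in>S. \<not> \<sigma> v}) * (\<Prod>T\<in>Cs - {S}. y + of_nat (card T))"
    if "S \<in> Cs" for S
  proof -
    have "(\<Prod>T\<in>Cs - {S}. y + of_nat (card {x\<in>V. K x = T})) = (\<Prod>T\<in>Cs - {S}. y + of_nat (card T))"
      using e by (intro prod.cong) auto
    then show ?thesis by (simp only: cardS[OF that])
  qed
  have "(\<Sum>M\<in>mixed V K Cs S\<^sub>0 vertex_doubles. y ^ (Suc (card Cs) - size M)) =
      (y + of_nat (card (vertex_doubles S\<^sub>0))) * (\<Prod>S\<in>Cs. y + of_nat (card {x\<in>V. K x = S})) +
      (\<Sum>S\<in>Cs. of_nat (card (vertex_doubles S)) * (\<Prod>T\<in>Cs - {S}. y + of_nat (card {x\<in>V. K x = T})))"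
    by (rule gf(3))
  also have "(\<Sum>S\<in>Cs. of_nat (card (vertex_doubles S)) * (\<Prod>T\<in>Cs - {S}. y + of_nat (card {x\<in>V. K x = T}))) =
      (\<Sum>S\<in>Cs. of_nat (card {v\<in>S. \<sigma> v} * card {v\<in>S. \<not> \<sigma> v}) * (\<Prod>T\<in>Cs - {S}. y + of_nat (card T)))"
    by (rule sum.cong[OF refl P2])
  also have "y + of_nat (card (vertex_doubles S\<^sub>0)) = y + 1 + of_nat (card {v\<in>S\<^sub>0. \<sigma> v})"
    by (simp add: card0)
  finally show "(\<Sum>M\<in>mixed V K Cs S\<^sub>0 vertex_doubles. y ^ (Suc (card Cs) - size M)) =
      (y + 1 + of_nat (card {v\<in>S\<^sub>0. \<sigma> v})) * (\<Prod>S\<in>Cs. y + of_nat (card S)) +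
      (\<Sum>S\<in>Cs. of_nat (card {v\<in>S. \<sigma> v} * card {v\<in>S. \<not> \<sigma> v}) * (\<Prod>T\<in>Cs - {S}. y + of_nat (card T)))"
    unfolding P1 .
qed

end

section \<open>The h-vector\<close>

context rooted_forest
begin

text \<open>\<open>mixed\<close> wants one label per edge; for an edge of \<open>I\<close> either
  end yields the same component.\<close>

definition edge_cls :: "'e \<Rightarrow> 'v set" where "edge_cls e = K (SOME u. u \<in> \<phi> e)"

lemma edge_cls_eq:
  assumes "e \<in> I" "\<phi> e = {u, v}"
  shows "edge_cls e = K u"
proof -
  have "(SOME u. u \<in> \<phi> e) \<in> {u, v}" using assms(2) by (metis insertI1 someI)
  then show ?thesis using conn_edge[of e I \<phi>, OF assms] unfolding edge_cls_def
    by (auto simp: cls_eq_iff intro: conn_sym)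
qed

lemma edge_cls_iff:
  assumes "e \<in> I" "S \<in> K ` V"
  shows "edge_cls e = S \<longleftrightarrow> \<phi> e \<subseteq> S"
proof -
  obtain u v where uv: "\<phi> e = {u, v}" using ends[OF assms(1)] by blast
  obtain a where a: "S = K a" using assms(2) by auto
  show ?thesis
    using K_eq_iff[OF assms(2), of u] edge_in_cls[of e I \<phi>, OF assms(1) uv, of a]
    unfolding edge_cls_eq[OF assms(1) uv] a by simp
qed

lemma edge_cls_in: "e \<in> I \<Longrightarrow> edge_cls e \<in> K ` V"
  using ends[of e] edge_cls_eq[of e] by auto

lemma edges_of_cls: "S \<in> K ` V \<Longrightarrow> {e\<in>I. edge_cls e = S} = {e\<in>I. \<phi> e \<subseteq> S}"
  using edge_cls_iff by auto

text \<open>The forest counterpart of \<open>vertex_doubles\<close>: the exponents lowered by one in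
  a component of excess 2. In the root class one edge suffices, since 0-bar supplies the other unit.
  A pair with \<open>e = f\<close> is an edge of weight 3.\<close>

definition edge_doubles where "edge_doubles S = (if S = S\<^sub>0 then {{#f#} | f. f \<in> I \<and> \<phi> f \<subseteq> S \<and> oddroot \<phi> \<sigma> I r f}
  else {{#e, f#} | e f. oddpath \<phi> \<sigma> I e f \<and> \<phi> e \<subseteq> S})"

lemma edge_doubles_root: "N \<in> edge_doubles S\<^sub>0 \<Longrightarrow> size N = 1 \<and> set_mset N \<subseteq> {e\<in>I. edge_cls e = S\<^sub>0}"
  using edges_of_cls[of S\<^sub>0] rV by (auto simp: edge_doubles_def)

lemma edge_doubles_nonroot:
  assumes "S \<in> Cs" "N \<in> edge_doubles S"
  shows "size N = 2 \<and> set_mset N \<subseteq> {e\<in>I. edge_cls e = S}"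
proof -
  have S: "S \<in> K ` V" "S \<noteq> S\<^sub>0" using assms(1) by (auto simp: Cs_def)
  then obtain a where a: "S = K a" by auto
  obtain e f where N: "N = {#e, f#}" "oddpath \<phi> \<sigma> I e f" "\<phi> e \<subseteq> S"
    using assms(2) S(2) by (auto simp: edge_doubles_def)
  have "\<phi> f \<subseteq> S" using oddpath_edges(3)[OF N(2), of a] N(3) a by simp
  then show ?thesis unfolding edges_of_cls[OF S(1)] using N oddpath_edges(1,2)[OF N(2)] by simp
qed

lemma finite_edge_doubles:
  assumes "S \<in> insert S\<^sub>0 Cs"
  shows "finite (edge_doubles S)"
proof (cases "S = S\<^sub>0")
  case True
  have "edge_doubles S \<subseteq> (\<lambda>f. {#f#}) ` I" using True by (auto simp: edge_doubles_def)
  then show ?thesis using finI finite_subset by blast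
next
  case False
  have "edge_doubles S \<subseteq> (\<lambda>(e, f). {#e, f#}) ` (I \<times> I)"
  proof
    fix N assume "N \<in> edge_doubles S"
    then obtain e f where N: "N = {#e, f#}" "oddpath \<phi> \<sigma> I e f" using False by (auto simp: edge_doubles_def)
    then have "(e, f) \<in> I \<times> I" using oddpath_edges(1)[OF N(2)] oddpath_edges(2)[OF N(2)] by simp
    then show "N \<in> (\<lambda>(e, f). {#e, f#}) ` (I \<times> I)" using N(1) by (intro image_eqI[of _ _ "(e, f)"]) auto
  qed
  then show ?thesis by (rule finite_subset) (simp add: finI)
qed

text \<open>A tree on n vertices has n - 1 edges, and \<open>card_oddroot\<close> and
  \<open>card_oddpath\<close> express the exceptional parts by vertices again. Compared with
  \<open>vertex_doubles_gf\<close>, the summand 1 at the root is missing, since 0-bar owns no edge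
  of the forest.\<close>

lemma edge_doubles_gf:
  fixes y :: "'c::comm_ring_1"
  shows "finite (mixed I edge_cls Cs S\<^sub>0 edge_doubles)"
    and "\<And>M. M \<in> mixed I edge_cls Cs S\<^sub>0 edge_doubles \<Longrightarrow> size M \<le> Suc (card Cs)"
    and "(\<Sum>M\<in>mixed I edge_cls Cs S\<^sub>0 edge_doubles. y ^ (Suc (card Cs) - size M)) =
      (y + of_nat (card {v\<in>S\<^sub>0. \<sigma> v})) * (\<Prod>S\<in>Cs. y + of_nat (card S - 1)) +
      (\<Sum>S\<in>Cs. of_nat (card {v\<in>S. \<sigma> v} * card {v\<in>S. \<not> \<sigma> v}) * (\<Prod>T\<in>Cs - {S}. y + of_nat (card T - 1)))"
proof -
  have CsD: "S \<in> Cs \<Longrightarrow> S \<in> K ` V \<and> S \<noteq> S\<^sub>0" for S by (auto simp: Cs_def)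
  have ends': "\<exists>u v. \<phi> e = {u, v}" if "e \<in> I" for e using ends[OF that] by blast
  have \<kappa>: "edge_cls ` I \<subseteq> insert S\<^sub>0 Cs" unfolding insert_Cs using edge_cls_in by auto
  note gf = mixed_gf[OF finCs finI S0_notin \<kappa> edge_doubles_root edge_doubles_nonroot finite_edge_doubles]
  show "finite (mixed I edge_cls Cs S\<^sub>0 edge_doubles)" by (rule gf(1))
  show "\<And>M. M \<in> mixed I edge_cls Cs S\<^sub>0 edge_doubles \<Longrightarrow> size M \<le> Suc (card Cs)" by (rule gf(2))
  have "edge_doubles S\<^sub>0 = (\<lambda>f. {#f#}) ` {f\<in>I. \<phi> f \<subseteq> S\<^sub>0 \<and> oddroot \<phi> \<sigma> I r f}" by (auto simp: edge_doubles_def)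
  then have "card (edge_doubles S\<^sub>0) = card {f\<in>I. \<phi> f \<subseteq> S\<^sub>0 \<and> oddroot \<phi> \<sigma> I r f}"
    by (simp add: card_image inj_on_def)
  also have "\<dots> = card {v\<in>S\<^sub>0. \<sigma> v}" using card_oddroot[OF fo ends', of r \<sigma>] \<sigma>r by simp
  finally have card0: "card (edge_doubles S\<^sub>0) = card {v\<in>S\<^sub>0. \<sigma> v}" .
  have cardS: "card (edge_doubles S) = card {v\<in>S. \<sigma> v} * card {v\<in>S. \<not> \<sigma> v}" if S: "S \<in> Cs" for S
  proof -
    obtain a where a: "S = K a" using CsD[OF S] by auto
    show ?thesis using card_oddpath[OF fo, of \<sigma> a] CsD[OF S] unfolding a edge_doubles_def by simp
  qed
  have e: "card {x\<in>I. edge_cls x = S} = card S - 1" if S: "S \<in> Cs" for S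
  proof -
    obtain a where a: "S = K a" using CsD[OF S] by auto
    show ?thesis unfolding edges_of_cls[OF conjunct1[OF CsD[OF S]]] unfolding a
      by (rule card_tree_edges[OF fo ends'])
  qed
  have P2: "of_nat (card (edge_doubles S)) * (\<Prod>T\<in>Cs - {S}. y + of_nat (card {x\<in>I. edge_cls x = T})) =
      of_nat (card {v\<in>S. \<sigma> v} * card {v\<in>S. \<not> \<sigma> v}) * (\<Prod>T\<in>Cs - {S}. y + of_nat (card T - 1))"
    if "S \<in> Cs" for S
  proof -
    have "(\<Prod>T\<in>Cs - {S}. y + of_nat (card {x\<in>I. edge_cls x = T})) = (\<Prod>T\<in>Cs - {S}. y + of_nat (card T - 1))"
      using e by (intro prod.cong) auto
    then show ?thesis by (simp only: cardS[OF that])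
  qed
  have "(\<Sum>M\<in>mixed I edge_cls Cs S\<^sub>0 edge_doubles. y ^ (Suc (card Cs) - size M)) =
      (y + of_nat (card (edge_doubles S\<^sub>0))) * (\<Prod>S\<in>Cs. y + of_nat (card {x\<in>I. edge_cls x = S})) +
      (\<Sum>S\<in>Cs. of_nat (card (edge_doubles S)) * (\<Prod>T\<in>Cs - {S}. y + of_nat (card {x\<in>I. edge_cls x = T})))"
    by (rule gf(3))
  also have "(\<Sum>S\<in>Cs. of_nat (card (edge_doubles S)) * (\<Prod>T\<in>Cs - {S}. y + of_nat (card {x\<in>I. edge_cls x = T}))) =
      (\<Sum>S\<in>Cs. of_nat (card {v\<in>S. \<sigma> v} * card {v\<in>S. \<not> \<sigma> v}) * (\<Prod>T\<in>Cs - {S}. y + of_nat (card T - 1)))"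
    by (rule sum.cong[OF refl P2])
  also have "(\<Prod>S\<in>Cs. y + of_nat (card {x\<in>I. edge_cls x = S})) = (\<Prod>S\<in>Cs. y + of_nat (card S - 1))"
    using e by (intro prod.cong) auto
  finally show "(\<Sum>M\<in>mixed I edge_cls Cs S\<^sub>0 edge_doubles. y ^ (Suc (card Cs) - size M)) =
      (y + of_nat (card {v\<in>S\<^sub>0. \<sigma> v})) * (\<Prod>S\<in>Cs. y + of_nat (card S - 1)) +
      (\<Sum>S\<in>Cs. of_nat (card {v\<in>S. \<sigma> v} * card {v\<in>S. \<not> \<sigma> v}) * (\<Prod>T\<in>Cs - {S}. y + of_nat (card T - 1)))"
    unfolding card0 .
qed

lemma card_cls_pos: "S \<in> K ` V \<Longrightarrow> 1 \<le> card S"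
proof -
  assume S: "S \<in> K ` V"
  then have "S \<noteq> {}" using cls_self by fastforce
  then show ?thesis using finK[OF S] by (simp add: Suc_le_eq card_gt_0_iff)
qed

end

lemma sum_by_size:
  fixes y :: "'c::comm_ring_1"
  assumes "finite X" "\<And>M. M \<in> X \<Longrightarrow> size M \<le> c"
  shows "(\<Sum>M\<in>X. y ^ (c - size M)) = (\<Sum>i\<le>c. of_nat (card {M\<in>X. size M = i}) * y ^ (c - i))"
proof -
  have "(\<Sum>M\<in>X. y ^ (c - size M)) = (\<Sum>i\<in>{..c}. \<Sum>M\<in>{M\<in>X. size M = i}. y ^ (c - size M))"
    using assms by (intro sum.group[symmetric]) auto
  also have "\<dots> = (\<Sum>i\<le>c. of_nat (card {M\<in>X. size M = i}) * y ^ (c - i))"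
    by (rule sum.cong[OF refl]) simp
  finally show ?thesis .
qed

context rooted_cone
begin

text \<open>At y = t - 1 the generating function of the vertex side is the defining sum of the
  h-vector; at y = t that of the edge side displays its coefficients. The two polynomials are equal
  factor by factor.\<close>

lemma h_vector_eq:
  fixes \<Gamma> :: "'e matroid"
  assumes \<Gamma>: "indep \<Gamma> = {W. W \<subseteq> t ` V \<and> forest \<phi> (I \<union> W)}"
  shows "h_vector \<Gamma> j = int (card {M\<in>mixed I edge_cls Cs S\<^sub>0 edge_doubles. size M = j})"
proof -
  let ?XU = "mixed V K Cs S\<^sub>0 vertex_doubles" and ?XM = "mixed I edge_cls Cs S\<^sub>0 edge_doubles"
  define c where "c = Suc (card Cs)"
  have S0: "S\<^sub>0 \<in> K ` V" using rV by auto
  have XV: "set_mset M \<subseteq> V" if "M \<in> ?XU" for M using that by (simp add: mixed_def)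
  have XU: "M \<in> ?XU \<Longrightarrow> size M = card (set_mset M)" for M
    using mixed_vertex_doubles_is_set[of M] by (metis size_mset_set)
  have bij: "bij_betw (\<lambda>M. t ` set_mset M) ?XU (indep \<Gamma>)"
  proof (rule bij_betwI')
    fix M N assume M: "M \<in> ?XU" and N: "N \<in> ?XU"
    show "t ` set_mset M = t ` set_mset N \<longleftrightarrow> M = N"
      using inj_on_image_eq_iff[OF inj_t XV[OF M] XV[OF N]] mixed_vertex_doubles_is_set[OF M] mixed_vertex_doubles_is_set[OF N] by metis
  next
    fix M assume M: "M \<in> ?XU"
    then have "mset_set (set_mset M) \<in> ?XU" using mixed_vertex_doubles_is_set[OF M] by simp
    then show "t ` set_mset M \<in> indep \<Gamma>" unfolding \<Gamma> using forest_iff_mixed[OF XV[OF M]] XV[OF M] by auto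
  next
    fix W assume "W \<in> indep \<Gamma>"
    then obtain U where U: "U \<subseteq> V" "W = t ` U" "forest \<phi> (I \<union> t ` U)"
      unfolding \<Gamma> by (auto simp: subset_image_iff)
    then show "\<exists>M\<in>?XU. W = t ` set_mset M"
      using forest_iff_mixed[OF U(1)] finite_subset[OF U(1) finV] by (intro bexI[of _ "mset_set U"]) auto
  qed
  have card_t: "card (t ` set_mset M) = size M" if "M \<in> ?XU" for M
    using XU[OF that] card_image[OF inj_on_subset[OF inj_t XV[OF that]]] by simp
  have count: "indep_count \<Gamma> i = card {M\<in>?XU. size M = i}" for i
  proof -
    have "bij_betw (\<lambda>M. t ` set_mset M) {M\<in>?XU. size M = i} {W\<in>indep \<Gamma>. card W = i}"
      unfolding bij_betw_def
    proof
      show "inj_on (\<lambda>M. t ` set_mset M) {M\<in>?XU. size M = i}"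
        using bij by (auto simp: bij_betw_def intro: inj_on_subset)
      have "indep \<Gamma> = (\<lambda>M. t ` set_mset M) ` ?XU" using bij by (simp add: bij_betw_def)
      then show "(\<lambda>M. t ` set_mset M) ` {M\<in>?XU. size M = i} = {W\<in>indep \<Gamma>. card W = i}"
        using card_t by auto
    qed
    then show ?thesis unfolding indep_count_def by (simp add: bij_betw_same_card)
  qed
  \<comment> \<open>At y = 0 only members of the largest size \<open>c\<close> survive, so
    positivity yields an independent set of size \<open>c\<close>; this determines the rank.\<close>
  have "(\<Sum>M\<in>?XU. (0::int) ^ (c - size M)) > 0"
  proof -
    have "(\<Prod>S\<in>Cs. (0::int) + of_nat (card S)) > 0"
      using card_cls_pos by (intro prod_pos) (fastforce simp: Cs_def)
    then have A: "0 < (0 + 1 + int (card {v\<in>S\<^sub>0. \<sigma> v})) * (\<Prod>S\<in>Cs. (0::int) + of_nat (card S))"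
      by (intro mult_pos_pos) auto
    have B: "0 \<le> (\<Sum>S\<in>Cs. int (card {v\<in>S. \<sigma> v} * card {v\<in>S. \<not> \<sigma> v}) * (\<Prod>T\<in>Cs - {S}. 0 + of_nat (card T)))"
      by (intro sum_nonneg mult_nonneg_nonneg prod_nonneg) auto
    show ?thesis unfolding c_def vertex_doubles_gf(3)[of "0::int"] by (rule add_pos_nonneg[OF A B])
  qed
  then obtain M where M: "M \<in> ?XU" "(0::int) ^ (c - size M) \<noteq> 0"
    by (metis less_irrefl sum.neutral)
  then have "size M = c" using vertex_doubles_gf(2)[OF M(1)] by (auto simp: c_def power_0_left split: if_splits)
  have fin: "finite (indep \<Gamma>)" using bij vertex_doubles_gf(1) by (metis bij_betw_finite)
  have rank: "matroid_rank \<Gamma> = c"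
    unfolding matroid_rank_def
  proof (rule Max_eqI)
    show "finite (card ` indep \<Gamma>)" using fin by simp
    show "n \<le> c" if "n \<in> card ` indep \<Gamma>" for n
    proof -
      obtain W where W: "W \<in> indep \<Gamma>" "n = card W" using \<open>n \<in> card ` indep \<Gamma>\<close> by auto
      have "W \<in> (\<lambda>M. t ` set_mset M) ` ?XU" using W(1) bij_betw_imp_surj_on[OF bij] by simp
      then obtain M where "M \<in> ?XU" "W = t ` set_mset M" by blast
      then show ?thesis using W card_t[of M] vertex_doubles_gf(2)[of M] by (simp add: c_def)
    qed
    have "t ` set_mset M \<in> indep \<Gamma>" using bij M(1) by (auto simp: bij_betw_def)
    then show "c \<in> card ` indep \<Gamma>" using card_t[OF M(1)] \<open>size M = c\<close> by (metis imageI)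
  qed
  let ?x = "[:0, 1:] :: int poly"
  have e0: "[:-1, 1:] + 1 + of_nat n = ?x + of_nat n" for n
    by (simp add: one_pCons)
  \<comment> \<open>This is (t - 1) + n = t + (n - 1); the truncated subtraction is safe because
    components are nonempty.\<close>
  have eS: "[:-1, 1:] + of_nat (card S) = ?x + of_nat (card S - 1)" if "S \<in> Cs" for S
  proof -
    have "1 \<le> card S" using card_cls_pos that by (auto simp: Cs_def)
    then have "(of_nat (card S) :: int poly) = of_nat (card S - 1) + 1" by (simp add: of_nat_diff)
    then show ?thesis by (simp add: one_pCons)
  qed
  have prods: "(\<Prod>S\<in>C. [:-1, 1:] + of_nat (card S)) = (\<Prod>S\<in>C. ?x + of_nat (card S - 1))" if "C \<subseteq> Cs" for C
    using eS that by (intro prod.cong) auto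
  have "(\<Sum>i\<le>c. smult (int (indep_count \<Gamma> i)) ([:-1, 1:] ^ (c - i))) = (\<Sum>M\<in>?XU. [:-1, 1:] ^ (c - size M))"
    unfolding count using vertex_doubles_gf(1,2)
    by (subst sum_by_size) (auto simp: c_def of_nat_poly intro!: sum.cong)
  also have "\<dots> = (\<Sum>M\<in>?XM. ?x ^ (c - size M))"
    unfolding c_def vertex_doubles_gf(3) edge_doubles_gf(3) e0 using prods by (simp add: Diff_subset)
  also have "\<dots> = (\<Sum>M\<in>?XM. monom 1 (c - size M))"
    by (simp add: monom_altdef)
  finally have eq: "(\<Sum>i\<le>c. smult (int (indep_count \<Gamma> i)) ([:-1, 1:] ^ (c - i))) = (\<Sum>M\<in>?XM. monom 1 (c - size M))" .
  show ?thesis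
  proof (cases "j \<le> c")
    case True
    have "h_vector \<Gamma> j = coeff (\<Sum>M\<in>?XM. monom 1 (c - size M)) (c - j)"
      unfolding h_vector_def rank Let_def eq using True by simp
    \<comment> \<open>Both \<open>j\<close> and the sizes are at most \<open>c\<close>, so equal
      differences from \<open>c\<close> mean equal sizes.\<close>
    also have "\<dots> = (\<Sum>M\<in>?XM. if size M = j then 1 else 0)"
      unfolding coeff_sum using True edge_doubles_gf(2) by (intro sum.cong) (fastforce simp: c_def)+
    also have "\<dots> = int (card {M\<in>?XM. size M = j})"
      using edge_doubles_gf(1) by (simp add: sum.If_cases Int_def)
    finally show ?thesis .
  next
    case False
    then have e: "{M\<in>?XM. size M = j} = {}" using edge_doubles_gf(2) by (fastforce simp: c_def)
    show ?thesis using False unfolding e h_vector_def rank Let_def by simp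
  qed
qed

end

section \<open>Order ideal and purity\<close>

lemma cls_mono: "F' \<subseteq> F \<Longrightarrow> cls \<phi> F' a \<subseteq> cls \<phi> F a"
  using conn_mono by (auto simp: in_cls)

lemma chain_single: "e \<in> F \<Longrightarrow> \<phi> e = {u, v} \<Longrightarrow> chain \<phi> F [u, v] [e]"
  by simp

text \<open>In a forest the end edges determine the end vertices up to reversal, for a single edge
  as an unordered pair; so one odd path makes all of them odd.\<close>

lemma oddpath_any:
  assumes fo: "forest \<phi> F" and o: "oddpath \<phi> \<sigma> F e f"
    and q: "chain \<phi> F vs es" "distinct vs" "es \<noteq> []"
    and ef: "hd es = e \<and> last es = f \<or> hd es = f \<and> last es = e"
  shows "\<sigma> (hd vs) \<noteq> \<sigma> (last vs)"
proof -
  have *: "\<sigma> (hd vs) \<noteq> \<sigma> (last vs)"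
    if o: "oddpath \<phi> \<sigma> F e f" and q: "chain \<phi> F vs es" "distinct vs" "es \<noteq> []" "hd es = e" "last es = f" for e f vs es
  proof -
    obtain ws fs where p: "chain \<phi> F ws fs" "distinct ws" "fs \<noteq> []" "hd fs = e" "last fs = f" "\<sigma> (hd ws) \<noteq> \<sigma> (last ws)"
      using o by (auto simp: oddpath_def)
    show ?thesis
    proof (cases "e = f")
      case True
      then have "es = [e]" "fs = [e]" using single_edge_path[OF q(1-3)] single_edge_path[OF p(1-3)] p q by auto
      then have "{hd vs, last vs} = {hd ws, last ws}"
        using chain_singleton_edge[of \<phi> F vs e] chain_singleton_edge[of \<phi> F ws e] p(1) q(1) by simp
      then show ?thesis using p(6) by (auto simp: doubleton_eq_iff)
    next
      case False
      then show ?thesis using path_ends_unique[OF fo p(1-3) q(1-3)] p q by simp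
    qed
  qed
  from ef show ?thesis
  proof
    assume "hd es = e \<and> last es = f"
    then show ?thesis using *[OF o q] by simp
  next
    assume "hd es = f \<and> last es = e"
    then show ?thesis using *[OF oddpath_sym[OF o] q] by simp
  qed
qed

lemma path_between_edges:
  assumes fo: "forest \<phi> F" and ends: "\<And>e. e \<in> F \<Longrightarrow> \<exists>u v. \<phi> e = {u, v}"
    and ef: "e \<in> F" "f \<in> F" "\<phi> e \<subseteq> cls \<phi> F a" "\<phi> f \<subseteq> cls \<phi> F a"
  obtains vs es where "chain \<phi> F vs es" "distinct vs" "es \<noteq> []" "hd es = e" "last es = f"
proof -
  obtain x x' where x: "\<phi> e = {x, x'}" using ends ef by blast
  obtain y y' where y: "\<phi> f = {y, y'}" using ends ef by blast
  show ?thesis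
  proof (cases "e = f")
    case True
    show ?thesis
      using that[of "[x, x']" "[e]"] chain_single[of e F \<phi> x x'] forest_no_loop[OF fo ef(1) x] True x ef(1) by simp
  next
    case False
    have "cls \<phi> F x = cls \<phi> F y" using x y ef cls_eqI[of x \<phi> F a] cls_eqI[of y \<phi> F a] by auto
    then have "(x, y) \<in> conn \<phi> F" by (simp add: cls_eq_iff)
    then show ?thesis using edge_path_between[OF fo ef(1) x ef(2) y _ False] that by metis
  qed
qed

lemma oddpath_mono: "oddpath \<phi> \<sigma> F' e f \<Longrightarrow> F' \<subseteq> F \<Longrightarrow> oddpath \<phi> \<sigma> F e f"
  unfolding oddpath_def using chain_mono chain_edges by (metis subset_trans)

lemma oddroot_mono: "oddroot \<phi> \<sigma> F' r f \<Longrightarrow> F' \<subseteq> F \<Longrightarrow> oddroot \<phi> \<sigma> F r f"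
  unfolding oddroot_def using chain_mono chain_edges by (metis subset_trans)

text \<open>The two edges lie in one class of \<open>F'\<close>, hence are joined by a path in
  \<open>F'\<close>; this path also lives in \<open>F\<close>, where \<open>oddpath_any\<close>
  gives its parity.\<close>

lemma oddpath_subforest:
  assumes fo: "forest \<phi> F" and sub: "F' \<subseteq> F" and ends: "\<And>e. e \<in> F' \<Longrightarrow> \<exists>u v. \<phi> e = {u, v}"
    and ef: "e \<in> F'" "f \<in> F'" "\<phi> e \<subseteq> cls \<phi> F' a" "\<phi> f \<subseteq> cls \<phi> F' a" and o: "oddpath \<phi> \<sigma> F e f"
  shows "oddpath \<phi> \<sigma> F' e f"
proof -
  obtain vs es where p: "chain \<phi> F' vs es" "distinct vs" "es \<noteq> []" "hd es = e" "last es = f"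
    using path_between_edges[OF forest_mono[OF fo sub] ends ef] by metis
  have c: "chain \<phi> F vs es" using chain_mono[OF p(1)] chain_edges[OF p(1)] sub by blast
  have "\<sigma> (hd vs) \<noteq> \<sigma> (last vs)" using p(4,5) by (intro oddpath_any[OF fo o c p(2,3)]) simp
  then show ?thesis using oddpathI[OF p(1-3)] p(4,5) by simp
qed

lemma oddroot_subforest:
  assumes fo: "forest \<phi> F" and sub: "F' \<subseteq> F" and ends: "\<And>e. e \<in> F' \<Longrightarrow> \<exists>u v. \<phi> e = {u, v}"
    and f: "f \<in> F'" "\<phi> f \<subseteq> cls \<phi> F' r" and o: "oddroot \<phi> \<sigma> F r f"
  shows "oddroot \<phi> \<sigma> F' r f"
proof -
  obtain x y where xy: "\<phi> f = {x, y}" using ends f by blast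
  have "x \<noteq> y" using forest_no_loop[OF fo _ xy] f sub by blast
  moreover have "(r, x) \<in> conn \<phi> F'" using f xy by (auto simp: in_cls)
  ultimately obtain vs es where p: "chain \<phi> F' vs es" "distinct vs" "hd vs = r" "es \<noteq> []" "last es = f"
    using edge_path_from[of f F' \<phi>, OF f(1) xy] by metis
  have c: "chain \<phi> F vs es" using chain_mono[OF p(1)] chain_edges[OF p(1)] sub by blast
  obtain ws fs where q: "chain \<phi> F ws fs" "distinct ws" "fs \<noteq> []" "hd ws = r" "last fs = f" "\<sigma> r \<noteq> \<sigma> (last ws)"
    using o by (auto simp: oddroot_def)
  have "last vs = last ws" using path_last_unique[OF fo c p(2,4) q(1-3)] p q by simp
  then show ?thesis unfolding oddroot_def using p q(6) by metis
qed

text \<open>The monomial \<open>m\<close> encodes the pair \<open>(F, \<omega>)\<close> of its support and its exponents, so that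
  \<open>surplus m\<close> has the exponents \<open>\<omega> - 1\<close>.\<close>

definition surplus :: "'e multiset \<Rightarrow> 'e multiset" where
  "surplus m = m - mset_set (set_mset m)"

lemma count_surplus: "count (surplus m) e = count m e - 1"
  by (cases "e \<in># m") (auto simp: surplus_def not_in_iff)

lemma surplus_add_old: "f \<in># m \<Longrightarrow> surplus (add_mset f m) = add_mset f (surplus m)"
  by (rule multiset_eqI) (auto simp: count_surplus Suc_diff_le not_in_iff Suc_le_eq)

lemma surplus_add_new: "f \<notin># m \<Longrightarrow> surplus (add_mset f m) = surplus m"
  by (rule multiset_eqI) (auto simp: count_surplus not_in_iff)

lemma surplus_mono: "n \<subseteq># m \<Longrightarrow> surplus n \<subseteq># surplus m"
  by (auto simp: subseteq_mset_def count_surplus diff_le_mono)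

lemma set_surplus: "set_mset (surplus m) \<subseteq> set_mset m"
  unfolding surplus_def by (rule set_mset_mono) simp

text \<open>The support now varies with the monomial, so only the ambient edge set \<open>E\<close>
  of the reduced graph is fixed and acyclicity moves into \<open>valid\<close>.\<close>

locale rooted_graph =
  fixes \<phi> :: "'e \<Rightarrow> 'v set" and V :: "'v set" and r :: 'v and \<sigma> :: "'v \<Rightarrow> bool" and E :: "'e set"
  assumes finV: "finite V" and rV: "r \<in> V" and \<sigma>r: "\<not> \<sigma> r" and finE: "finite E"
    and endsE: "\<And>e. e \<in> E \<Longrightarrow> \<exists>u\<in>V. \<exists>v\<in>V. \<phi> e = {u, v}"
begin

definition surplus_in :: "'e multiset \<Rightarrow> 'v set \<Rightarrow> 'e multiset" where
  "surplus_in m S = filter_mset (\<lambda>e. \<phi> e \<subseteq> S) (surplus m)"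

definition comps :: "'e multiset \<Rightarrow> 'v set set" where
  "comps m = cls \<phi> (set_mset m) ` V"

definition excess :: "'e multiset \<Rightarrow> 'v set \<Rightarrow> nat" where
  "excess m S = (if r \<in> S then 1 else 0) + size (surplus_in m S)"

text \<open>Excess weight 2 and the parity condition (C3) in one, see \<open>doubled_excess\<close>.
  Putting the parity into the exceptional case matches the sets \<open>edge_doubles\<close>.\<close>

definition doubled :: "'e multiset \<Rightarrow> 'v set \<Rightarrow> bool" where
  "doubled m S \<longleftrightarrow> (if r \<in> S then \<exists>f. surplus_in m S = {#f#} \<and> oddroot \<phi> \<sigma> (set_mset m) r f
     else \<exists>e f. surplus_in m S = {#e, f#} \<and> oddpath \<phi> \<sigma> (set_mset m) e f)"

definition valid :: "'e multiset \<Rightarrow> bool" where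
  "valid m \<longleftrightarrow> set_mset m \<subseteq> E \<and> forest \<phi> (set_mset m) \<and>
     (\<forall>S\<in>comps m. excess m S \<le> 1 \<or> doubled m S) \<and>
     (\<forall>S\<in>comps m. \<forall>S'\<in>comps m. doubled m S \<longrightarrow> doubled m S' \<longrightarrow> S = S')"

lemma doubled_excess: "doubled m S \<Longrightarrow> excess m S = 2"
  by (auto simp: doubled_def excess_def split: if_splits)

lemma ends2: "set_mset m \<subseteq> E \<Longrightarrow> e \<in># m \<Longrightarrow> \<exists>u v. \<phi> e = {u, v}"
  using endsE by blast

lemma surplus_in_edges: "e \<in># surplus_in m S \<Longrightarrow> e \<in># m \<and> \<phi> e \<subseteq> S"
  using set_surplus[of m] by (auto simp: surplus_in_def)

lemma comps_eqI: "S \<in> comps m \<Longrightarrow> S' \<in> comps m \<Longrightarrow> x \<in> S \<Longrightarrow> x \<in> S' \<Longrightarrow> S = S'"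
  unfolding comps_def using cls_eqI by (metis imageE)

lemma comps_cls: "S \<in> comps m \<Longrightarrow> x \<in> S \<Longrightarrow> S = cls \<phi> (set_mset m) x"
  unfolding comps_def using cls_eqI by (metis imageE)

text \<open>Each component of \<open>n\<close> lies in a component of \<open>m\<close> of at least
  the same excess. If its excess is still above 1, none of the surplus was lost, so the same edges
  are weighted and the parity carries over to the subforest. Two doubled components of
  \<open>n\<close> would sit in the same component of \<open>m\<close>, share its surplus edges and
  therefore coincide.\<close>

lemma valid_down:
  assumes m: "valid m" and nm: "n \<subseteq># m"
  shows "valid n"
proof -
  have sub: "set_mset n \<subseteq> set_mset m" using nm by (rule set_mset_mono)
  have E: "set_mset m \<subseteq> E" "set_mset n \<subseteq> E" and fo: "forest \<phi> (set_mset m)" "forest \<phi> (set_mset n)"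
    using m sub forest_mono[OF _ sub, of \<phi>] by (auto simp: valid_def)
  define up where "up S = cls \<phi> (set_mset m) (SOME x. x \<in> S)" for S
  have up: "up S \<in> comps m \<and> S \<subseteq> up S" if S: "S \<in> comps n" for S
  proof -
    obtain a where a: "a \<in> V" "S = cls \<phi> (set_mset n) a" using S by (auto simp: comps_def)
    have "(SOME x. x \<in> S) \<in> S" using a cls_self by (metis someI)
    then have "(SOME x. x \<in> S) \<in> cls \<phi> (set_mset m) a" using cls_mono[OF sub, of \<phi> a] a by auto
    then have "up S = cls \<phi> (set_mset m) a" unfolding up_def by (rule cls_eqI)
    then show ?thesis using a cls_mono[OF sub, of \<phi> a] by (auto simp: comps_def)
  qed
  have xsub: "surplus_in n S \<subseteq># surplus_in m (up S)" if "S \<in> comps n" for S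
  proof -
    have "surplus_in n S \<subseteq># filter_mset (\<lambda>e. \<phi> e \<subseteq> S) (surplus m)"
      unfolding surplus_in_def by (rule multiset_filter_mono[OF surplus_mono[OF nm]])
    also have "\<dots> \<subseteq># surplus_in m (up S)"
      unfolding surplus_in_def using up[OF that] by (auto simp: subseteq_mset_def)
    finally show ?thesis .
  qed
  have ex: "excess n S \<le> excess m (up S)" if "S \<in> comps n" for S
    using size_mset_mono[OF xsub[OF that]] up[OF that] unfolding excess_def by auto
  have big: "surplus_in n S = surplus_in m (up S) \<and> (r \<in> S \<longleftrightarrow> r \<in> up S) \<and> doubled m (up S)"
    if S: "S \<in> comps n" and b: "\<not> excess n S \<le> 1" for S
  proof -
    have d: "doubled m (up S)" using m up[OF S] ex[OF S] b unfolding valid_def by force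
    have "excess n S = excess m (up S)" using ex[OF S] b doubled_excess[OF d] by linarith
    then have "size (surplus_in n S) = size (surplus_in m (up S))" "r \<in> S \<longleftrightarrow> r \<in> up S"
      using size_mset_mono[OF xsub[OF S]] up[OF S] unfolding excess_def by (auto split: if_splits)
    then have "surplus_in n S = surplus_in m (up S)" using xsub[OF S] mset_subset_size subset_mset.less_le by fastforce
    then show ?thesis using d \<open>r \<in> S \<longleftrightarrow> r \<in> up S\<close> by blast
  qed
  have d: "doubled n S" if S: "S \<in> comps n" and b: "\<not> excess n S \<le> 1" for S
  proof (cases "r \<in> S")
    case True
    obtain f where f: "surplus_in n S = {#f#}" "oddroot \<phi> \<sigma> (set_mset m) r f"
      using big[OF S b] True unfolding doubled_def by auto
    have "f \<in># n" "\<phi> f \<subseteq> cls \<phi> (set_mset n) r" using surplus_in_edges[of f n S] f comps_cls[OF S True] by auto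
    then have "oddroot \<phi> \<sigma> (set_mset n) r f"
      using oddroot_subforest[OF fo(1) sub ends2[OF E(2)] _ _ f(2)] by blast
    then show ?thesis using f True unfolding doubled_def by auto
  next
    case False
    obtain e f where f: "surplus_in n S = {#e, f#}" "oddpath \<phi> \<sigma> (set_mset m) e f"
      using big[OF S b] False unfolding doubled_def by auto
    obtain a where a: "S = cls \<phi> (set_mset n) a" using S by (auto simp: comps_def)
    have "e \<in># n" "f \<in># n" "\<phi> e \<subseteq> S" "\<phi> f \<subseteq> S" using surplus_in_edges[of e n S] surplus_in_edges[of f n S] f by auto
    then have "oddpath \<phi> \<sigma> (set_mset n) e f"
      using oddpath_subforest[OF fo(1) sub ends2[OF E(2)] _ _ _ _ f(2), of a] a by blast
    then show ?thesis using f False unfolding doubled_def by auto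
  qed
  moreover have "S = S'" if S: "S \<in> comps n" "S' \<in> comps n" "doubled n S" "doubled n S'" for S S'
  proof -
    have b: "\<not> excess n S \<le> 1" "\<not> excess n S' \<le> 1" using S doubled_excess by force+
    have "up S = up S'" using big[OF S(1) b(1)] big[OF S(2) b(2)] up[OF S(1)] up[OF S(2)] m unfolding valid_def by blast
    then have eq: "surplus_in n S = surplus_in n S'" using big[OF S(1) b(1)] big[OF S(2) b(2)] by simp
    have "surplus_in n S \<noteq> {#}" using S(3) unfolding doubled_def by (auto split: if_splits)
    then obtain f where f: "f \<in># surplus_in n S" by auto
    then have f': "f \<in># n" "\<phi> f \<subseteq> S" "\<phi> f \<subseteq> S'" using surplus_in_edges[of f n S] surplus_in_edges[of f n S'] eq by auto
    obtain u v where "\<phi> f = {u, v}" using ends2[OF E(2) f'(1)] by blast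
    then show ?thesis using comps_eqI[OF S(1,2), of u] f' by auto
  qed
  ultimately show ?thesis using E fo unfolding valid_def by blast
qed

text \<open>Raising an exponent changes no component and adds one unit of excess to
  \<open>S\<close>. With \<open>valid_add_new\<close>, this provides the moves that a maximal
  monomial must block.\<close>

lemma valid_add_old:
  assumes m: "valid m" and S: "S \<in> comps m" and f: "f \<in># m" "\<phi> f \<subseteq> S"
    and c: "excess m S = 0 \<or> (\<forall>T\<in>comps m. \<not> doubled m T) \<and> doubled (add_mset f m) S"
  shows "valid (add_mset f m)"
proof -
  let ?n = "add_mset f m"
  have set: "set_mset ?n = set_mset m" using f by auto
  have comps: "comps ?n = comps m" by (simp only: comps_def set)
  have E: "set_mset m \<subseteq> E" using m by (simp add: valid_def)
  obtain u v where uv: "\<phi> f = {u, v}" using ends2[OF E f(1)] by blast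
  have x: "surplus_in ?n T = surplus_in m T" if "T \<in> comps m" "T \<noteq> S" for T
  proof -
    have "\<not> \<phi> f \<subseteq> T" using comps_eqI[OF S that(1), of u] that(2) f(2) uv by auto
    then show ?thesis by (simp add: surplus_in_def surplus_add_old[OF f(1)])
  qed
  have dT: "doubled ?n T \<longleftrightarrow> doubled m T" if "T \<in> comps m" "T \<noteq> S" for T
    unfolding doubled_def x[OF that] set ..
  have eT: "excess ?n T = excess m T" if "T \<in> comps m" "T \<noteq> S" for T
    unfolding excess_def x[OF that] ..
  have eS: "excess ?n S = Suc (excess m S)"
    using f(2) by (simp add: surplus_in_def excess_def surplus_add_old[OF f(1)])
  have old: "excess m T \<le> 1 \<or> doubled m T" if "T \<in> comps m" for T using m that by (simp add: valid_def)
  have uniq: "T = T'" if "T \<in> comps m" "T' \<in> comps m" "doubled m T" "doubled m T'" for T T'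
    using m that by (simp add: valid_def)
  have 1: "excess ?n T \<le> 1 \<or> doubled ?n T" if "T \<in> comps m" for T
    using old[OF that] dT[OF that] eT[OF that] eS c by (cases "T = S") auto
  have 2: "T = T'" if "T \<in> comps m" "T' \<in> comps m" "doubled ?n T" "doubled ?n T'" for T T'
  proof (cases "excess m S = 0")
    case True
    then have "\<not> doubled ?n S" using eS doubled_excess[of ?n S] by auto
    then show ?thesis using that dT uniq by metis
  next
    case False
    then show ?thesis using that dT c by metis
  qed
  show ?thesis
    unfolding valid_def set comps using m 1 2 by (simp add: valid_def)
qed

lemma surplus_in_union:
  assumes E: "set_mset m \<subseteq> E" and S: "S1 \<in> comps m" "S2 \<in> comps m" and disj: "S1 \<inter> S2 = {}"
  shows "surplus_in m (S1 \<union> S2) = surplus_in m S1 + surplus_in m S2"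
proof (rule multiset_eqI)
  fix f
  have "\<phi> f \<subseteq> S1 \<union> S2 \<longleftrightarrow> \<phi> f \<subseteq> S1 \<or> \<phi> f \<subseteq> S2" "\<not> (\<phi> f \<subseteq> S1 \<and> \<phi> f \<subseteq> S2)" if fm: "f \<in># m"
  proof -
    obtain x y where xy: "\<phi> f = {x, y}" using ends2[OF E fm] by blast
    have "\<phi> f \<subseteq> T \<longleftrightarrow> x \<in> T" "\<phi> f \<subseteq> T \<longleftrightarrow> y \<in> T" if T: "T \<in> comps m" for T
    proof -
      obtain a where a: "T = cls \<phi> (set_mset m) a" using T by (auto simp: comps_def)
      show "\<phi> f \<subseteq> T \<longleftrightarrow> x \<in> T" "\<phi> f \<subseteq> T \<longleftrightarrow> y \<in> T"
        using edge_in_cls[of f "set_mset m" \<phi> x y a] edge_in_cls[of f "set_mset m" \<phi> y x a] fm xy a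
        by (auto simp: insert_commute)
    qed
    then show "\<phi> f \<subseteq> S1 \<union> S2 \<longleftrightarrow> \<phi> f \<subseteq> S1 \<or> \<phi> f \<subseteq> S2" "\<not> (\<phi> f \<subseteq> S1 \<and> \<phi> f \<subseteq> S2)"
      using xy disj S by auto
  qed
  then show "count (surplus_in m (S1 \<union> S2)) f = count (surplus_in m S1 + surplus_in m S2) f"
    using set_surplus[of m] by (cases "f \<in># surplus m") (auto simp: surplus_in_def not_in_iff)
qed

text \<open>A new edge of exponent 1 merges two components and brings no surplus, so the excesses
  add. If the first was 0, the union simply inherits the excess and the status of the second. All
  other components keep their paths, hence their parity.\<close>

lemma valid_add_new:
  assumes m: "valid m" and e: "e \<in> E" "\<phi> e = {u, v}" and n: "(u, v) \<notin> conn \<phi> (set_mset m)"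
    and c: "excess m (cls \<phi> (set_mset m) u) = 0 \<or>
      (\<forall>T\<in>comps m. \<not> doubled m T) \<and> doubled (add_mset e m) (cls \<phi> (set_mset m) u \<union> cls \<phi> (set_mset m) v)"
  shows "valid (add_mset e m)"
proof -
  let ?n = "add_mset e m" and ?F = "set_mset m"
  let ?S1 = "cls \<phi> ?F u" and ?S2 = "cls \<phi> ?F v"
  have eF: "e \<notin># m" using n conn_edge[of e ?F \<phi>] e by blast
  have fo: "forest \<phi> ?F" and E: "?F \<subseteq> E" using m by (auto simp: valid_def)
  have fo': "forest \<phi> (set_mset ?n)" using forest_insert[OF fo e(2) n] by simp
  have uv: "u \<in> V" "v \<in> V" using endsE[OF e(1)] e(2) by (auto simp: doubleton_eq_iff)
  have comps: "comps ?n = insert (?S1 \<union> ?S2) (comps m - {?S1, ?S2})"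
    unfolding comps_def set_mset_add_mset_insert by (rule cls_image_insert[of \<phi>, OF e(2) uv])
  have S12: "?S1 \<in> comps m" "?S2 \<in> comps m" using uv by (auto simp: comps_def)
  have disj: "?S1 \<inter> ?S2 = {}"
    using n comps_eqI[OF S12] cls_eq_iff[of \<phi> ?F u v] by blast
  have xT: "surplus_in ?n T = surplus_in m T" for T by (simp add: surplus_in_def surplus_add_new[OF eF])
  have eT: "excess ?n T = excess m T" for T by (simp add: excess_def xT)
  have x12: "surplus_in m (?S1 \<union> ?S2) = surplus_in m ?S1 + surplus_in m ?S2" by (rule surplus_in_union[OF E S12 disj])
  have sub: "?F \<subseteq> set_mset ?n" by auto
  have dT: "doubled ?n T \<longleftrightarrow> doubled m T" if T: "T \<in> comps m" for T
  proof (cases "r \<in> T")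
    case True
    have "oddroot \<phi> \<sigma> (set_mset ?n) r f \<longleftrightarrow> oddroot \<phi> \<sigma> ?F r f" if f: "surplus_in m T = {#f#}" for f
    proof -
      have "f \<in># m" "\<phi> f \<subseteq> cls \<phi> ?F r" using surplus_in_edges[of f m T] f comps_cls[OF T True] by auto
      then show ?thesis using oddroot_subforest[OF fo' sub ends2[OF E]] oddroot_mono[OF _ sub] by metis
    qed
    then show ?thesis using True by (auto simp: doubled_def xT)
  next
    case False
    have "oddpath \<phi> \<sigma> (set_mset ?n) e f \<longleftrightarrow> oddpath \<phi> \<sigma> ?F e f" if f: "surplus_in m T = {#e, f#}" for e f
    proof -
      obtain a where a: "T = cls \<phi> ?F a" using T by (auto simp: comps_def)
      have "e \<in># m" "f \<in># m" "\<phi> e \<subseteq> cls \<phi> ?F a" "\<phi> f \<subseteq> cls \<phi> ?F a"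
        using surplus_in_edges[of f m T] surplus_in_edges[of e m T] f a by auto
      then show ?thesis using oddpath_subforest[OF fo' sub ends2[OF E]] oddpath_mono[OF _ sub] by metis
    qed
    then show ?thesis using False by (auto simp: doubled_def xT)
  qed
  have old: "excess m T \<le> 1 \<or> doubled m T" if "T \<in> comps m" for T using m that by (simp add: valid_def)
  have uniq: "T = T'" if "T \<in> comps m" "T' \<in> comps m" "doubled m T" "doubled m T'" for T T'
    using m that by (simp add: valid_def)
  have "(\<forall>T\<in>comps ?n. excess ?n T \<le> 1 \<or> doubled ?n T) \<and>
    (\<forall>T\<in>comps ?n. \<forall>T'\<in>comps ?n. doubled ?n T \<longrightarrow> doubled ?n T' \<longrightarrow> T = T')"
  proof (cases "excess m ?S1 = 0")
    case True
    then have x1: "surplus_in m ?S1 = {#}" "r \<notin> ?S1" by (auto simp: excess_def split: if_splits)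
    have eU: "excess m (?S1 \<union> ?S2) = excess m ?S2" using x1 by (auto simp: excess_def x12)
    have dU: "doubled ?n (?S1 \<union> ?S2) \<longleftrightarrow> doubled ?n ?S2" using x1 by (simp add: doubled_def x12 xT)
    have 1: "excess ?n T \<le> 1 \<or> doubled ?n T" if "T \<in> comps ?n" for T
      using that old[of T] old[OF S12(2)] dT[of T] dT[OF S12(2)] eU dU eT[of T] eT[of "?S1 \<union> ?S2"] unfolding comps by auto
    have 2: "T = T'" if "T \<in> comps ?n" "T' \<in> comps ?n" "doubled ?n T" "doubled ?n T'" for T T'
    proof -
      \<comment> \<open>Traces the merged component back to that of \<open>v\<close>, so that
        uniqueness for \<open>m\<close> can be applied.\<close>
      define g where "g T = (if T = ?S1 \<union> ?S2 then ?S2 else T)" for T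
      have g: "g T \<in> comps m \<and> doubled m (g T)" if "T \<in> comps ?n" "doubled ?n T" for T
        using that dU dT S12 unfolding comps g_def by auto
      have "g T = g T'" using uniq g that by blast
      then show ?thesis using that(1,2) unfolding comps g_def by (auto split: if_splits)
    qed
    show ?thesis using 1 2 by blast
  next
    case False
    then have no: "\<And>T. T \<in> comps m \<Longrightarrow> \<not> doubled m T" and dU: "doubled ?n (?S1 \<union> ?S2)" using c by auto
    have "excess ?n T \<le> 1 \<or> doubled ?n T" if "T \<in> comps ?n" for T
      using that old[of T] no[of T] dU eT[of T] unfolding comps by auto
    moreover have "T = ?S1 \<union> ?S2" if "T \<in> comps ?n" "doubled ?n T" for T
      using that no[of T] dT[of T] unfolding comps by auto
    ultimately show ?thesis by blast
  qed
  then show ?thesis unfolding valid_def using fo' E e(1) by auto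
qed

end

section \<open>The degree of a maximal monomial\<close>

lemma chain_const:
  assumes "chain \<phi> F vs es" "\<And>e u v. e \<in> F \<Longrightarrow> \<phi> e = {u, v} \<Longrightarrow> \<sigma> u = \<sigma> v"
  shows "\<sigma> (hd vs) = \<sigma> (last vs)"
  using assms
proof (induction \<phi> F vs es rule: chain.induct)
  case (2 \<phi> F u v vs e es)
  have c: "e \<in> F" "\<phi> e = {u, v}" "chain \<phi> F (v # vs) es" using "2.prems"(1) by simp_all
  have "\<sigma> u = \<sigma> v" by (rule "2.prems"(2)[OF c(1,2)])
  moreover have "\<sigma> (hd (v # vs)) = \<sigma> (last (v # vs))" by (rule "2.IH"[OF c(3) "2.prems"(2)])
  ultimately show ?case by simp
qed auto

text \<open>Outside the tree, 0-bar is joined to vertices of \<open>A\<close> only. Thus each edge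
  at the root is crossing, and a weight on it is an odd exception of its own.\<close>

locale rooted_bigraph = rooted_graph +
  assumes r_cross: "\<And>e v. e \<in> E \<Longrightarrow> \<phi> e = {r, v} \<Longrightarrow> v \<noteq> r \<Longrightarrow> \<sigma> v"
begin

text \<open>Loops are tolerated, as no forest contains them. The root is left out because its
  component has excess at least 1 in any case.\<close>

definition isolated :: "'b set" where
  "isolated = {v\<in>V. v \<noteq> r \<and> (\<forall>e\<in>E. \<forall>w. \<phi> e = {v, w} \<longrightarrow> w = v)}"

definition has_crossing :: bool where
  "has_crossing \<longleftrightarrow> (\<exists>e\<in>E. \<exists>u v. \<phi> e = {u, v} \<and> \<sigma> u \<noteq> \<sigma> v)"

lemma doubled_imp_crossing:
  assumes E: "set_mset m \<subseteq> E" and d: "doubled m S"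
  shows has_crossing
proof (rule ccontr)
  assume no: "\<not> has_crossing"
  have "\<sigma> (hd vs) = \<sigma> (last vs)" if "chain \<phi> F vs es" "F \<subseteq> E" for F vs es
    using chain_const[OF that(1), of \<sigma>] that(2) no unfolding has_crossing_def by blast
  then have "\<not> oddpath \<phi> \<sigma> (set_mset m) e f" "\<not> oddroot \<phi> \<sigma> (set_mset m) r f" for e f
    using E unfolding oddpath_def oddroot_def by blast+
  then show False using d unfolding doubled_def by (auto split: if_splits)
qed

lemma singleton_cls:
  assumes "\<And>e. e \<in> F \<Longrightarrow> \<not> \<phi> e \<subseteq> cls \<phi> F v"
  shows "cls \<phi> F v = {v}"
proof -
  have "y = v" if "(v, y) \<in> conn \<phi> F" for y
  proof -
    have "y \<in> {v}"
      using that
    proof (rule conn_closed)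
      fix e x w assume e: "e \<in> F" "\<phi> e = {x, w}" "x \<in> {v}"
      then have "\<phi> e \<subseteq> cls \<phi> F v" using edge_in_cls[of e F \<phi> x w v] cls_self[of v \<phi> F] by simp
      then show "w \<in> {v}" using assms e by blast
    qed simp
    then show ?thesis by simp
  qed
  then show ?thesis using cls_self[of v \<phi> F] by (auto simp: in_cls)
qed

lemma isolated_cls:
  assumes "v \<in> isolated" "F \<subseteq> E" "forest \<phi> F"
  shows "cls \<phi> F v = {v}" "e \<in> F \<Longrightarrow> \<not> \<phi> e \<subseteq> {v}"
proof -
  have no: "\<not> \<phi> e \<subseteq> {v}" if e: "e \<in> F" for e
  proof
    assume s: "\<phi> e \<subseteq> {v}"
    obtain x y where "\<phi> e = {x, y}" using endsE e assms(2) by blast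
    then show False using forest_no_loop[OF assms(3) e] s by auto
  qed
  then show "e \<in> F \<Longrightarrow> \<not> \<phi> e \<subseteq> {v}" .
  have "y \<in> {v}" if "(v, y) \<in> conn \<phi> F" for y
    using that
  proof (rule conn_closed)
    fix e x w assume e: "e \<in> F" "\<phi> e = {x, w}" "x \<in> {v}"
    then show "w \<in> {v}" using assms(1,2) unfolding isolated_def by auto
  qed simp
  then show "cls \<phi> F v = {v}" using cls_self[of v \<phi> F] by (auto simp: in_cls)
qed

text \<open>Each edge of the support lies inside exactly one component, so the exponents beyond 1
  can be summed componentwise.\<close>

lemma sum_surplus:
  assumes E: "set_mset m \<subseteq> E"
  shows "size m = card (set_mset m) + (\<Sum>S\<in>comps m. size (surplus_in m S))"
proof -
  have fin: "finite (comps m)" using finV by (simp add: comps_def)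
  have one: "\<exists>!S. S \<in> comps m \<and> \<phi> e \<subseteq> S" if e: "e \<in># m" for e
  proof -
    obtain u v where uv: "\<phi> e = {u, v}" "u \<in> V" using endsE e E by blast
    have "cls \<phi> (set_mset m) u \<in> comps m \<and> \<phi> e \<subseteq> cls \<phi> (set_mset m) u"
      using uv edge_in_cls[of e "set_mset m" \<phi> u v u] e cls_self[of u \<phi> "set_mset m"] by (auto simp: comps_def)
    moreover have "S = S'" if "S \<in> comps m \<and> \<phi> e \<subseteq> S" "S' \<in> comps m \<and> \<phi> e \<subseteq> S'" for S S'
      using comps_eqI[of S m S' u] that uv by auto
    ultimately show ?thesis by blast
  qed
  have size_surplus_in: "size (surplus_in m S) = (\<Sum>e\<in>set_mset m. if \<phi> e \<subseteq> S then count m e - 1 else 0)" for S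
  proof -
    have "size (surplus_in m S) = (\<Sum>e\<in>set_mset m. count (surplus_in m S) e)"
      unfolding size_multiset_overloaded_eq using surplus_in_edges[of _ m S]
      by (intro sum.mono_neutral_left) (auto simp: not_in_iff)
    then show ?thesis by (simp add: surplus_in_def count_surplus cong: sum.cong if_cong)
  qed
  have "(\<Sum>S\<in>comps m. size (surplus_in m S)) = (\<Sum>e\<in>set_mset m. \<Sum>S\<in>comps m. if \<phi> e \<subseteq> S then count m e - 1 else 0)"
    unfolding size_surplus_in by (rule sum.swap)
  also have "\<dots> = (\<Sum>e\<in>set_mset m. count m e - 1)"
  proof (rule sum.cong[OF refl])
    fix e assume "e \<in> set_mset m"
    then obtain S where S: "S \<in> comps m" "\<phi> e \<subseteq> S" "\<And>S'. S' \<in> comps m \<Longrightarrow> \<phi> e \<subseteq> S' \<Longrightarrow> S' = S"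
      using one by metis
    have "(\<Sum>S\<in>comps m. if \<phi> e \<subseteq> S then count m e - 1 else 0) = (\<Sum>S'\<in>comps m. if S' = S then count m e - 1 else 0)"
    proof (rule sum.cong[OF refl])
      fix S' assume "S' \<in> comps m"
      then have "\<phi> e \<subseteq> S' \<longleftrightarrow> S' = S" using S(2) S(3)[of S'] by blast
      then show "(if \<phi> e \<subseteq> S' then count m e - 1 else 0) = (if S' = S then count m e - 1 else 0)" by simp
    qed
    then show "(\<Sum>S\<in>comps m. if \<phi> e \<subseteq> S then count m e - 1 else 0) = count m e - 1"
      using S(1) fin by simp
  qed
  finally have "(\<Sum>S\<in>comps m. size (surplus_in m S)) = (\<Sum>e\<in>set_mset m. count m e - 1)" .
  moreover have "size m = (\<Sum>e\<in>set_mset m. 1 + (count m e - 1))"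
    unfolding size_multiset_overloaded_eq by (rule sum.cong) auto
  then have "size m = card (set_mset m) + (\<Sum>e\<in>set_mset m. count m e - 1)"
    unfolding sum.distrib by (simp only: card_eq_sum)
  ultimately show ?thesis by simp
qed

text \<open>By maximality the component carries exactly one unit of surplus, on an edge
  \<open>g\<close>. If both sides occurred in \<open>S\<close>, some odd path would end with
  \<open>g\<close>, and weighting its first edge once more would create an admissible
  exception.\<close>

lemma mono_component:
  assumes m: "valid m" and mx: "\<And>e. \<not> valid (add_mset e m)" and no: "\<And>S. S \<in> comps m \<Longrightarrow> \<not> doubled m S"
    and S: "S \<in> comps m" "r \<notin> S" and f: "f \<in># m" "\<phi> f \<subseteq> S" and w: "w \<in> S" "w' \<in> S"
  shows "\<sigma> w = \<sigma> w'"
proof (rule ccontr)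
  assume ne: "\<sigma> w \<noteq> \<sigma> w'"
  have E: "set_mset m \<subseteq> E" and fo: "forest \<phi> (set_mset m)" using m by (auto simp: valid_def)
  have "excess m S \<noteq> 0"
  proof
    assume "excess m S = 0"
    then have "valid (add_mset f m)" by (intro valid_add_old[OF m S(1) f]) simp
    then show False using mx by simp
  qed
  moreover have "excess m S \<le> 1" using m S(1) no[OF S(1)] by (auto simp: valid_def)
  ultimately have "size (surplus_in m S) = 1" unfolding excess_def if_not_P[OF S(2)] by linarith
  then obtain g where g: "surplus_in m S = {#g#}" by (metis size_1_singleton_mset)
  then have gm: "g \<in># m" "\<phi> g \<subseteq> S" using surplus_in_edges[of g m S] by auto
  obtain x y where xy: "\<phi> g = {x, y}" using ends2[OF E gm(1)] by blast
  have xny: "x \<noteq> y" by (rule forest_no_loop[OF fo gm(1) xy])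
  have Sx: "S = cls \<phi> (set_mset m) x" using comps_cls[OF S(1)] gm xy by auto
  have "\<exists>h. oddpath \<phi> \<sigma> (set_mset m) h g"
  proof (cases "\<sigma> x = \<sigma> y")
    case False
    have "chain \<phi> (set_mset m) [x, y] [g]" using chain_single[of g "set_mset m" \<phi> x y] gm xy by simp
    then show ?thesis using oddpathI[of \<phi> "set_mset m" "[x, y]" "[g]" \<sigma>] xny False by auto
  next
    case True
    \<comment> \<open>The ends of \<open>g\<close> agree under \<sigma>, so a path from a vertex of
      the other side ending with \<open>g\<close> is odd whichever end of \<open>g\<close> comes
      last.\<close>
    obtain w0 where w0: "w0 \<in> S" "\<sigma> w0 \<noteq> \<sigma> x" using ne w by metis
    have "(w0, x) \<in> conn \<phi> (set_mset m)" using w0(1) Sx by (simp add: in_cls conn_sym)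
    then obtain vs es where p: "chain \<phi> (set_mset m) vs es" "distinct vs" "hd vs = w0" "es \<noteq> []" "last es = g"
      using edge_path_from[of g "set_mset m" \<phi> x y w0] gm(1) xy xny by metis
    have "last vs \<in> {x, y}" using chain_hd_edge(2)[OF p(1,4)] p(5) xy by simp
    then have "\<sigma> (hd vs) \<noteq> \<sigma> (last vs)" using True w0 p(3) by auto
    then show ?thesis using oddpathI[OF p(1,2,4)] p(5) by blast
  qed
  then obtain h where h: "oddpath \<phi> \<sigma> (set_mset m) h g" by blast
  have hm: "h \<in># m" "\<phi> h \<subseteq> S" using oddpath_edges(1)[OF h] oddpath_edges(3)[OF h, of x] gm Sx by auto
  have "surplus_in (add_mset h m) S = {#h, g#}" using hm g by (simp add: surplus_in_def surplus_add_old)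
  moreover have "set_mset (add_mset h m) = set_mset m" using hm by auto
  ultimately have "doubled (add_mset h m) S" unfolding doubled_def using h S(2) by auto
  then show False using valid_add_old[OF m S(1) hm] no mx by blast
qed

text \<open>Such a component is a single vertex of excess 0, so any edge leaving the vertex could be
  added.\<close>

lemma empty_component:
  assumes m: "valid m" and mx: "\<And>e. \<not> valid (add_mset e m)" and S: "S \<in> comps m" "r \<notin> S"
    and nf: "\<And>f. f \<in># m \<Longrightarrow> \<not> \<phi> f \<subseteq> S"
  shows "\<exists>v\<in>isolated. S = {v}"
proof -
  obtain v where v: "v \<in> V" "S = cls \<phi> (set_mset m) v" using S by (auto simp: comps_def)
  have Sv: "S = {v}" using singleton_cls[of "set_mset m" v] nf v by blast
  have "surplus_in m S = {#}" using surplus_in_edges[of _ m S] nf by (metis multiset_nonemptyE)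
  then have e0: "excess m S = 0" using S(2) by (simp add: excess_def)
  have "w = v" if e: "e \<in> E" "\<phi> e = {v, w}" for e w
  proof (rule ccontr)
    assume "w \<noteq> v"
    then have "(v, w) \<notin> conn \<phi> (set_mset m)" using Sv v(2) by (auto simp: in_cls[symmetric])
    then show False using valid_add_new[OF m e] e0 v(2) mx by blast
  qed
  then show ?thesis using v Sv S(2) unfolding isolated_def by auto
qed

text \<open>Suppose there is no exception. Then every component lies on one side, so a crossing edge
  joins two different components. Both have excess 1, or the edge could be added. After adding it,
  the two units of excess, one of them possibly 0-bar itself, lie on different sides; the union is a
  legitimate exception, against maximality.\<close>

lemma maximal_doubled:
  assumes m: "valid m" and mx: "\<And>e. \<not> valid (add_mset e m)" and c: has_crossing
  shows "\<exists>S\<in>comps m. doubled m S"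
proof (rule ccontr)
  assume "\<not> ?thesis"
  then have no: "\<And>S. S \<in> comps m \<Longrightarrow> \<not> doubled m S" by blast
  let ?F = "set_mset m"
  let ?c = "cls \<phi> ?F"
  have E: "?F \<subseteq> E" and fo: "forest \<phi> ?F" using m by (auto simp: valid_def)
  have cV: "u \<in> V \<Longrightarrow> ?c u \<in> comps m" for u by (simp add: comps_def)
  have small: "S \<in> comps m \<Longrightarrow> excess m S \<le> 1" for S using m no by (auto simp: valid_def)
  have root: "?c r = {r}"
  proof (rule singleton_cls, rule notI)
    fix e0 assume e0: "e0 \<in> ?F" "\<phi> e0 \<subseteq> ?c r"
    \<comment> \<open>A root component with any edge has an edge at \<open>r\<close> itself. That
      edge is crossing, so weighting it would give an exception; hence the root is alone.\<close>
    have "\<exists>e\<in>?F. \<exists>v. \<phi> e = {r, v} \<and> v \<noteq> r"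
    proof (rule ccontr)
      assume nn: "\<not> ?thesis"
      have "y \<in> {r}" if "(r, y) \<in> conn \<phi> ?F" for y
        using that by (rule conn_closed) (use nn in blast)+
      moreover obtain x y where "\<phi> e0 = {x, y}" using ends2[OF E e0(1)] by blast
      ultimately have "\<phi> e0 = {r, r}" using e0(2) by (auto simp: in_cls)
      then show False using forest_no_loop[OF fo e0(1)] by blast
    qed
    then obtain e v where e: "e \<in> ?F" "\<phi> e = {r, v}" "v \<noteq> r" by blast
    have "\<sigma> v" using r_cross[OF _ e(2,3)] e(1) E by blast
    have "chain \<phi> ?F [r, v] [e]" using chain_single[of e ?F \<phi> r v] e by simp
    then have o: "oddroot \<phi> \<sigma> ?F r e" unfolding oddroot_def using e(3) \<open>\<sigma> v\<close> \<sigma>r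
      by (intro exI[of _ "[r, v]"] exI[of _ "[e]"]) auto
    have em: "e \<in># m" "\<phi> e \<subseteq> ?c r" using e edge_in_cls[of e ?F \<phi> r v r] cls_self[of r \<phi> ?F] by auto
    have "size (surplus_in m (?c r)) = 0" using small[OF cV[OF rV]] cls_self[of r \<phi> ?F] by (simp add: excess_def)
    then have "surplus_in (add_mset e m) (?c r) = {#e#}" using em by (simp add: surplus_in_def surplus_add_old)
    moreover have "set_mset (add_mset e m) = ?F" using em by auto
    ultimately have "doubled (add_mset e m) (?c r)" unfolding doubled_def using o cls_self[of r \<phi> ?F] by auto
    then show False using valid_add_old[OF m cV[OF rV] em] no mx by blast
  qed
  have mono: "\<sigma> w = \<sigma> w'" if S: "S \<in> comps m" and w: "w \<in> S" "w' \<in> S" for S w w'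
  proof (cases "r \<in> S")
    case True
    then have "S = {r}" using comps_cls[OF S] root by simp
    then show ?thesis using w by simp
  next
    case False
    show ?thesis
    proof (cases "\<exists>f. f \<in># m \<and> \<phi> f \<subseteq> S")
      case True
      then show ?thesis using mono_component[OF m mx no S False _ _ w] by blast
    next
      case nf: False
      then show ?thesis using empty_component[OF m mx S False] w by blast
    qed
  qed
  obtain e u v where e: "e \<in> E" "\<phi> e = {u, v}" "\<sigma> u \<noteq> \<sigma> v" using c by (auto simp: has_crossing_def)
  \<comment> \<open>At most one end of the crossing edge is the root, so after exchanging the names
    only \<open>u\<close> can be it.\<close>
  have key: False if e: "e \<in> E" "\<phi> e = {u, v}" "\<sigma> u \<noteq> \<sigma> v" and vr: "v \<noteq> r" for u v
  proof -
    have uv: "u \<in> V" "v \<in> V" using endsE[OF e(1)] e(2) by (auto simp: doubleton_eq_iff)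
    note C = cV[OF uv(1)] cV[OF uv(2)]
    have n: "(u, v) \<notin> conn \<phi> ?F" using mono[OF C(1), of u v] e(3) cls_self[of u \<phi> ?F] by (auto simp: in_cls)
    then have n': "(v, u) \<notin> conn \<phi> ?F" using conn_sym by metis
    let ?n = "add_mset e m"
    have em: "e \<notin># m" using n conn_edge[of e ?F \<phi>] e by blast
    have fo': "forest \<phi> (set_mset ?n)" using forest_insert[OF fo e(2) n] by simp
    have disj: "?c u \<inter> ?c v = {}" using n comps_eqI[OF C] cls_eq_iff[of \<phi> ?F u v] by blast
    have nz: "excess m (?c u) \<noteq> 0" "excess m (?c v) \<noteq> 0"
    proof -
      have e': "\<phi> e = {v, u}" using e(2) by (simp add: insert_commute)
      show "excess m (?c u) \<noteq> 0"
      proof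
        assume "excess m (?c u) = 0"
        then have "valid (add_mset e m)" by (intro valid_add_new[OF m e(1,2) n] disjI1)
        then show False using mx by blast
      qed
      show "excess m (?c v) \<noteq> 0"
      proof
        assume "excess m (?c v) = 0"
        then have "valid (add_mset e m)" by (intro valid_add_new[OF m e(1) e' n'] disjI1)
        then show False using mx by blast
      qed
    qed
    have nd: "\<not> doubled ?n (?c u \<union> ?c v)" using valid_add_new[OF m e(1,2) n] no mx by blast
    have sub: "?F \<subseteq> set_mset ?n" by auto
    have un: "?c u \<union> ?c v = cls \<phi> (set_mset ?n) u"
      using cls_insert[of \<phi> e u v ?F u, OF e(2)] cls_self[of u \<phi> ?F] by simp
    have rv: "r \<notin> ?c v"
    proof
      assume "r \<in> ?c v"
      then have "?c v = {r}" using cls_eqI[of r \<phi> ?F v] root by simp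
      then show False using cls_self[of v \<phi> ?F] vr by simp
    qed
    have "size (surplus_in m (?c v)) = 1" using nz(2) small[OF C(2)] unfolding excess_def if_not_P[OF rv] by linarith
    then obtain f where f: "surplus_in m (?c v) = {#f#}" by (metis size_1_singleton_mset)
    then have fm: "f \<in># m" "\<phi> f \<subseteq> ?c v" using surplus_in_edges[of f m "?c v"] by auto
    have ends': "\<exists>x y. \<phi> g = {x, y}" if "g \<in> set_mset ?n" for g
      using that ends2[OF E] e(2) by auto
    have xT: "surplus_in ?n T = surplus_in m T" for T by (simp add: surplus_in_def surplus_add_new[OF em])
    have x12: "surplus_in m (?c u \<union> ?c v) = surplus_in m (?c u) + surplus_in m (?c v)" by (rule surplus_in_union[OF E C disj])
    show False
    proof (cases "r \<in> ?c u")
      case True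
      then have "?c u = {r}" using cls_eqI[of r \<phi> ?F u] root by simp
      then have ur: "u = r" using cls_self[of u \<phi> ?F] by simp
      have "size (surplus_in m (?c u)) = 0" using small[OF C(1)] True by (simp add: excess_def)
      then have x: "surplus_in ?n (?c u \<union> ?c v) = {#f#}" using f by (simp add: xT x12)
      obtain x y where xy: "\<phi> f = {x, y}" using ends2[OF E fm(1)] by blast
      have "x \<in> cls \<phi> (set_mset ?n) r" using fm(2) xy un ur by auto
      then obtain vs es where p: "chain \<phi> (set_mset ?n) vs es" "distinct vs" "hd vs = r" "es \<noteq> []" "last es = f"
        using edge_path_from[of f "set_mset ?n" \<phi> x y r] fm(1) xy forest_no_loop[OF fo fm(1) xy]
        by (auto simp: in_cls)
      have "last vs \<in> ?c v" using chain_hd_edge(2)[OF p(1,4)] p(5) fm(2) by auto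
      then have "\<sigma> (last vs) = \<sigma> v" using mono[OF C(2)] cls_self[of v \<phi> ?F] by blast
      then have "oddroot \<phi> \<sigma> (set_mset ?n) r f" unfolding oddroot_def using p e(3) ur by metis
      then show False using nd x True unfolding doubled_def by auto
    next
      case False
      have "size (surplus_in m (?c u)) = 1" using nz(1) small[OF C(1)] unfolding excess_def if_not_P[OF False] by linarith
      then obtain g where g: "surplus_in m (?c u) = {#g#}" by (metis size_1_singleton_mset)
      then have gm: "g \<in># m" "\<phi> g \<subseteq> ?c u" using surplus_in_edges[of g m "?c u"] by auto
      have x: "surplus_in ?n (?c u \<union> ?c v) = {#g, f#}" using f g by (simp add: xT x12)
      have "g \<in> set_mset ?n" "f \<in> set_mset ?n" "\<phi> g \<subseteq> cls \<phi> (set_mset ?n) u" "\<phi> f \<subseteq> cls \<phi> (set_mset ?n) u"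
        using fm gm un by auto
      then obtain vs es where p: "chain \<phi> (set_mset ?n) vs es" "distinct vs" "es \<noteq> []" "hd es = g" "last es = f"
        using path_between_edges[OF fo' ends'] by metis
      have "hd vs \<in> ?c u" "last vs \<in> ?c v" using chain_hd_edge[OF p(1,3)] p(4,5) fm(2) gm(2) by auto
      then have "\<sigma> (hd vs) = \<sigma> u" "\<sigma> (last vs) = \<sigma> v"
        using mono[OF C(1)] mono[OF C(2)] cls_self[of v \<phi> ?F] cls_self[of u \<phi> ?F] by blast+
      then have "oddpath \<phi> \<sigma> (set_mset ?n) g f" using oddpathI[OF p(1-3), of \<sigma>] p(4,5) e(3) by simp
      then show False using nd x False rv unfolding doubled_def by auto
    qed
  qed
  show False
  proof (cases "v = r")
    case True
    then have "u \<noteq> r" using e(3) by auto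
    then show ?thesis using key[of v u] e by (auto simp: insert_commute)
  qed (use key e in blast)
qed

text \<open>The excess is 0 on the isolated singletons, 1 on the others, and one more on the
  exception if an edge is crossing. The sum of all excesses is the surplus plus the unit of 0-bar,
  which is the 1 on the left; \<open>forest_card\<close> then eliminates the number of
  components.\<close>

lemma maximal_size:
  assumes m: "valid m" and mx: "\<And>e. \<not> valid (add_mset e m)"
  shows "size m + card isolated + 1 = card V + (if has_crossing then 1 else 0)"
proof -
  let ?F = "set_mset m"
  have E: "?F \<subseteq> E" and fo: "forest \<phi> ?F" using m by (auto simp: valid_def)
  have fin: "finite (comps m)" using finV by (simp add: comps_def)
  define Iso where "Iso = (\<lambda>v. {v}) ` isolated"
  have iso_sub: "Iso \<subseteq> comps m"
    unfolding Iso_def comps_def using isolated_cls(1)[OF _ E fo] by (auto simp: isolated_def image_iff)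
  have cardIso: "card Iso = card isolated" unfolding Iso_def by (simp add: card_image)
  have ex: "excess m S = (if S \<in> Iso then 0 else 1) + (if doubled m S then 1 else 0)" if S: "S \<in> comps m" for S
  proof (cases "S \<in> Iso")
    case True
    then obtain v where v: "v \<in> isolated" "S = {v}" by (auto simp: Iso_def)
    have "surplus_in m S = {#}" using surplus_in_edges[of _ m S] isolated_cls(2)[OF v(1) E fo] v(2) by (metis multiset_nonemptyE)
    moreover have "r \<notin> S" using v by (auto simp: isolated_def)
    ultimately have "excess m S = 0" by (simp add: excess_def)
    then show ?thesis using True doubled_excess[of m S] by auto
  next
    case False
    have "excess m S \<noteq> 0"
    proof (cases "r \<in> S")
      case rS: False
      then obtain f where "f \<in># m" "\<phi> f \<subseteq> S"
        using empty_component[OF m mx S rS] False by (auto simp: Iso_def)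
      then have "excess m S = 0 \<Longrightarrow> valid (add_mset f m)" by (intro valid_add_old[OF m S]) auto
      then show ?thesis using mx[of f] by blast
    qed (simp add: excess_def)
    moreover have "excess m S \<le> 1 \<or> doubled m S" using m S by (simp add: valid_def)
    ultimately show ?thesis using False doubled_excess[of m S] by auto
  qed
  have d: "(\<Sum>S\<in>comps m. if doubled m S then 1 else 0 :: nat) = (if has_crossing then 1 else 0)"
  proof (cases has_crossing)
    case True
    then obtain S where S: "S \<in> comps m" "doubled m S" using maximal_doubled[OF m mx] by blast
    have "doubled m T \<longleftrightarrow> T = S" if "T \<in> comps m" for T using m S that by (auto simp: valid_def)
    then have "(\<Sum>T\<in>comps m. if doubled m T then 1 else 0 :: nat) = (\<Sum>T\<in>comps m. if T = S then 1 else 0)"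
      by (intro sum.cong) auto
    then show ?thesis using True S(1) fin by simp
  next
    case False
    then have "\<not> doubled m S" for S using doubled_imp_crossing[OF E] by blast
    then show ?thesis using False by simp
  qed
  have i: "(\<Sum>S\<in>comps m. if S \<in> Iso then 0 else 1 :: nat) + card Iso = card (comps m)"
  proof -
    have "(\<Sum>S\<in>comps m. if S \<in> Iso then 0 else 1 :: nat) = card (comps m - Iso)"
      using fin by (simp add: sum.If_cases Diff_eq)
    moreover have "card (comps m - Iso) + card Iso = card (comps m)"
      using iso_sub fin by (metis card_Diff_subset card_mono finite_subset le_add_diff_inverse2)
    ultimately show ?thesis by simp
  qed
  have r1: "(\<Sum>S\<in>comps m. if r \<in> S then 1 else 0 :: nat) = 1"
  proof -
    have "r \<in> S \<longleftrightarrow> S = cls \<phi> ?F r" if "S \<in> comps m" for S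
      using comps_cls[OF that, of r] cls_self[of r \<phi> ?F] by blast
    then have "(\<Sum>S\<in>comps m. if r \<in> S then 1 else 0 :: nat) = (\<Sum>S\<in>comps m. if S = cls \<phi> ?F r then 1 else 0)"
      by (intro sum.cong) auto
    then show ?thesis using fin rV by (simp add: comps_def)
  qed
  have "(\<Sum>S\<in>comps m. excess m S) = (\<Sum>S\<in>comps m. if S \<in> Iso then 0 else 1) + (if has_crossing then 1 else 0)"
    using ex by (simp add: sum.distrib d cong: sum.cong)
  moreover have "(\<Sum>S\<in>comps m. excess m S) = 1 + (\<Sum>S\<in>comps m. size (surplus_in m S))"
    unfolding excess_def by (simp add: sum.distrib r1)
  moreover have "card ?F + card (comps m) = card V"
    unfolding comps_def by (rule forest_card[OF finite_set_mset finV fo]) (use E endsE in blast)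
  ultimately show ?thesis using sum_surplus[OF E] i cardIso by linarith
qed

end

section \<open>Biconed graphs\<close>

lemma path_containing_iff_chain:
  "path_containing (spanning_subgraph H F) X W vs es \<longleftrightarrow>
     chain (ends H) F vs es \<and> set vs \<subseteq> verts H \<and> distinct vs \<and> X \<subseteq> set vs \<and> W \<subseteq> set es"
  unfolding path_containing_def path_def walk_iff_chain by blast

text \<open>Otherwise the first vertex and edge could be dropped. Applied to the reversed path as
  well, it locates the prescribed objects at both ends.\<close>

lemma shortest_path_hd:
  assumes "shortest_path_containing (spanning_subgraph H F) X W vs es" "es \<noteq> []"
  shows "hd es \<in> W \<or> hd vs \<in> X"
proof (rule ccontr)
  assume n: "\<not> ?thesis"
  have p: "chain (ends H) F vs es" "set vs \<subseteq> verts H" "distinct vs" "X \<subseteq> set vs" "W \<subseteq> set es"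
    and min: "\<And>vs' es'. path_containing (spanning_subgraph H F) X W vs' es' \<Longrightarrow> length es \<le> length es'"
    using assms(1) unfolding shortest_path_containing_def path_containing_iff_chain by auto
  obtain e es' where es: "es = e # es'" using assms(2) by (cases es) auto
  then obtain u ws where ws: "vs = u # ws" "chain (ends H) F ws es'" using p(1) unfolding es chain_Cons_iff by blast
  have "path_containing (spanning_subgraph H F) X W ws es'"
    unfolding path_containing_iff_chain using p ws es n by auto
  then show False using min es by fastforce
qed

lemma shortest_path_rev:
  assumes "shortest_path_containing (spanning_subgraph H F) X W vs es"
  shows "shortest_path_containing (spanning_subgraph H F) X W (rev vs) (rev es)"
  using assms chain_rev[of "ends H" F vs es]
  unfolding shortest_path_containing_def path_containing_iff_chain by auto

lemma shortest_path_exists: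
  assumes "path_containing H' X W vs es"
  obtains vs' es' where "shortest_path_containing H' X W vs' es'"
proof -
  have "\<exists>p. path_containing H' X W (fst p) (snd p) \<and>
      (\<forall>q. path_containing H' X W (fst q) (snd q) \<longrightarrow> length (snd p) \<le> length (snd q))"
    by (rule ex_has_least_nat[of _ "(vs, es)"]) (use assms in simp)
  then show ?thesis using that unfolding shortest_path_containing_def by fastforce
qed

text \<open>Along the path \<sigma> changes exactly at the crossing edges. Distinct edges are needed
  because the crossing edges are counted as a set.\<close>

lemma odd_crossings_iff:
  fixes \<sigma> :: "'v \<Rightarrow> bool"
  assumes "chain \<phi> F vs es" "distinct es"
    and "\<And>e u v. e \<in> F \<Longrightarrow> \<phi> e = {u, v} \<Longrightarrow> cr e \<longleftrightarrow> \<sigma> u \<noteq> \<sigma> v"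
  shows "odd (card {e \<in> set es. cr e}) \<longleftrightarrow> \<sigma> (hd vs) \<noteq> \<sigma> (last vs)"
  using assms
proof (induction \<phi> F vs es rule: chain.induct)
  case (2 \<phi> F u v vs e es)
  have c: "e \<in> F" "\<phi> e = {u, v}" "chain \<phi> F (v # vs) es" using "2.prems"(1) by simp_all
  have d: "e \<notin> set es" "distinct es" using "2.prems"(2) by simp_all
  have IH: "odd (card {e \<in> set es. cr e}) \<longleftrightarrow> \<sigma> v \<noteq> \<sigma> (last (v # vs))"
    using "2.IH"[OF c(3) d(2) "2.prems"(3)] by simp
  have cr: "cr e \<longleftrightarrow> \<sigma> u \<noteq> \<sigma> v" by (rule "2.prems"(3)[OF c(1,2)])
  have "{x \<in> set (e # es). cr x} = (if cr e then insert e {x \<in> set es. cr x} else {x \<in> set es. cr x})" by auto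
  then have step: "odd (card {x \<in> set (e # es). cr x}) \<longleftrightarrow> (cr e \<noteq> odd (card {x \<in> set es. cr x}))"
    using d(1) by simp
  show ?case unfolding step IH cr by auto
qed auto

definition base_verts :: "('v, 'e) mgraph \<Rightarrow> 'v bvert set" where
  "base_verts G = insert ApexBar (Base ` verts G)"

definition inA :: "'v set \<Rightarrow> 'v bvert \<Rightarrow> bool" where
  "inA A x \<longleftrightarrow> x \<in> Base ` A"

lemma reduced_simps:
  "ends (reduced G A B) = bends G"
  "verts (reduced G A B) = base_verts G"
  "edges (reduced G A B) = edges (biconing G A B) - base_tree A B"
  "edges (reduced G A B) = ConeBar ` (A \<inter> B) \<union> BaseEdge ` edges G"
  by (auto simp: reduced_def biconing_def base_verts_def base_tree_def Let_def)

lemma biconing_simps: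
  "ends (biconing G A B) = bends G"
  "verts (biconing G A B) = insert Apex (base_verts G)"
  "edges (biconing G A B) = {Spine} \<union> Cone ` A \<union> ConeBar ` B \<union> BaseEdge ` edges G"
  by (auto simp: biconing_def base_verts_def)

lemma reduced_ends:
  assumes "biconing_data G A B" "e \<in> edges (reduced G A B)"
  shows "\<exists>u\<in>base_verts G. \<exists>v\<in>base_verts G. bends G e = {u, v}"
proof -
  from assms(2) consider b where "e = ConeBar b" "b \<in> A \<inter> B" | g where "e = BaseEdge g" "g \<in> edges G"
    unfolding reduced_simps(4) by blast
  then show ?thesis
  proof cases
    case 1
    then show ?thesis using assms(1) by (auto simp: base_verts_def biconing_data_def)
  next
    case 2
    have "fin_mgraph G" using assms(1) by (simp add: biconing_data_def)
    then obtain u v where "u \<in> verts G" "v \<in> verts G" "ends G g = {u, v}"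
      using fin_mgraph_ends[of G g] 2 by blast
    then show ?thesis using 2 by (intro bexI[of _ "Base u"] bexI[of _ "Base v"]) (auto simp: base_verts_def)
  qed
qed

lemma rooted_bigraph_reduced:
  assumes "biconing_data G A B"
  shows "rooted_bigraph (bends G) (base_verts G) ApexBar (inA A) (edges (reduced G A B))"
proof
  have fin: "finite (verts G)" "finite (edges G)" "A \<subseteq> verts G"
    using assms by (auto simp: biconing_data_def fin_mgraph_def)
  show "finite (base_verts G)" "finite (edges (reduced G A B))"
    using fin finite_subset[of "A \<inter> B" "verts G"] by (auto simp: base_verts_def reduced_simps(4))
  show "ApexBar \<in> base_verts G" by (simp add: base_verts_def)
  show "\<not> inA A ApexBar" by (auto simp: inA_def)
  show "\<exists>u\<in>base_verts G. \<exists>v\<in>base_verts G. bends G e = {u, v}" if "e \<in> edges (reduced G A B)" for e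
    by (rule reduced_ends[OF assms that])
  show "inA A v" if "e \<in> edges (reduced G A B)" "bends G e = {ApexBar, v}" "v \<noteq> ApexBar" for e v
    using that unfolding reduced_simps(4) by (auto simp: inA_def doubleton_eq_iff)
qed

lemma crossing_iff:
  assumes d: "biconing_data G A B" and e: "e \<in> edges (reduced G A B)" "bends G e = {u, v}"
  shows "crossing G A B e \<longleftrightarrow> inA A u \<noteq> inA A v"
proof -
  have V: "u \<in> base_verts G" "v \<in> base_verts G"
    using reduced_ends[OF d e(1)] e(2) by (auto simp: doubleton_eq_iff)
  have n: "x \<in> Base ` (B - A) \<union> {ApexBar} \<longleftrightarrow> \<not> inA A x" if "x \<in> base_verts G" for x
  proof -
    have "Base y \<in> Base ` X \<longleftrightarrow> y \<in> X" for y :: 'a and X by auto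
    then show ?thesis using that d by (auto simp: inA_def base_verts_def biconing_data_def)
  qed
  show ?thesis
  proof
    assume "crossing G A B e"
    then obtain a w where aw: "inA A a" "w \<in> Base ` (B - A) \<union> {ApexBar}" "{u, v} = {a, w}"
      unfolding crossing_def reduced_simps e(2) inA_def by blast
    then have "\<not> inA A w" using n V by (auto simp: doubleton_eq_iff)
    then show "inA A u \<noteq> inA A v" using aw by (auto simp: doubleton_eq_iff)
  next
    assume "inA A u \<noteq> inA A v"
    then consider "inA A u" "\<not> inA A v" | "inA A v" "\<not> inA A u" by blast
    then show "crossing G A B e"
    proof cases
      case 1
      then have "u \<in> Base ` A" "v \<in> Base ` (B - A) \<union> {ApexBar}" using n V unfolding inA_def by blast+
      then show ?thesis unfolding crossing_def reduced_simps e(2) by blast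
    next
      case 2
      then have "v \<in> Base ` A" "u \<in> Base ` (B - A) \<union> {ApexBar}" "{u, v} = {v, u}"
        using n V unfolding inA_def by blast+
      then show ?thesis unfolding crossing_def reduced_simps e(2) by blast
    qed
  qed
qed

context
  fixes G :: "('v, 'e) mgraph" and A B :: "'v set" and F :: "('v, 'e) bedge set"
  assumes d: "biconing_data G A B" and F: "F \<subseteq> edges (reduced G A B)" and fo: "forest (bends G) F"
begin

lemma odd_crossings_path:
  assumes "chain (bends G) F vs es" "distinct vs"
  shows "odd (card {e \<in> set es. crossing G A B e}) \<longleftrightarrow> inA A (hd vs) \<noteq> inA A (last vs)"
  by (rule odd_crossings_iff[OF assms(1) distinct_chain_edges[OF assms] crossing_iff[OF d]])
    (use F in auto)

lemma chain_in_verts: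
  assumes "chain (bends G) F vs es" "es \<noteq> []"
  shows "set vs \<subseteq> base_verts G"
proof (rule chain_verts_subset[OF assms])
  fix e assume "e \<in> F"
  then show "bends G e \<subseteq> base_verts G" using reduced_ends[OF d subsetD[OF F \<open>e \<in> F\<close>]] by auto
qed

text \<open>By \<open>shortest_path_hd\<close> a shortest path containing \<open>e\<close> and
  \<open>f\<close> has them as its end edges. The weighted edges form a set, so \<open>e = f\<close>
  covers a single edge of weight 3.\<close>

lemma odd_crossing_pair:
  assumes S: "ApexBar \<notin> S" and W: "weighted_edges (reduced G A B) F \<omega> S = {e, f}"
  shows "odd_crossing G A B F \<omega> S \<longleftrightarrow> oddpath (bends G) (inA A) F e f"
proof -
  let ?P = "shortest_path_containing (spanning_subgraph (reduced G A B) F) {} {e, f}"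
  have iff: "odd_crossing G A B F \<omega> S \<longleftrightarrow> (\<exists>vs es. ?P vs es \<and> odd (card {e \<in> set es. crossing G A B e}))"
    using S by (simp add: odd_crossing_def Let_def W)
  have sp: "chain (bends G) F vs es" "distinct vs" "es \<noteq> []" "hd es = e \<and> last es = f \<or> hd es = f \<and> last es = e"
    if p: "?P vs es" for vs es
  proof -
    have c: "chain (bends G) F vs es" "distinct vs" "{e, f} \<subseteq> set es"
      using p unfolding shortest_path_containing_def path_containing_iff_chain reduced_simps by auto
    then have ne: "es \<noteq> []" by auto
    have h: "hd es \<in> {e, f}" using shortest_path_hd[OF p ne] by simp
    have l: "last es \<in> {e, f}" using shortest_path_hd[OF shortest_path_rev[OF p]] ne by (simp add: hd_rev)
    show "chain (bends G) F vs es" "distinct vs" "es \<noteq> []" by fact+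
    show "hd es = e \<and> last es = f \<or> hd es = f \<and> last es = e"
    proof (cases "hd es = last es")
      case True
      then have "es = [hd es]" by (rule single_edge_path[OF c(1,2) ne])
      then have "{e, f} \<subseteq> {hd es}" using c(3) by (metis empty_set list.simps(15))
      then show ?thesis using h l by auto
    next
      case False
      then show ?thesis using h l by auto
    qed
  qed
  show ?thesis
  proof
    assume "odd_crossing G A B F \<omega> S"
    then obtain vs es where p: "?P vs es" "odd (card {e \<in> set es. crossing G A B e})" using iff by blast
    note c = sp[OF p(1)]
    have "inA A (hd vs) \<noteq> inA A (last vs)" using p(2) odd_crossings_path[OF c(1,2)] by simp
    then have "oddpath (bends G) (inA A) F (hd es) (last es)" by (rule oddpathI[OF c(1-3)])
    then show "oddpath (bends G) (inA A) F e f" using c(4) oddpath_sym by metis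
  next
    assume o: "oddpath (bends G) (inA A) F e f"
    then obtain ws fs where q: "chain (bends G) F ws fs" "distinct ws" "fs \<noteq> []" "hd fs = e" "last fs = f"
      by (auto simp: oddpath_def)
    then have "path_containing (spanning_subgraph (reduced G A B) F) {} {e, f} ws fs"
      unfolding path_containing_iff_chain reduced_simps using chain_in_verts[OF q(1,3)] by auto
    then obtain vs es where p: "?P vs es" using shortest_path_exists by metis
    note c = sp[OF p]
    have "inA A (hd vs) \<noteq> inA A (last vs)" by (rule oddpath_any[OF fo o c])
    then show "odd_crossing G A B F \<omega> S" using iff p odd_crossings_path[OF c(1,2)] by blast
  qed
qed

lemma odd_crossing_root:
  assumes S: "ApexBar \<in> S" and W: "weighted_edges (reduced G A B) F \<omega> S = {f}"
  shows "odd_crossing G A B F \<omega> S \<longleftrightarrow> oddroot (bends G) (inA A) F ApexBar f"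
proof -
  let ?P = "shortest_path_containing (spanning_subgraph (reduced G A B) F) {ApexBar} {f}"
  let ?N = "\<lambda>vs es. chain (bends G) F vs es \<and> distinct vs \<and> es \<noteq> [] \<and> hd vs = ApexBar \<and> last es = f"
  have iff: "odd_crossing G A B F \<omega> S \<longleftrightarrow> (\<exists>vs es. ?P vs es \<and> odd (card {e \<in> set es. crossing G A B e}))"
    using S by (simp add: odd_crossing_def Let_def W)
  \<comment> \<open>A shortest path may run in either direction; it is turned so that it starts at
    0-bar. Its set of edges, hence its parity, stays the same.\<close>
  have sp: "\<exists>vs' es'. ?P vs' es' \<and> ?N vs' es' \<and> set es' = set es" if p: "?P vs es" for vs es
  proof -
    have c: "chain (bends G) F vs es" "distinct vs" "f \<in> set es" "ApexBar \<in> set vs"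
      using p unfolding shortest_path_containing_def path_containing_iff_chain reduced_simps by auto
    then have ne: "es \<noteq> []" by auto
    note rs = chain_rev_simps[OF c(1) ne]
    have h: "hd es = f \<or> hd vs = ApexBar" using shortest_path_hd[OF p ne] by simp
    have l: "last es = f \<or> last vs = ApexBar" using shortest_path_hd[OF shortest_path_rev[OF p]] ne rs by simp
    have hl: "hd vs \<noteq> last vs"
      using c(2) chain_length[OF c(1)] ne by (cases vs; cases es) (auto split: if_splits)
    have fwd: "?thesis" if "hd vs = ApexBar" "last es = f" using that p c ne by blast
    have bwd: "?thesis" if "last vs = ApexBar" "hd es = f"
      using that shortest_path_rev[OF p] chain_rev[OF c(1)] c(2) ne rs
      by (intro exI[of _ "rev vs"] exI[of _ "rev es"]) auto
    show ?thesis
    proof (cases "hd es = f \<and> last es = f")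
      case True
      \<comment> \<open>For a path of one edge both ends satisfy \<open>h\<close> and
        \<open>l\<close> through \<open>f\<close> alone, so the position of 0-bar has to be found
        among its two vertices.\<close>
      then have "es = [f]" using single_edge_path[OF c(1,2) ne] by simp
      then have "length vs = 2" using chain_length[OF c(1)] by simp
      then have "ApexBar = hd vs \<or> ApexBar = last vs" using c(4) by (cases vs; cases "tl vs") auto
      then show ?thesis
      proof
        assume "ApexBar = hd vs"
        then show ?thesis using True by (intro fwd) simp_all
      next
        assume "ApexBar = last vs"
        then show ?thesis using True by (intro bwd) simp_all
      qed
    next
      case False
      then consider "hd vs = ApexBar" "last es = f" | "last vs = ApexBar" "hd es = f" using h l hl by metis
      then show ?thesis by cases (rule fwd, assumption+, rule bwd, assumption+)
    qed
  qed
  show ?thesis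
  proof
    assume "odd_crossing G A B F \<omega> S"
    then obtain vs es where p: "?P vs es" "odd (card {e \<in> set es. crossing G A B e})" using iff by blast
    obtain vs' es' where q: "?N vs' es'" "set es' = set es" using sp[OF p(1)] by blast
    have "inA A (hd vs') \<noteq> inA A (last vs')" using p(2) odd_crossings_path[of vs' es'] q by simp
    then show "oddroot (bends G) (inA A) F ApexBar f" unfolding oddroot_def using q(1) by metis
  next
    assume "oddroot (bends G) (inA A) F ApexBar f"
    then obtain ws fs where q: "chain (bends G) F ws fs" "distinct ws" "fs \<noteq> []" "hd ws = ApexBar" "last fs = f"
      "inA A ApexBar \<noteq> inA A (last ws)" by (auto simp: oddroot_def)
    have "ApexBar \<in> set ws" using q(4) hd_in_set[OF chain_ne[OF q(1)]] by simp
    then have "path_containing (spanning_subgraph (reduced G A B) F) {ApexBar} {f} ws fs"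
      unfolding path_containing_iff_chain reduced_simps using q chain_in_verts[OF q(1,3)] by auto
    then obtain vs0 es0 where "?P vs0 es0" using shortest_path_exists by metis
    then obtain vs es where p: "?P vs es" "?N vs es" using sp by blast
    then have c: "chain (bends G) F vs es" "distinct vs" "es \<noteq> []" by simp_all
    have "last vs = last ws" using p(2) q(4,5) by (intro path_last_unique[OF fo c q(1-3)]) simp_all
    then have "inA A (hd vs) \<noteq> inA A (last vs)" using q(6) p(2) by simp
    then show "odd_crossing G A B F \<omega> S" using iff p(1) odd_crossings_path[OF c(1,2)] by blast
  qed
qed

end

section \<open>Two-weighted forests as valid monomials, and their count for a fixed support\<close>

context rooted_graph
begin

lemma size_surplus_in: "size (surplus_in m S) = (\<Sum>e\<in>{e\<in>set_mset m. \<phi> e \<subseteq> S}. count m e - 1)"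
proof -
  have "size (surplus_in m S) = (\<Sum>e\<in>{e\<in>set_mset m. \<phi> e \<subseteq> S}. count (surplus_in m S) e)"
    unfolding size_multiset_overloaded_eq using surplus_in_edges[of _ m S]
    by (intro sum.mono_neutral_left) (auto simp: not_in_iff)
  also have "\<dots> = (\<Sum>e\<in>{e\<in>set_mset m. \<phi> e \<subseteq> S}. count m e - 1)"
    by (intro sum.cong) (auto simp: surplus_in_def count_surplus)
  finally show ?thesis .
qed

lemma set_surplus_in: "set_mset (surplus_in m S) = {e\<in>set_mset m. \<phi> e \<subseteq> S \<and> 2 \<le> count m e}"
proof -
  have "e \<in># surplus_in m S \<longleftrightarrow> \<phi> e \<subseteq> S \<and> 2 \<le> count m e" for e
    by (auto simp: surplus_in_def count_surplus simp flip: count_greater_zero_iff)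
  moreover have "2 \<le> count m e \<Longrightarrow> e \<in># m" for e
    by (simp flip: count_greater_zero_iff)
  ultimately show ?thesis by blast
qed

text \<open>For a fixed support only the surplus is free, and the conditions on it are exactly the
  constraint counted in \<open>edge_doubles_gf\<close>.\<close>

lemma valid_iff_mixed:
  assumes E: "set_mset m \<subseteq> E" and fo: "forest \<phi> (set_mset m)"
  shows "valid m \<longleftrightarrow> surplus m \<in> mixed (set_mset m) (rooted_forest.edge_cls \<phi> (set_mset m))
    (rooted_forest.Cs \<phi> V r (set_mset m)) (cls \<phi> (set_mset m) r) (rooted_forest.edge_doubles \<phi> r \<sigma> (set_mset m))"
proof -
  interpret f: rooted_forest \<phi> V r \<sigma> "set_mset m"
    by unfold_locales (use finV rV \<sigma>r fo endsE E in auto)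
  have part: "part f.edge_cls S (surplus m) = surplus_in m S" if "S \<in> comps m" for S
    unfolding part_def surplus_in_def using set_surplus[of m] f.edge_cls_iff[of _ S] that
    by (intro filter_mset_cong refl) (auto simp: comps_def)
  have S0: "S = cls \<phi> (set_mset m) r \<longleftrightarrow> r \<in> S" if "S \<in> comps m" for S
    using comps_cls[OF that, of r] cls_self[of r \<phi> "set_mset m"] by blast
  have ins: "insert (cls \<phi> (set_mset m) r) f.Cs = comps m" unfolding f.insert_Cs comps_def ..
  have r0: "cls \<phi> (set_mset m) r \<in> comps m" using rV by (simp add: comps_def)
  have D: "part f.edge_cls S (surplus m) \<in> f.edge_doubles S \<longleftrightarrow> doubled m S" if S: "S \<in> comps m" for S
  proof (cases "r \<in> S")
    case True
    then show ?thesis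
      unfolding part[OF S] f.edge_doubles_def doubled_def using S0[OF S] surplus_in_edges[of _ m S] by auto
  next
    case False
    then have nS: "S \<noteq> cls \<phi> (set_mset m) r" using S0[OF S] by blast
    have "\<phi> e \<subseteq> S" if "surplus_in m S = {#e, f#}" for e f using surplus_in_edges[of e m S] that by simp
    then show ?thesis
      unfolding part[OF S] f.edge_doubles_def doubled_def if_not_P[OF nS] if_not_P[OF False] mem_Collect_eq by blast
  qed
  have D': "surplus_in m S \<in> f.edge_doubles S \<longleftrightarrow> doubled m S" if "S \<in> comps m" for S
    using D[OF that] unfolding part[OF that] .
  have Cs: "S \<in> f.Cs \<longleftrightarrow> S \<in> comps m \<and> r \<notin> S" for S
    using S0 by (auto simp: f.Cs_def comps_def)
  have small: "excess m S \<le> 1 \<longleftrightarrow> (if r \<in> S then surplus_in m S = {#} else size (surplus_in m S) \<le> 1)" for S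
    by (simp add: excess_def)
  have "(\<forall>S\<in>comps m. excess m S \<le> 1 \<or> doubled m S) \<longleftrightarrow>
    (\<forall>S\<in>f.Cs. size (part f.edge_cls S (surplus m)) \<le> 1 \<or> part f.edge_cls S (surplus m) \<in> f.edge_doubles S) \<and>
    (part f.edge_cls (cls \<phi> (set_mset m) r) (surplus m) = {#} \<or>
     part f.edge_cls (cls \<phi> (set_mset m) r) (surplus m) \<in> f.edge_doubles (cls \<phi> (set_mset m) r))"
    (is "?l \<longleftrightarrow> ?a \<and> ?b")
  proof -
    have a: "?a \<longleftrightarrow> (\<forall>S\<in>f.Cs. excess m S \<le> 1 \<or> doubled m S)"
      by (rule ball_cong[OF refl]) (simp add: Cs part D' small del: One_nat_def)
    have b: "?b \<longleftrightarrow> excess m (cls \<phi> (set_mset m) r) \<le> 1 \<or> doubled m (cls \<phi> (set_mset m) r)"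
      using part[OF r0] D[OF r0] small cls_self[of r \<phi> "set_mset m"] by auto
    show ?thesis unfolding a b ins[symmetric] by blast
  qed
  moreover have "(\<forall>S\<in>comps m. \<forall>S'\<in>comps m. doubled m S \<longrightarrow> doubled m S' \<longrightarrow> S = S') \<longleftrightarrow>
    (\<forall>S\<in>comps m. \<forall>S'\<in>comps m. part f.edge_cls S (surplus m) \<in> f.edge_doubles S \<longrightarrow>
      part f.edge_cls S' (surplus m) \<in> f.edge_doubles S' \<longrightarrow> S = S')"
    by (intro ball_cong refl) (simp add: D)
  ultimately show ?thesis
    unfolding valid_def mixed_def mem_Collect_eq ins using E fo set_surplus[of m] by argo
qed

end

lemma size_2_mset:
  assumes "size M = 2"
  shows "\<exists>e f. M = {#e, f#}"
proof -
  obtain e N where "M = add_mset e N" "size N = 1"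
    using assms by (metis One_nat_def Suc_1 size_eq_Suc_imp_eq_union size_add_mset add_mset_add_single nat.inject)
  then show ?thesis by (metis size_1_singleton_mset)
qed

text \<open>In the given definition uniqueness concerns all components of excess 2, in
  \<open>valid\<close> only the doubled ones. These agree, because (C3) makes every component of
  excess 2 doubled.\<close>

lemma two_weighted_forest_iff:
  assumes d: "biconing_data G A B"
  shows "two_weighted_forest G A B (set_mset m) (count m) \<longleftrightarrow>
    rooted_graph.valid (bends G) (base_verts G) ApexBar (inA A) (edges (reduced G A B)) m"
proof -
  let ?H = "reduced G A B" and ?F = "set_mset m"
  interpret rooted_bigraph "bends G" "base_verts G" ApexBar "inA A" "edges ?H"
    by (rule rooted_bigraph_reduced[OF d])
  have ac: "acyclic_set ?H ?F \<longleftrightarrow> forest (bends G) ?F" if F: "?F \<subseteq> edges ?H"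
  proof -
    have "ends ?H e \<subseteq> verts ?H" if "e \<in> ?F" for e
      using reduced_ends[OF d subsetD[OF F that]] unfolding reduced_simps(1,2) by auto
    then show ?thesis using acyclic_set_iff_forest[of ?F ?H] unfolding reduced_simps(1) by blast
  qed
  have co: "components (spanning_subgraph ?H ?F) = comps m" if F: "?F \<subseteq> edges ?H"
  proof -
    have "ends ?H e \<subseteq> verts ?H" if "e \<in> ?F" for e
      using reduced_ends[OF d subsetD[OF F that]] unfolding reduced_simps(1,2) by auto
    then show ?thesis using components_eq[of ?F ?H] unfolding reduced_simps(1,2) comps_def by blast
  qed
  have ex: "excess_weight ?H ?F (count m) S = excess m S" for S
    unfolding excess_weight_def excess_def size_surplus_in component_edges_def reduced_simps(1) ..
  have we: "weighted_edges ?H ?F (count m) S = set_mset (surplus_in m S)" for S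
    unfolding weighted_edges_def component_edges_def set_surplus_in reduced_simps(1) by auto
  have key: "doubled m S \<longleftrightarrow> excess m S = 2 \<and> odd_crossing G A B ?F (count m) S"
    if F: "?F \<subseteq> edges ?H" "forest (bends G) ?F" for S
  proof (cases "ApexBar \<in> S")
    case True
    have o: "odd_crossing G A B ?F (count m) S \<longleftrightarrow> oddroot (bends G) (inA A) ?F ApexBar f" if "surplus_in m S = {#f#}" for f
      using that by (intro odd_crossing_root[OF d F True]) (simp add: we)
    have "excess m S = 2 \<longleftrightarrow> (\<exists>f. surplus_in m S = {#f#})"
      using True size_1_singleton_mset[of "surplus_in m S"] by (auto simp: excess_def)
    then show ?thesis using True o unfolding doubled_def by auto
  next
    case False
    have o: "odd_crossing G A B ?F (count m) S \<longleftrightarrow> oddpath (bends G) (inA A) ?F e f" if "surplus_in m S = {#e, f#}" for e f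
      using that by (intro odd_crossing_pair[OF d F False]) (simp add: we)
    have "excess m S = 2 \<longleftrightarrow> (\<exists>e f. surplus_in m S = {#e, f#})"
      using False size_2_mset[of "surplus_in m S"] by (auto simp: excess_def)
    then show ?thesis using False o unfolding doubled_def by auto
  qed
  have ge1: "\<forall>e\<in>?F. 1 \<le> count m e" by (simp add: Suc_le_eq)
  show ?thesis
  proof (cases "?F \<subseteq> edges ?H \<and> forest (bends G) ?F")
    case True
    then have F: "?F \<subseteq> edges ?H" "forest (bends G) ?F" by auto
    note k = key[OF F]
    have "two_weighted_forest G A B ?F (count m) \<longleftrightarrow>
      (\<forall>S\<in>comps m. \<forall>S'\<in>comps m. excess m S = 2 \<and> excess m S' = 2 \<longrightarrow> S = S') \<and>
      (\<forall>S\<in>comps m. excess m S \<noteq> 2 \<longrightarrow> excess m S = 0 \<or> excess m S = 1) \<and>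
      (\<forall>S\<in>comps m. excess m S = 2 \<longrightarrow> odd_crossing G A B ?F (count m) S)"
      unfolding two_weighted_forest_def Let_def ac[OF F(1)] co[OF F(1)] ex using F ge1 by blast
    moreover have "valid m \<longleftrightarrow> (\<forall>S\<in>comps m. excess m S \<le> 1 \<or> doubled m S) \<and>
     (\<forall>S\<in>comps m. \<forall>S'\<in>comps m. doubled m S \<longrightarrow> doubled m S' \<longrightarrow> S = S')"
      unfolding valid_def using F by blast
    moreover have "excess m S \<le> 1 \<longleftrightarrow> excess m S = 0 \<or> excess m S = 1" for S by auto
    ultimately show ?thesis unfolding k by (smt (verit) numeral_eq_one_iff one_neq_zero semiring_norm(85) zero_neq_numeral)
  next
    case False
    then show ?thesis unfolding two_weighted_forest_def Let_def valid_def using ac by blast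
  qed
qed

text \<open>Lets an arbitrary weighting be replaced by the exponents of its monomial, which vanish
  off \<open>F\<close>.\<close>

lemma two_weighted_forest_cong:
  assumes "\<And>e. e \<in> F \<Longrightarrow> \<omega> e = \<omega>' e"
  shows "two_weighted_forest G A B F \<omega> \<longleftrightarrow> two_weighted_forest G A B F \<omega>'"
proof -
  have "excess_weight H F \<omega> = excess_weight H F \<omega>'" for H :: "('a bvert, ('a, 'b) bedge) mgraph"
    using assms by (auto simp: fun_eq_iff excess_weight_def component_edges_def intro!: sum.cong)
  moreover have "weighted_edges H F \<omega> = weighted_edges H F \<omega>'" for H :: "('a bvert, ('a, 'b) bedge) mgraph"
    using assms by (auto simp: fun_eq_iff weighted_edges_def component_edges_def)
  moreover have "(\<forall>e\<in>F. 1 \<le> \<omega> e) \<longleftrightarrow> (\<forall>e\<in>F. 1 \<le> \<omega>' e)" using assms by auto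
  ultimately show ?thesis unfolding two_weighted_forest_def odd_crossing_def Let_def by presburger
qed

lemma count_sum_replicate:
  "finite F \<Longrightarrow> count (\<Sum>e\<in>F. replicate_mset (\<omega> e) e) x = (if x \<in> F then \<omega> x else 0)"
  by (simp add: count_sum)

lemma forest_ideal_iff:
  assumes d: "biconing_data G A B"
  shows "m \<in> forest_ideal G A B r \<longleftrightarrow>
    rooted_graph.valid (bends G) (base_verts G) ApexBar (inA A) (edges (reduced G A B)) m"
  unfolding two_weighted_forest_iff[OF d, symmetric]
proof
  assume "m \<in> forest_ideal G A B r"
  then obtain F \<omega> where m: "m = (\<Sum>e\<in>F. replicate_mset (\<omega> e) e)" and t: "two_weighted_forest G A B F \<omega>"
    by (auto simp: forest_ideal_def)
  interpret rooted_bigraph "bends G" "base_verts G" ApexBar "inA A" "edges (reduced G A B)"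
    by (rule rooted_bigraph_reduced[OF d])
  have F: "finite F" "\<And>e. e \<in> F \<Longrightarrow> 1 \<le> \<omega> e"
  proof -
    have "F \<subseteq> edges (reduced G A B)" using t by (simp add: two_weighted_forest_def Let_def)
    then show "finite F" by (rule finite_subset[OF _ finE])
    show "1 \<le> \<omega> e" if "e \<in> F" for e using t that by (simp add: two_weighted_forest_def Let_def)
  qed
  have c: "count m e = (if e \<in> F then \<omega> e else 0)" for e unfolding m by (rule count_sum_replicate[OF F(1)])
  have "e \<in># m \<longleftrightarrow> e \<in> F" for e using F(2)[of e] c[of e] by (auto simp flip: count_greater_zero_iff)
  then have "set_mset m = F" by blast
  moreover have "two_weighted_forest G A B F (count m)"
    using t two_weighted_forest_cong[of F \<omega> "count m" G A B] c by simp
  ultimately show "two_weighted_forest G A B (set_mset m) (count m)" by simp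
next
  assume t: "two_weighted_forest G A B (set_mset m) (count m)"
  have "m = (\<Sum>e\<in>set_mset m. replicate_mset (count m e) e)"
    by (rule multiset_eqI) (simp add: count_sum_replicate not_in_iff)
  then show "m \<in> forest_ideal G A B r" using t unfolding forest_ideal_def by blast
qed

text \<open>The map \<open>t\<close> of \<open>rooted_cone\<close>, giving each vertex the tree edge
  it owns. The vertex 0 owns none, hence the arbitrary value.\<close>

fun cone_edge :: "'v set \<Rightarrow> 'v bvert \<Rightarrow> ('v, 'e) bedge" where
  "cone_edge A Apex = undefined"
| "cone_edge A ApexBar = Spine"
| "cone_edge A (Base v) = (if v \<in> A then Cone v else ConeBar v)"

lemma base_tree_eq:
  assumes "biconing_data G A B"
  shows "base_tree A B = cone_edge A ` base_verts G"
proof -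
  have "verts G = A \<union> (B - A)" using assms by (auto simp: biconing_data_def)
  then show ?thesis by (force simp: base_tree_def base_verts_def image_image)
qed

lemma cone_edge_ends:
  assumes "x \<in> base_verts G"
  shows "bends G (cone_edge A x) = {x, if inA A x \<or> x = ApexBar then Apex else ApexBar}"
proof -
  have A: "inA A (Base v) \<longleftrightarrow> v \<in> A" for v by (auto simp: inA_def)
  consider "x = ApexBar" | v where "x = Base v" using assms by (auto simp: base_verts_def)
  then show ?thesis by cases (simp_all add: A insert_commute)
qed

lemma inj_cone_edge: "inj_on (cone_edge A) (base_verts G)"
  by (auto simp: inj_on_def base_verts_def split: if_splits)

lemma rooted_cone_biconing:
  assumes d: "biconing_data G A B" and I: "I \<subseteq> edges (reduced G A B)" and fo: "forest (bends G) I"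
  shows "rooted_cone (bends G) (base_verts G) ApexBar (inA A) I Apex (cone_edge A)"
proof -
  interpret rooted_bigraph "bends G" "base_verts G" ApexBar "inA A" "edges (reduced G A B)"
    by (rule rooted_bigraph_reduced[OF d])
  show ?thesis
  proof
    show "\<exists>u\<in>base_verts G. \<exists>v\<in>base_verts G. bends G e = {u, v}" if "e \<in> I" for e
      using endsE I that by blast
    show "finite I" by (rule finite_subset[OF I finE])
    show "Apex \<notin> base_verts G" by (auto simp: base_verts_def)
    show "cone_edge A ` base_verts G \<inter> I = {}"
      using I unfolding base_tree_eq[OF d, symmetric] reduced_simps(3) by blast
  qed (fact finV rV \<sigma>r fo inj_cone_edge cone_edge_ends)+
qed

lemma fin_mgraph_biconing:
  assumes "biconing_data G A B"
  shows "fin_mgraph (biconing G A B)"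
proof -
  have fin: "finite (verts G)" "finite (edges G)" "A \<subseteq> verts G" "B \<subseteq> verts G"
    and ends: "\<And>e. e \<in> edges G \<Longrightarrow> ends G e \<subseteq> verts G \<and> card (ends G e) \<in> {1, 2}"
    using assms by (auto simp: biconing_data_def fin_mgraph_def)
  have "card (Base ` X) = card X" for X :: "'a set" by (simp add: card_image inj_on_def)
  then show ?thesis
    using fin ends finite_subset[OF fin(3,1)] finite_subset[OF fin(4,1)]
    unfolding fin_mgraph_def biconing_simps base_verts_def by fastforce
qed

lemma indep_biconing_iff:
  assumes "biconing_data G A B"
  shows "F \<in> indep (graphic_matroid (biconing G A B)) \<longleftrightarrow> F \<subseteq> edges (biconing G A B) \<and> forest (bends G) F"
  using graphic_matroid_indep[OF fin_mgraph_biconing[OF assms]] by (simp only: biconing_simps(1))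

lemma base_tree_subset:
  assumes "biconing_data G A B"
  shows "base_tree A B \<subseteq> edges (biconing G A B)"
  unfolding base_tree_def biconing_simps by auto

text \<open>Independence is the case \<open>I = {}\<close> of \<open>admissible_imp_forest\<close>:
  all components are single vertices and only that of 0-bar is doubly attached. The tree has one
  edge less than there are vertices, which bounds every acyclic set.\<close>

lemma base_tree_basis:
  assumes d: "biconing_data G A B"
  shows "is_basis (graphic_matroid (biconing G A B)) (base_tree A B)" (is "is_basis ?M ?T")
  unfolding is_basis_def
proof (intro conjI ballI impI)
  interpret c: rooted_cone "bends G" "base_verts G" ApexBar "inA A" "{}" Apex "cone_edge A"
    by (rule rooted_cone_biconing[OF d]) (auto simp: forest_def)
  have K: "cls (bends G) {} x = {x}" for x by (auto simp: cls_def adj_def)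
  have doubly_attached: "S = {ApexBar}" if "c.doubly_attached (base_verts G) S" "S \<in> cls (bends G) {} ` base_verts G" for S
    using that unfolding c.doubly_attached_def by (auto simp: K split: if_splits)
  have "c.admissible (base_verts G)"
    unfolding c.admissible_def using doubly_attached by (auto simp: K)
  then have "forest (bends G) ?T"
    using c.admissible_imp_forest[OF order_refl] unfolding base_tree_eq[OF d] by simp
  then show T: "?T \<in> indep ?M" unfolding indep_biconing_iff[OF d] using base_tree_subset[OF d] by simp
  fix X assume X: "X \<in> indep ?M" and TX: "?T \<subseteq> X"
  have fin: "fin_mgraph (biconing G A B)" by (rule fin_mgraph_biconing[OF d])
  have fX: "X \<subseteq> edges (biconing G A B)" "forest (bends G) X" using X unfolding indep_biconing_iff[OF d] by auto
  have finX: "finite X" using fX(1) fin finite_subset unfolding fin_mgraph_def by blast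
  have finV: "finite (insert Apex (base_verts G))" using c.finV by simp
  have 1: "card X + card (cls (bends G) X ` insert Apex (base_verts G)) = card (insert Apex (base_verts G))"
    using fin_mgraph_ends[OF fin] fX(1) unfolding biconing_simps(1,2)
    by (intro forest_card[OF finX finV fX(2)]) blast
  have 2: "0 < card (cls (bends G) X ` insert Apex (base_verts G))" using finV by (simp add: card_gt_0_iff)
  have 3: "card (insert Apex (base_verts G)) = Suc (card (base_verts G))"
    using c.finV c.zV by simp
  have 4: "card ?T = card (base_verts G)"
    unfolding base_tree_eq[OF d] by (rule card_image[OF inj_cone_edge])
  have "card X \<le> card ?T" unfolding 4 using 1[unfolded 3] 2 by linarith
  then show "X = ?T" using card_seteq[OF finX TX] by simp
qed

text \<open>A monomial with support \<open>I\<close> is the squarefree one times its surplus, so its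
  degree exceeds \<open>card I\<close> by the size of the surplus; \<open>h_vector_eq\<close> counts
  the surpluses.\<close>

lemma count_forest_ideal:
  assumes d: "biconing_data G A B" and I: "I \<in> indep (graphic_matroid (biconing G A B))" "I \<inter> base_tree A B = {}"
  shows "int (card {m \<in> forest_ideal G A B r. size m = card I + j \<and> set_mset m = I}) =
    h_vector (Gamma (graphic_matroid (biconing G A B)) (base_tree A B) I) j"
proof -
  let ?M = "graphic_matroid (biconing G A B)"
  have sub: "I \<subseteq> edges (biconing G A B)" and fo: "forest (bends G) I" using I(1) unfolding indep_biconing_iff[OF d] by auto
  have Ir: "I \<subseteq> edges (reduced G A B)" using sub I(2) unfolding reduced_simps(3) by blast
  interpret rooted_bigraph "bends G" "base_verts G" ApexBar "inA A" "edges (reduced G A B)"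
    by (rule rooted_bigraph_reduced[OF d])
  interpret c: rooted_cone "bends G" "base_verts G" ApexBar "inA A" I Apex "cone_edge A"
    by (rule rooted_cone_biconing[OF d Ir fo])
  let ?X = "mixed I c.edge_cls c.Cs (cls (bends G) I ApexBar) c.edge_doubles"
  have "indep (Gamma ?M (base_tree A B) I) = {W. W \<subseteq> cone_edge A ` base_verts G \<and> forest (bends G) (I \<union> W)}"
    unfolding Gamma_def matroid.select_convs indep_biconing_iff[OF d] base_tree_eq[OF d, symmetric]
    using base_tree_subset[OF d] sub by (auto simp: Un_commute)
  then have h: "h_vector (Gamma ?M (base_tree A B) I) j = int (card {N\<in>?X. size N = j})" by (rule c.h_vector_eq)
  have mem: "m \<in> forest_ideal G A B r \<longleftrightarrow> surplus m \<in> ?X" if "set_mset m = I" for m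
    unfolding forest_ideal_iff[OF d] using valid_iff_mixed[of m] Ir fo unfolding that by simp
  have "bij_betw (\<lambda>N. mset_set I + N) {N\<in>?X. size N = j}
    {m \<in> forest_ideal G A B r. size m = card I + j \<and> set_mset m = I}"
  proof (rule bij_betwI')
    fix N assume N: "N \<in> {N\<in>?X. size N = j}"
    have s: "set_mset (mset_set I + N) = I" using N c.finI by (auto simp: mixed_def)
    moreover have "surplus (mset_set I + N) = N" unfolding surplus_def s by simp
    ultimately show "mset_set I + N \<in> {m \<in> forest_ideal G A B r. size m = card I + j \<and> set_mset m = I}"
      using N mem[OF s] by simp
  next
    fix m assume m: "m \<in> {m \<in> forest_ideal G A B r. size m = card I + j \<and> set_mset m = I}"
    have "m = mset_set (set_mset m) + surplus m"
    proof (rule multiset_eqI)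
      show "count m x = count (mset_set (set_mset m) + surplus m) x" for x
        by (cases "x \<in># m") (auto simp: count_surplus not_in_iff Suc_le_eq)
    qed
    then have eq: "m = mset_set I + surplus m" using m by simp
    then have "size m = card I + size (surplus m)" by (metis size_mset_set size_union)
    then show "\<exists>N\<in>{N\<in>?X. size N = j}. m = mset_set I + N" using m mem[of m] eq by auto
  qed simp
  then have "card {N\<in>?X. size N = j} = card {m \<in> forest_ideal G A B r. size m = card I + j \<and> set_mset m = I}"
    by (rule bij_betw_same_card)
  then show ?thesis unfolding h by simp
qed

lemma pure_forest_ideal:
  assumes d: "biconing_data G A B"
  shows "pure_order_ideal (forest_ideal G A B r)"
proof -
  interpret rooted_bigraph "bends G" "base_verts G" ApexBar "inA A" "edges (reduced G A B)"
    by (rule rooted_bigraph_reduced[OF d])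
  have "size m + card isolated + 1 = card (base_verts G) + (if has_crossing then 1 else 0)"
    if "m \<in> maximal_monomials (forest_ideal G A B r)" for m
  proof (rule maximal_size)
    show "valid m" using that by (simp add: maximal_monomials_def forest_ideal_iff[OF d])
    show "\<not> valid (add_mset e m)" for e
    proof
      assume "valid (add_mset e m)"
      then have "add_mset e m \<in> forest_ideal G A B r" using forest_ideal_iff[OF d] by blast
      then have "add_mset e m = m" using that unfolding maximal_monomials_def by auto
      then show False by simp
    qed
  qed
  then have "size m = size n" if "m \<in> maximal_monomials (forest_ideal G A B r)"
    "n \<in> maximal_monomials (forest_ideal G A B r)" for m n
    using that by (metis add_right_cancel)
  moreover have "order_ideal (forest_ideal G A B r)"
    unfolding order_ideal_def using valid_down forest_ideal_iff[OF d] by blast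
  ultimately show ?thesis unfolding pure_order_ideal_def by blast
qed

section \<open>Restriction to an independent set\<close>

lemma bends_sub_base: "bends (sub_base G I) = bends G"
proof
  show "bends (sub_base G I) e = bends G e" for e
    by (cases e) (simp_all add: sub_base_def spanning_subgraph_def)
qed

text \<open>The reduced graph of the smaller biconing has the same vertices and sides, and its edge
  set is exactly \<open>I\<close>. Hence the two notions of \<open>valid\<close> differ only in the
  bound on the support.\<close>

lemma forest_ideal_restriction:
  assumes d: "biconing_data G A B" and I: "I \<in> indep (graphic_matroid (biconing G A B))" "I \<inter> base_tree A B = {}"
  shows "biconing_data (sub_base G I) A (sub_coneset A B I)"
    and "base_tree A B = base_tree A (sub_coneset A B I)"
    and "matroid_restrict (graphic_matroid (biconing G A B)) (base_tree A B \<union> I) =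
      graphic_matroid (biconing (sub_base G I) A (sub_coneset A B I))"
    and "forest_ideal G A B r \<inter> monomials_in I = forest_ideal (sub_base G I) A (sub_coneset A B I) r'"
proof -
  let ?G = "sub_base G I" and ?B = "sub_coneset A B I"
  have sub: "I \<subseteq> edges (biconing G A B)" using I(1) unfolding indep_biconing_iff[OF d] by auto
  have Ir: "I \<subseteq> edges (reduced G A B)" using sub I(2) unfolding reduced_simps(3) by blast
  show d': "biconing_data ?G A ?B"
    using d finite_subset[of _ "edges G"]
    by (auto simp: biconing_data_def fin_mgraph_def sub_base_def spanning_subgraph_def sub_coneset_def)
  show T: "base_tree A B = base_tree A ?B" by (auto simp: base_tree_def sub_coneset_def)
  have red: "edges (reduced ?G A ?B) = I"
    using Ir unfolding reduced_simps(4) by (auto simp: sub_base_def spanning_subgraph_def sub_coneset_def)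
  have ed: "edges (biconing ?G A ?B) = base_tree A B \<union> I"
    using red base_tree_subset[OF d'] unfolding reduced_simps(3) T[symmetric] by auto
  have bv: "base_verts ?G = base_verts G" by (simp add: base_verts_def sub_base_def spanning_subgraph_def)
  have ind: "indep (matroid_restrict (graphic_matroid (biconing G A B)) (base_tree A B \<union> I)) =
      indep (graphic_matroid (biconing ?G A ?B))"
  proof (rule set_eqI)
    fix F
    show "F \<in> indep (matroid_restrict (graphic_matroid (biconing G A B)) (base_tree A B \<union> I)) \<longleftrightarrow>
      F \<in> indep (graphic_matroid (biconing ?G A ?B))"
      unfolding indep_biconing_iff[OF d'] ed bends_sub_base
      using base_tree_subset[OF d] sub by (auto simp: matroid_restrict_def indep_biconing_iff[OF d])
  qed
  have gr: "ground (matroid_restrict (graphic_matroid (biconing G A B)) (base_tree A B \<union> I)) =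
      ground (graphic_matroid (biconing ?G A ?B))"
    using base_tree_subset[OF d] sub by (auto simp: matroid_restrict_def graphic_matroid_def ed)
  show "matroid_restrict (graphic_matroid (biconing G A B)) (base_tree A B \<union> I) =
      graphic_matroid (biconing ?G A ?B)"
    using ind gr by simp
  interpret g: rooted_bigraph "bends G" "base_verts G" ApexBar "inA A" "edges (reduced G A B)"
    by (rule rooted_bigraph_reduced[OF d])
  interpret g': rooted_bigraph "bends G" "base_verts G" ApexBar "inA A" I
    using rooted_bigraph_reduced[OF d'] unfolding red bends_sub_base bv .
  show "forest_ideal G A B r \<inter> monomials_in I = forest_ideal ?G A ?B r'"
    unfolding set_eq_iff Int_iff forest_ideal_iff[OF d] forest_ideal_iff[OF d'] red bends_sub_base bv
      g.valid_def g'.valid_def monomials_in_def mem_Collect_eq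
    using Ir by blast
qed

theorem theorem6p3:
  fixes G :: "('v, 'e) mgraph"
    and A B :: "'v set"
    and \<Delta> :: "('v, 'e) bedge matroid"
    and T\<^sub>0 :: "('v, 'e) bedge set"
    and r :: "('v, 'e) bedge rel"
  assumes biconed: "biconing_data G A B"
    and Delta: "\<Delta> = graphic_matroid (biconing G A B)"
    and T0: "T\<^sub>0 = base_tree A B"
    and order: "linear_order_on (ground \<Delta> - T\<^sub>0) r"
  shows
   "based_matroid \<Delta> T\<^sub>0 r \<and>
    pure_order_ideal (forest_ideal G A B r) \<and>
    forest_ideal G A B r \<subseteq> monomials_in (ground \<Delta> - T\<^sub>0) \<and>
    (\<forall>m\<in>forest_ideal G A B r. \<exists>I\<in>indep \<Delta>. I \<inter> T\<^sub>0 = {} \<and> set_mset m = I) \<and>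
    (\<forall>I\<in>indep \<Delta>. I \<inter> T\<^sub>0 = {} \<longrightarrow> (\<forall>j.
           int (card {m \<in> forest_ideal G A B r. size m = card I + j \<and> set_mset m = I})
             = h_vector (Gamma \<Delta> T\<^sub>0 I) j)) \<and>
    (\<forall>I\<in>indep \<Delta>. I \<inter> T\<^sub>0 = {} \<longrightarrow>
           biconing_data (sub_base G I) A (sub_coneset A B I) \<and>
           matroid_restrict \<Delta> (T\<^sub>0 \<union> I)
             = graphic_matroid (biconing (sub_base G I) A (sub_coneset A B I)) \<and>
           T\<^sub>0 = base_tree A (sub_coneset A B I) \<and>
           forest_ideal G A B r \<inter> monomials_in I
             = forest_ideal (sub_base G I) A (sub_coneset A B I) (Restr r I))"
proof -
  interpret rooted_bigraph "bends G" "base_verts G" ApexBar "inA A" "edges (reduced G A B)"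
    by (rule rooted_bigraph_reduced[OF biconed])
  have supp: "set_mset m \<subseteq> edges (biconing G A B) - base_tree A B \<and> forest (bends G) (set_mset m)"
    if "m \<in> forest_ideal G A B r" for m
  proof -
    have "valid m" using that forest_ideal_iff[OF biconed] by blast
    then have "set_mset m \<subseteq> edges (reduced G A B) \<and> forest (bends G) (set_mset m)"
      unfolding valid_def by blast
    then show ?thesis unfolding reduced_simps(3) .
  qed
  have g: "ground \<Delta> = edges (biconing G A B)" by (simp add: Delta graphic_matroid_def)
  have 1: "based_matroid \<Delta> T\<^sub>0 r"
    using is_matroid_graphic[OF fin_mgraph_biconing[OF biconed]] base_tree_basis[OF biconed] order
    by (simp add: based_matroid_def Delta T0)
  have 2: "forest_ideal G A B r \<subseteq> monomials_in (ground \<Delta> - T\<^sub>0)"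
    using supp unfolding g T0 monomials_in_def by blast
  have 3: "\<forall>m\<in>forest_ideal G A B r. \<exists>I\<in>indep \<Delta>. I \<inter> T\<^sub>0 = {} \<and> set_mset m = I"
  proof
    fix m assume "m \<in> forest_ideal G A B r"
    from supp[OF this] show "\<exists>I\<in>indep \<Delta>. I \<inter> T\<^sub>0 = {} \<and> set_mset m = I"
      unfolding Delta T0 by (intro bexI[of _ "set_mset m"]) (auto simp: indep_biconing_iff[OF biconed])
  qed
  have 4: "int (card {m \<in> forest_ideal G A B r. size m = card I + j \<and> set_mset m = I})
      = h_vector (Gamma \<Delta> T\<^sub>0 I) j" if "I \<in> indep \<Delta>" "I \<inter> T\<^sub>0 = {}" for I j
    using count_forest_ideal[OF biconed] that unfolding Delta T0 by blast
  have 5: "biconing_data (sub_base G I) A (sub_coneset A B I) \<and>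
      matroid_restrict \<Delta> (T\<^sub>0 \<union> I) = graphic_matroid (biconing (sub_base G I) A (sub_coneset A B I)) \<and>
      T\<^sub>0 = base_tree A (sub_coneset A B I) \<and>
      forest_ideal G A B r \<inter> monomials_in I = forest_ideal (sub_base G I) A (sub_coneset A B I) (Restr r I)"
    if I: "I \<in> indep \<Delta>" "I \<inter> T\<^sub>0 = {}" for I
  proof -
    note R = forest_ideal_restriction[OF biconed I(1)[unfolded Delta] I(2)[unfolded T0]]
    show ?thesis
      unfolding Delta T0 using R(1-3) R(4)[of r "Restr r I"] by (intro conjI)
  qed
  show ?thesis
    by (rule conjI[OF 1 conjI[OF pure_forest_ideal[OF biconed] conjI[OF 2 conjI[OF 3 conjI]]]])
      (intro ballI impI allI, rule 4 5, assumption+)+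
qed

end
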